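(* Let $L$ be a language (possibly with both relation and function symbols), let $\mathcal R$ be a Ramsey class of irreducible finite $L$-structures and let $\mathcal K$ be a hereditary locally finite subclass of $\mathcal R$ with the strong amalgamation property. Then $\mathcal K$ is a Ramsey class. Explicitly: for every pair of structures $\mathbf A,\mathbf B\in\mathcal K$ there exists a structure $\mathbf C\in\mathcal K$ such that $\mathbf C\longrightarrow(\mathbf B)^{\mathbf A}_2$.
   Context: Structures. A language $L$ consists of relation symbols and function symbols, each with an arity (a positive integer). An $L$-structure $\mathbf A$ has a countable (possibly empty) vertex set $A$, a relation $R_{\mathbf A}\subseteq A^r$ for each relation symbol $R$ of arity $r$, and a partial function $F_{\mathbf A}:\mathrm{Dom}(F_{\mathbf A})\to A$ with $\mathrm{Dom}(F_{\mathbf A})\subseteq A^r$ for each function symbol $F$ of arity $r$. A homomorphism $f:\mathbf A\to\mathbf B$ is a map $f:A\to B$ such that (applying $f$ coordinatewise) $f(R_{\mathbf A})\subseteq R_{\mathbf B}$, $f(\mathrm{Dom}(F_{\mathbf A}))\subseteq\mathrm{Dom}(F_{\mathbf B})$ and $f(F_{\mathbf A}(\bar x))=F_{\mathbf B}(f(\bar x))$ for $\bar x\in\mathrm{Dom}(F_{\mathbf A})$. An embedding is an injective homomorphism with $\bar x\in R_{\mathbf A}\iff f(\bar x)\in R_{\mathbf B}$ and $\bar x\in\mathrm{Dom}(F_{\mathbf A})\iff f(\bar x)\in\mathrm{Dom}(F_{\mathbf B})$ for all tuples $\bar x$. $\mathbf A$ is a substructure of $\mathbf B$ if $A\subseteq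 B$ and the inclusion is an embedding (so $A$ is closed under the functions of $\mathbf B$). Classes of structures are closed under isomorphism. A class is hereditary if it is closed under substructures. Ramsey. $\binom{\mathbf B}{\mathbf A}$ is the set of substructures of $\mathbf B$ isomorphic to $\mathbf A$. $\mathbf C\longrightarrow(\mathbf B)^{\mathbf A}_k$ means: for every partition of $\binom{\mathbf C}{\mathbf A}$ into $k$ classes there is $\widetilde{\mathbf B}\in\binom{\mathbf C}{\mathbf B}$ such that $\binom{\widetilde{\mathbf B}}{\mathbf A}$ is contained in one class. A class $\mathcal C$ is Ramsey if for all $\mathbf A,\mathbf B\in\mathcal C$ and all $k\ge1$ there is $\mathbf C\in\mathcal C$ with $\mathbf C\longrightarrow(\mathbf B)^{\mathbf A}_k$. Amalgamation. Given embeddings $\alpha_i:\mathbf A\to\mathbf B_i$ ($i=1,2$), a strong amalgamation of $\mathbf B_1,\mathbf B_2$ over $\mathbf A$ is a structure $\mathbf C$ with embeddings $\beta_i:\mathbf B_i\to\mathbf C$ such that $\beta_1\alpha_1=\beta_2\alpha_2$ and $\beta_1(B_1)\cap\beta_2(B_2)=\beta_1\alpha_1(A)$. It is free if moreover $C=\beta_1(B_1)\cup\beta_2(B_2)$ and no tuple in a relation of $\mathbf C$ or in the domain of a function of $\mathbf C$ contains both a vertex of $\beta_1(B_1\setminus\alpha_1(A))$ and a vertex of $\beta_2(B_2\setminus\alpha_2(A))$. $\mathcal K$ has the strong amalgamation property if for all $\mathbf A,\mathbf B_1,\mathbf B_2\in\mathcal K$ and all such embeddings there is a strong amalgamation in $\mathcal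 K$. Irreducibility and completion. A structure is irreducible if it is not a free amalgamation of two of its proper substructures. A homomorphism-embedding is a homomorphism whose restriction to every irreducible substructure is an embedding. An irreducible structure $\mathbf C'$ is a completion of $\mathbf C$ if there is a homomorphism-embedding $\mathbf C\to\mathbf C'$; it is a $\mathcal K$-completion if moreover $\mathbf C'\in\mathcal K$. Local finiteness. Let $\mathcal R$ be a class of finite irreducible structures and $\mathcal K\subseteq\mathcal R$. $\mathcal K$ is a locally finite subclass of $\mathcal R$ if for every $\mathbf C_0\in\mathcal R$ there is an integer $n=n(\mathbf C_0)$ such that every structure $\mathbf C$ satisfying the following has a $\mathcal K$-completion: (1) $\mathbf C_0$ is an $\mathcal R$-completion of $\mathbf C$; (2) every irreducible substructure of $\mathbf C$ is in $\mathcal K$; (3) every substructure of $\mathbf C$ with at most $n$ vertices has a $\mathcal K$-completion. *)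

theory Defs
  imports Main "HOL-Library.Countable_Set"
begin

record ('r, 'f) language =
  rel_syms :: "'r set"
  fun_syms :: "'f set"
  rel_arity :: "'r \<Rightarrow> nat"
  fun_arity :: "'f \<Rightarrow> nat"

definition is_language :: "('r, 'f) language \<Rightarrow> bool" where
  "is_language L \<longleftrightarrow>
     (\<forall>R\<in>rel_syms L. 0 < rel_arity L R) \<and> (\<forall>F\<in>fun_syms L. 0 < fun_arity L F)"

(* Tuples are lists; a partial function A^r -> A is a map from lists to option. *)
record ('v, 'r, 'f) struct =
  vertices :: "'v set"
  rel_interp :: "'r \<Rightarrow> 'v list set"
  fun_interp :: "'f \<Rightarrow> 'v list \<rightharpoonup> 'v"

definition tuples :: "'v set \<Rightarrow> nat \<Rightarrow> 'v list set" where
  "tuples X n = {x. length x = n \<and> set x \<subseteq> X}"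

(* The interpretation of symbols outside L is normalised to be empty, so that
   HOL equality of records is equality of L-structures; in particular,
   a substructure is determined by its vertex set. *)
definition is_struct :: "('r, 'f) language \<Rightarrow> ('v, 'r, 'f) struct \<Rightarrow> bool" where
  "is_struct L A \<longleftrightarrow>
     countable (vertices A) \<and>
     (\<forall>R\<in>rel_syms L. rel_interp A R \<subseteq> tuples (vertices A) (rel_arity L R)) \<and>
     (\<forall>F\<in>fun_syms L. dom (fun_interp A F) \<subseteq> tuples (vertices A) (fun_arity L F) \<and>
                      ran (fun_interp A F) \<subseteq> vertices A) \<and>
     (\<forall>R. R \<notin> rel_syms L \<longrightarrow> rel_interp A R = {}) \<and>
     (\<forall>F. F \<notin> fun_syms L \<longrightarrow> fun_interp A F = Map.empty)"

(* Maps between structures are total HOL functions; only their values on the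
   vertices of the source matter. *)
definition struct_hom ::
  "('r, 'f) language \<Rightarrow> ('v, 'r, 'f) struct \<Rightarrow> ('w, 'r, 'f) struct \<Rightarrow> ('v \<Rightarrow> 'w) \<Rightarrow> bool" where
  "struct_hom L A B f \<longleftrightarrow>
     is_struct L A \<and> is_struct L B \<and>
     f ` vertices A \<subseteq> vertices B \<and>
     (\<forall>R\<in>rel_syms L. map f ` rel_interp A R \<subseteq> rel_interp B R) \<and>
     (\<forall>F\<in>fun_syms L. map f ` dom (fun_interp A F) \<subseteq> dom (fun_interp B F) \<and>
        (\<forall>x\<in>dom (fun_interp A F).
           f (the (fun_interp A F x)) = the (fun_interp B F (map f x))))"

definition struct_emb ::
  "('r, 'f) language \<Rightarrow> ('v, 'r, 'f) struct \<Rightarrow> ('w, 'r, 'f) struct \<Rightarrow> ('v \<Rightarrow> 'w) \<Rightarrow> bool" where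
  "struct_emb L A B f \<longleftrightarrow>
     struct_hom L A B f \<and> inj_on f (vertices A) \<and>
     (\<forall>R\<in>rel_syms L. \<forall>x\<in>tuples (vertices A) (rel_arity L R).
        x \<in> rel_interp A R \<longleftrightarrow> map f x \<in> rel_interp B R) \<and>
     (\<forall>F\<in>fun_syms L. \<forall>x\<in>tuples (vertices A) (fun_arity L F).
        x \<in> dom (fun_interp A F) \<longleftrightarrow> map f x \<in> dom (fun_interp B F))"

definition struct_isomorphic ::
  "('r, 'f) language \<Rightarrow> ('v, 'r, 'f) struct \<Rightarrow> ('w, 'r, 'f) struct \<Rightarrow> bool" where
  "struct_isomorphic L A B \<longleftrightarrow> (\<exists>f. struct_emb L A B f \<and> f ` vertices A = vertices B)"

definition substructure ::
  "('r, 'f) language \<Rightarrow> ('v, 'r, 'f) struct \<Rightarrow> ('v, 'r, 'f) struct \<Rightarrow> bool" where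
  "substructure L A B \<longleftrightarrow> vertices A \<subseteq> vertices B \<and> struct_emb L A B id"

definition proper_substructure ::
  "('r, 'f) language \<Rightarrow> ('v, 'r, 'f) struct \<Rightarrow> ('v, 'r, 'f) struct \<Rightarrow> bool" where
  "proper_substructure L A B \<longleftrightarrow> substructure L A B \<and> A \<noteq> B"

definition struct_class :: "('r, 'f) language \<Rightarrow> ('v, 'r, 'f) struct set \<Rightarrow> bool" where
  "struct_class L \<K> \<longleftrightarrow>
     (\<forall>A\<in>\<K>. is_struct L A) \<and> (\<forall>A\<in>\<K>. \<forall>B. struct_isomorphic L A B \<longrightarrow> B \<in> \<K>)"

definition hereditary :: "('r, 'f) language \<Rightarrow> ('v, 'r, 'f) struct set \<Rightarrow> bool" where
  "hereditary L \<K> \<longleftrightarrow> (\<forall>B\<in>\<K>. \<forall>A. substructure L A B \<longrightarrow> A \<in> \<K>)"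

(* copies L B A is the set "B choose A". *)
definition copies ::
  "('r, 'f) language \<Rightarrow> ('v, 'r, 'f) struct \<Rightarrow> ('v, 'r, 'f) struct \<Rightarrow> ('v, 'r, 'f) struct set" where
  "copies L B A = {A'. substructure L A' B \<and> struct_isomorphic L A' A}"

(* C --> (B)^A_k; as usual for Ramsey partitions, classes may be empty. *)
definition ramsey_arrow ::
  "('r, 'f) language \<Rightarrow> ('v, 'r, 'f) struct \<Rightarrow> ('v, 'r, 'f) struct \<Rightarrow> ('v, 'r, 'f) struct \<Rightarrow> nat \<Rightarrow> bool"
where
  "ramsey_arrow L C B A k \<longleftrightarrow>
     (\<forall>P :: nat \<Rightarrow> ('v, 'r, 'f) struct set.
        (\<Union>i<k. P i) = copies L C A \<and> (\<forall>i<k. \<forall>j<k. i \<noteq> j \<longrightarrow> P i \<inter> P j = {}) \<longrightarrow>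
        (\<exists>B'\<in>copies L C B. \<exists>i<k. copies L B' A \<subseteq> P i))"

definition ramsey_class :: "('r, 'f) language \<Rightarrow> ('v, 'r, 'f) struct set \<Rightarrow> bool" where
  "ramsey_class L \<K> \<longleftrightarrow>
     (\<forall>A\<in>\<K>. \<forall>B\<in>\<K>. \<forall>k\<ge>1. \<exists>C\<in>\<K>. ramsey_arrow L C B A k)"

definition strong_amalgamation ::
  "('r, 'f) language \<Rightarrow> ('v, 'r, 'f) struct \<Rightarrow> ('v, 'r, 'f) struct \<Rightarrow> ('v, 'r, 'f) struct \<Rightarrow>
   ('v \<Rightarrow> 'v) \<Rightarrow> ('v \<Rightarrow> 'v) \<Rightarrow> ('v, 'r, 'f) struct \<Rightarrow> ('v \<Rightarrow> 'v) \<Rightarrow> ('v \<Rightarrow> 'v) \<Rightarrow> bool" where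
  "strong_amalgamation L A B1 B2 \<alpha>1 \<alpha>2 C \<beta>1 \<beta>2 \<longleftrightarrow>
     struct_emb L A B1 \<alpha>1 \<and> struct_emb L A B2 \<alpha>2 \<and>
     struct_emb L B1 C \<beta>1 \<and> struct_emb L B2 C \<beta>2 \<and>
     (\<forall>x\<in>vertices A. \<beta>1 (\<alpha>1 x) = \<beta>2 (\<alpha>2 x)) \<and>
     \<beta>1 ` vertices B1 \<inter> \<beta>2 ` vertices B2 = \<beta>1 ` \<alpha>1 ` vertices A"

definition free_amalgamation ::
  "('r, 'f) language \<Rightarrow> ('v, 'r, 'f) struct \<Rightarrow> ('v, 'r, 'f) struct \<Rightarrow> ('v, 'r, 'f) struct \<Rightarrow>
   ('v \<Rightarrow> 'v) \<Rightarrow> ('v \<Rightarrow> 'v) \<Rightarrow> ('v, 'r, 'f) struct \<Rightarrow> ('v \<Rightarrow> 'v) \<Rightarrow> ('v \<Rightarrow> 'v) \<Rightarrow> bool" where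
  "free_amalgamation L A B1 B2 \<alpha>1 \<alpha>2 C \<beta>1 \<beta>2 \<longleftrightarrow>
     strong_amalgamation L A B1 B2 \<alpha>1 \<alpha>2 C \<beta>1 \<beta>2 \<and>
     vertices C = \<beta>1 ` vertices B1 \<union> \<beta>2 ` vertices B2 \<and>
     (\<forall>x. (\<exists>R\<in>rel_syms L. x \<in> rel_interp C R) \<or> (\<exists>F\<in>fun_syms L. x \<in> dom (fun_interp C F)) \<longrightarrow>
        \<not> (set x \<inter> \<beta>1 ` (vertices B1 - \<alpha>1 ` vertices A) \<noteq> {} \<and>
           set x \<inter> \<beta>2 ` (vertices B2 - \<alpha>2 ` vertices A) \<noteq> {}))"

definition strong_amalgamation_property ::
  "('r, 'f) language \<Rightarrow> ('v, 'r, 'f) struct set \<Rightarrow> bool" where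
  "strong_amalgamation_property L \<K> \<longleftrightarrow>
     (\<forall>A\<in>\<K>. \<forall>B1\<in>\<K>. \<forall>B2\<in>\<K>. \<forall>\<alpha>1 \<alpha>2.
        struct_emb L A B1 \<alpha>1 \<and> struct_emb L A B2 \<alpha>2 \<longrightarrow>
        (\<exists>C\<in>\<K>. \<exists>\<beta>1 \<beta>2. strong_amalgamation L A B1 B2 \<alpha>1 \<alpha>2 C \<beta>1 \<beta>2))"

(* B1 and B2 sit in C by inclusion. Allowing arbitrary embeddings of B1, B2 into C
   would make infinite structures isomorphic to a proper substructure reducible. *)
definition irreducible_struct :: "('r, 'f) language \<Rightarrow> ('v, 'r, 'f) struct \<Rightarrow> bool" where
  "irreducible_struct L C \<longleftrightarrow>
     is_struct L C \<and>
     \<not> (\<exists>A B1 B2 \<alpha>1 \<alpha>2. proper_substructure L B1 C \<and> proper_substructure L B2 C \<and>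
          free_amalgamation L A B1 B2 \<alpha>1 \<alpha>2 C id id)"

definition hom_embedding ::
  "('r, 'f) language \<Rightarrow> ('v, 'r, 'f) struct \<Rightarrow> ('w, 'r, 'f) struct \<Rightarrow> ('v \<Rightarrow> 'w) \<Rightarrow> bool" where
  "hom_embedding L A B f \<longleftrightarrow>
     struct_hom L A B f \<and>
     (\<forall>S. substructure L S A \<and> irreducible_struct L S \<longrightarrow> struct_emb L S B f)"

(* is_completion L C C': C' is a completion of C. *)
definition is_completion ::
  "('r, 'f) language \<Rightarrow> ('v, 'r, 'f) struct \<Rightarrow> ('w, 'r, 'f) struct \<Rightarrow> bool" where
  "is_completion L C C' \<longleftrightarrow> irreducible_struct L C' \<and> (\<exists>f. hom_embedding L C C' f)"

definition has_completion_in ::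
  "('r, 'f) language \<Rightarrow> ('w, 'r, 'f) struct set \<Rightarrow> ('v, 'r, 'f) struct \<Rightarrow> bool" where
  "has_completion_in L \<K> C \<longleftrightarrow> (\<exists>C'\<in>\<K>. is_completion L C C')"

definition finite_irreducible_class ::
  "('r, 'f) language \<Rightarrow> ('v, 'r, 'f) struct set \<Rightarrow> bool" where
  "finite_irreducible_class L \<R> \<longleftrightarrow>
     struct_class L \<R> \<and> (\<forall>A\<in>\<R>. finite (vertices A) \<and> irreducible_struct L A)"

(* C ranges over all countable structures, so finiteness of S is stated
   explicitly: card is 0 on infinite sets. *)
definition locally_finite_subclass ::
  "('r, 'f) language \<Rightarrow> ('v, 'r, 'f) struct set \<Rightarrow> ('v, 'r, 'f) struct set \<Rightarrow> bool" where
  "locally_finite_subclass L \<R> \<K> \<longleftrightarrow>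
     finite_irreducible_class L \<R> \<and> struct_class L \<K> \<and> \<K> \<subseteq> \<R> \<and>
     (\<forall>C0\<in>\<R>. \<exists>n::nat. \<forall>C :: ('v, 'r, 'f) struct.
        is_struct L C \<and>
        is_completion L C C0 \<and>
        (\<forall>S. substructure L S C \<and> irreducible_struct L S \<longrightarrow> S \<in> \<K>) \<and>
        (\<forall>S. substructure L S C \<and> finite (vertices S) \<and> card (vertices S) \<le> n \<longrightarrow>
              has_completion_in L \<K> S)
        \<longrightarrow> has_completion_in L \<K> C)"

end

theory Submission
  imports Defs "HOL-Library.FuncSet"
begin

text \<open>Let \<open>A\<close> and \<open>B\<close> be members of the class \<open>\<K>\<close>. The larger class \<open>\<R>\<close> is Ramsey, so some \<open>C0\<close> in
\<open>\<R>\<close> arrows \<open>B\<close> for colourings of copies of \<open>A\<close>, but \<open>C0\<close> may contain configurations that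
no member of \<open>\<K>\<close> contains. The proof unfolds \<open>C0\<close> to a structure \<open>C\<close> that maps to \<open>C0\<close> by a
homomorphism-embedding, still has the arrow, and in which every small part can be completed in
\<open>\<K>\<close>. Local finiteness then completes all of \<open>C\<close>. As \<open>B\<close> is irreducible, its copies in \<open>C\<close>
survive in the completion, and so the completion has the arrow as well
(\<open>arrows_image\<close>).

The unfolding is the partite construction of Nesetril and Rodl. It starts with disjoint copies of
\<open>B\<close>, one for each copy in the target structure (\<open>initial_system\<close>), and treats the copies \<open>A1\<close> of
\<open>A\<close> in the target one after the other. If \<open>P\<close> is the structure reached so far and \<open>\<pi>\<close> its
projection, form a fibre power \<open>Z\<close> of the part of \<open>P\<close> that lies over \<open>A1\<close>, and glue a copy of
\<open>P\<close> to \<open>Z\<close> along every combinatorial line whose letters are the copies of \<open>A\<close> over \<open>A1\<close>. By the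
Hales--Jewett theorem, each colouring admits one of these copies of \<open>P\<close> in which all copies of
\<open>A\<close> over \<open>A1\<close> have the same colour (\<open>step_arrow\<close>). When all \<open>A1\<close> have been treated, the colour of a
copy of \<open>A\<close> in a suitable copy of the initial system depends only on its projection, and the arrow
of the target finishes the argument (\<open>one_round\<close>).

What has to be controlled is which parts of the new structure can be completed. The measure used
here is the number \<open>t\<close> of irreducible sets involved: \<open>completable \<K> t X\<close> says that at most \<open>t\<close>
irreducible sets of \<open>X\<close> are always embedded by one common map into a member of \<open>\<K>\<close>. A structure with
\<open>n\<close> vertices has at most \<open>2 ^ n\<close> irreducible sets, and these cover all of its vertices and
all tuples of its relations and function domains, so the value \<open>t = 2 ^ n\<close> takes care of all
substructures with \<open>n\<close> vertices (\<open>small_substructure_completion\<close>). Counting irreducible sets has the advantage that it is not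
disturbed by closures under functions.

One round of the construction raises \<open>t\<close> by one, and this is the heart of the matter
(\<open>step_completable\<close>). Given \<open>t\<close> irreducible sets in the glued structure, choose the line \<open>l0\<close>
whose copy of \<open>P\<close> contains most of them, and a coordinate \<open>i\<close> at which \<open>l0\<close> moves. Reading
off coordinate \<open>i\<close> retracts \<open>Z\<close> and all lines moving at \<open>i\<close> to \<open>P\<close>. Of a line that is constant at
\<open>i\<close>, the part in \<open>Z\<close> is sent into a single copy of \<open>A\<close>. So its sets can be replaced by this
copy, and at most \<open>t\<close> sets of \<open>P\<close> remain to be completed. The sets of a
constant line, together with \<open>A1\<close>, are projected to the target of the round; by the choice of \<open>l0\<close>
they number at most \<open>t - 1\<close> when \<open>t \<ge> 3\<close>, and the previous round takes care of them. All these
completions are amalgamated over \<open>A\<close>. For \<open>t = 2\<close> amalgamation over the intersection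
suffices (\<open>completable_two\<close>).\<close>

section \<open>Maps on vertex sets\<close>

text \<open>Symbols outside the language have empty interpretations and tuples of the wrong length occur in no
relation and no domain. Homomorphisms and embeddings between structures can therefore be described by
quantifying over all symbols and all lists, without reference to the language. Restricting attention
to a set \<open>V\<close> of vertices replaces the formation of induced substructures.\<close>

definition hom_on ::
  "('a, 'r, 'f) struct \<Rightarrow> 'a set \<Rightarrow> ('b, 'r, 'f) struct \<Rightarrow> ('a \<Rightarrow> 'b) \<Rightarrow> bool" where
  "hom_on X V Y f \<longleftrightarrow> f ` V \<subseteq> vertices Y \<and>
     (\<forall>R x. x \<in> rel_interp X R \<longrightarrow> set x \<subseteq> V \<longrightarrow> map f x \<in> rel_interp Y R) \<and>
     (\<forall>F x y. fun_interp X F x = Some y \<longrightarrow> set x \<subseteq> V \<longrightarrow>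
        fun_interp Y F (map f x) = Some (f y))"

text \<open>The equation between options in the last clause says at once that domains are preserved in both
directions and that values are respected.\<close>

definition emb_on ::
  "('a, 'r, 'f) struct \<Rightarrow> 'a set \<Rightarrow> ('b, 'r, 'f) struct \<Rightarrow> ('a \<Rightarrow> 'b) \<Rightarrow> bool" where
  "emb_on X V Y f \<longleftrightarrow> inj_on f V \<and> f ` V \<subseteq> vertices Y \<and>
     (\<forall>R x. set x \<subseteq> V \<longrightarrow> (map f x \<in> rel_interp Y R \<longleftrightarrow> x \<in> rel_interp X R)) \<and>
     (\<forall>F x. set x \<subseteq> V \<longrightarrow> fun_interp Y F (map f x) = map_option f (fun_interp X F x))"

abbreviation hom :: "('a, 'r, 'f) struct \<Rightarrow> ('b, 'r, 'f) struct \<Rightarrow> ('a \<Rightarrow> 'b) \<Rightarrow> bool" where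
  "hom X \<equiv> hom_on X (vertices X)"

abbreviation emb :: "('a, 'r, 'f) struct \<Rightarrow> ('b, 'r, 'f) struct \<Rightarrow> ('a \<Rightarrow> 'b) \<Rightarrow> bool" where
  "emb X \<equiv> emb_on X (vertices X)"

definition closed_in :: "('a, 'r, 'f) struct \<Rightarrow> 'a set \<Rightarrow> bool" where
  "closed_in X V \<longleftrightarrow> V \<subseteq> vertices X \<and>
     (\<forall>F x y. fun_interp X F x = Some y \<longrightarrow> set x \<subseteq> V \<longrightarrow> y \<in> V)"

definition tups :: "('a, 'r, 'f) struct \<Rightarrow> 'a list set" where
  "tups X = (\<Union>R. rel_interp X R) \<union> (\<Union>F. dom (fun_interp X F))"

text \<open>Irreducibility of the substructure on \<open>V\<close>. The parts \<open>V1\<close> and \<open>V2\<close> of a decomposition range over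
closed sets of the whole structure instead of subsets of \<open>V\<close>; intersecting with \<open>V\<close> shows
that this is the same, and it makes the notion easy to transport along maps.\<close>

definition irred :: "('a, 'r, 'f) struct \<Rightarrow> 'a set \<Rightarrow> bool" where
  "irred X V \<longleftrightarrow> closed_in X V \<and>
     (\<forall>V1 V2. closed_in X V1 \<longrightarrow> closed_in X V2 \<longrightarrow> V \<subseteq> V1 \<union> V2 \<longrightarrow>
        (\<forall>x\<in>tups X. set x \<subseteq> V \<longrightarrow> set x \<subseteq> V1 \<or> set x \<subseteq> V2) \<longrightarrow> V \<subseteq> V1 \<or> V \<subseteq> V2)"

definition hom_emb ::
  "('a, 'r, 'f) struct \<Rightarrow> ('b, 'r, 'f) struct \<Rightarrow> ('a \<Rightarrow> 'b) \<Rightarrow> bool" where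
  "hom_emb X Y f \<longleftrightarrow> hom X Y f \<and> (\<forall>V. irred X V \<longrightarrow> emb_on X V Y f)"

definition induced :: "('a, 'r, 'f) struct \<Rightarrow> 'a set \<Rightarrow> ('a, 'r, 'f) struct" where
  "induced X V = \<lparr>vertices = V, rel_interp = (\<lambda>R. rel_interp X R \<inter> lists V),
     fun_interp = (\<lambda>F. fun_interp X F |` lists V)\<rparr>"

lemma struct_relD:
  assumes "is_struct L X" "x \<in> rel_interp X R"
  shows "R \<in> rel_syms L" "length x = rel_arity L R" "set x \<subseteq> vertices X"
proof -
  show 1: "R \<in> rel_syms L" using assms unfolding is_struct_def by blast
  then have "x \<in> tuples (vertices X) (rel_arity L R)"
    using assms unfolding is_struct_def by blast
  then show "length x = rel_arity L R" "set x \<subseteq> vertices X" by (auto simp: tuples_def)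
qed

lemma struct_funD:
  assumes "is_struct L X" "fun_interp X F x = Some y"
  shows "F \<in> fun_syms L" "length x = fun_arity L F" "set x \<subseteq> vertices X" "y \<in> vertices X"
proof -
  show 1: "F \<in> fun_syms L" using assms unfolding is_struct_def by force
  have "dom (fun_interp X F) \<subseteq> tuples (vertices X) (fun_arity L F)"
    "ran (fun_interp X F) \<subseteq> vertices X"
    using assms 1 unfolding is_struct_def by blast+
  then have "x \<in> tuples (vertices X) (fun_arity L F)" "y \<in> vertices X"
    using assms(2) by (auto intro: ranI)
  then show "length x = fun_arity L F" "set x \<subseteq> vertices X" "y \<in> vertices X"
    by (auto simp: tuples_def)
qed

lemma is_structI:
  assumes "countable (vertices X)"
    and "\<And>R x. x \<in> rel_interp X R \<Longrightarrow>
      R \<in> rel_syms L \<and> length x = rel_arity L R \<and> set x \<subseteq> vertices X"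
    and "\<And>F x y. fun_interp X F x = Some y \<Longrightarrow>
      F \<in> fun_syms L \<and> length x = fun_arity L F \<and> set x \<subseteq> vertices X \<and> y \<in> vertices X"
  shows "is_struct L X"
proof -
  have 1: "rel_interp X R = {}" if "R \<notin> rel_syms L" for R
    using assms(2) that by blast
  have 2: "fun_interp X F = Map.empty" if "F \<notin> fun_syms L" for F
    using assms(3) that by (meson option.exhaust ext)
  have 3: "dom (fun_interp X F) \<subseteq> tuples (vertices X) (fun_arity L F)"
    "ran (fun_interp X F) \<subseteq> vertices X" for F
    using assms(3) unfolding ran_def tuples_def by blast+
  have 4: "rel_interp X R \<subseteq> tuples (vertices X) (rel_arity L R)" for R
    using assms(2) unfolding tuples_def by blast
  show ?thesis
    unfolding is_struct_def using 1 2 3 4 assms(1) by blast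
qed

lemma tups_vertices: "is_struct L X \<Longrightarrow> x \<in> tups X \<Longrightarrow> set x \<subseteq> vertices X"
  unfolding tups_def by (auto dest: struct_relD(3) struct_funD(3))

lemma closed_in_vertices: "is_struct L X \<Longrightarrow> closed_in X (vertices X)"
  unfolding closed_in_def by (auto dest: struct_funD(4))

lemma closed_in_Int: "closed_in X V \<Longrightarrow> closed_in X W \<Longrightarrow> closed_in X (V \<inter> W)"
  unfolding closed_in_def by (metis Int_iff Int_subset_iff le_infI1)

lemma struct_hom_iff:
  "struct_hom L X Y f \<longleftrightarrow> is_struct L X \<and> is_struct L Y \<and> hom X Y f"
proof (cases "is_struct L X \<and> is_struct L Y")
  case True
  then have X: "is_struct L X" and Y: "is_struct L Y" by auto
  have "struct_hom L X Y f" if "hom X Y f"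
  proof -
    have r: "map f x \<in> rel_interp Y R" if "x \<in> rel_interp X R" for R x
      using \<open>hom X Y f\<close> that struct_relD(3)[OF X that]
      unfolding hom_on_def by blast
    have fn: "fun_interp Y F (map f x) = Some (f y)" if "fun_interp X F x = Some y" for F x y
      using \<open>hom X Y f\<close> that struct_funD(3)[OF X that]
      unfolding hom_on_def by blast
    have "map f ` dom (fun_interp X F) \<subseteq> dom (fun_interp Y F)" for F using fn by blast
    moreover have "f (the (fun_interp X F x)) = the (fun_interp Y F (map f x))"
      if "x \<in> dom (fun_interp X F)" for F x using fn that by fastforce
    moreover have "f ` vertices X \<subseteq> vertices Y" using that unfolding hom_on_def by blast
    moreover have "map f ` rel_interp X R \<subseteq> rel_interp Y R" for R using r by auto
    ultimately show ?thesis unfolding struct_hom_def using X Y by simp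
  qed
  moreover have "hom X Y f" if h: "struct_hom L X Y f"
  proof -
    have "map f x \<in> rel_interp Y R" if "x \<in> rel_interp X R" for R x
      using h that struct_relD(1)[OF X that] unfolding struct_hom_def by blast
    moreover have "fun_interp Y F (map f x) = Some (f y)" if "fun_interp X F x = Some y" for F x y
    proof -
      have "F \<in> fun_syms L" by (rule struct_funD(1)[OF X that])
      moreover have xd: "x \<in> dom (fun_interp X F)" using that by auto
      ultimately have "map f x \<in> dom (fun_interp Y F)"
        "f (the (fun_interp X F x)) = the (fun_interp Y F (map f x))"
        using h unfolding struct_hom_def by blast+
      then show ?thesis unfolding that by (auto simp: domIff)
    qed
    moreover have "f ` vertices X \<subseteq> vertices Y" using h by (simp add: struct_hom_def)
    ultimately show ?thesis unfolding hom_on_def by simp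
  qed
  ultimately show ?thesis using True by blast
qed (auto simp: struct_hom_def)

lemma emb_on_hom_on: "emb_on X V Y f \<Longrightarrow> hom_on X V Y f"
  unfolding emb_on_def hom_on_def by simp

text \<open>A tuple of \<open>Y\<close> that is the image of a tuple of vertices of \<open>X\<close> has the arity prescribed by the
language, so the restriction to symbols and arities of the language can be dropped.\<close>

lemma struct_emb_iff:
  "struct_emb L X Y f \<longleftrightarrow> is_struct L X \<and> is_struct L Y \<and> emb X Y f"
proof (cases "is_struct L X \<and> is_struct L Y")
  case True
  then have X: "is_struct L X" and Y: "is_struct L Y" by auto
  have "struct_emb L X Y f" if e: "emb X Y f"
  proof -
    have "struct_hom L X Y f" using emb_on_hom_on[OF e] X Y struct_hom_iff by blast
    moreover have "x \<in> dom (fun_interp X F) \<longleftrightarrow> map f x \<in> dom (fun_interp Y F)"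
      if "x \<in> tuples (vertices X) n" for x F n
      using e that unfolding emb_on_def tuples_def by (simp add: domIff)
    ultimately show ?thesis
      using e unfolding struct_emb_def emb_on_def by (auto simp: tuples_def)
  qed
  moreover have "emb X Y f" if e: "struct_emb L X Y f"
  proof -
    have h: "hom X Y f" using e struct_hom_iff struct_emb_def by blast
    have "map f x \<in> rel_interp Y R \<longleftrightarrow> x \<in> rel_interp X R" if x: "set x \<subseteq> vertices X" for R x
    proof
      assume a: "map f x \<in> rel_interp Y R"
      then have "R \<in> rel_syms L" "x \<in> tuples (vertices X) (rel_arity L R)"
        using struct_relD[OF Y a] x by (auto simp: tuples_def)
      then show "x \<in> rel_interp X R" using e a unfolding struct_emb_def by blast
    qed (use h x in \<open>auto simp: hom_on_def\<close>)
    moreover have "fun_interp Y F (map f x) = map_option f (fun_interp X F x)"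
      if x: "set x \<subseteq> vertices X" for F x
    proof (cases "fun_interp Y F (map f x)")
      case None
      then show ?thesis using h x unfolding hom_on_def by (cases "fun_interp X F x") auto
    next
      case (Some y)
      then have "F \<in> fun_syms L" "x \<in> tuples (vertices X) (fun_arity L F)"
        using struct_funD[OF Y Some] x by (auto simp: tuples_def)
      then have "x \<in> dom (fun_interp X F)" using e Some unfolding struct_emb_def by blast
      then show ?thesis using h x unfolding hom_on_def by auto
    qed
    moreover have "inj_on f (vertices X)" using e by (simp add: struct_emb_def)
    moreover have "f ` vertices X \<subseteq> vertices Y" using h by (simp add: hom_on_def)
    ultimately show ?thesis unfolding emb_on_def by simp
  qed
  ultimately show ?thesis using True by blast
qed (auto simp: struct_hom_def struct_emb_def)

lemma induced_simps [simp]: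
  "vertices (induced X V) = V"
  "rel_interp (induced X V) R = rel_interp X R \<inter> lists V"
  "fun_interp (induced X V) F = fun_interp X F |` lists V"
  by (auto simp: induced_def)

lemma induced_fun [simp]: "set x \<subseteq> V \<Longrightarrow> fun_interp (induced X V) F x = fun_interp X F x"
  by (auto simp: restrict_map_def in_lists_conv_set)

lemma induced_fun_Some:
  "fun_interp (induced X V) F x = Some y \<longleftrightarrow> set x \<subseteq> V \<and> fun_interp X F x = Some y"
  by (auto simp: restrict_map_def in_lists_conv_set)

lemma is_struct_induced:
  assumes "is_struct L X" "closed_in X V"
  shows "is_struct L (induced X V)"
proof (rule is_structI)
  show "countable (vertices (induced X V))"
    using assms unfolding is_struct_def closed_in_def by (auto intro: countable_subset)
next
  fix R x assume "x \<in> rel_interp (induced X V) R"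
  then show "R \<in> rel_syms L \<and> length x = rel_arity L R \<and> set x \<subseteq> vertices (induced X V)"
    using struct_relD[OF assms(1)] by auto
next
  fix F x y assume "fun_interp (induced X V) F x = Some y"
  then show "F \<in> fun_syms L \<and> length x = fun_arity L F \<and> set x \<subseteq> vertices (induced X V) \<and>
    y \<in> vertices (induced X V)"
    using struct_funD[OF assms(1)] assms(2) unfolding induced_fun_Some closed_in_def
    by (metis induced_simps(1))
qed

lemma emb_on_induced [simp]: "W \<subseteq> V \<Longrightarrow> emb_on (induced X V) W Y f \<longleftrightarrow> emb_on X W Y f"
  unfolding emb_on_def by (auto simp: in_lists_conv_set subset_iff)

text \<open>Because an inclusion that is an embedding preserves definedness of functions in both directions, the
substructures are exactly the structures induced on closed sets.\<close>

lemma substructure_iff: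
  assumes X: "is_struct L X"
  shows "substructure L S X \<longleftrightarrow> (\<exists>V. closed_in X V \<and> S = induced X V)"
proof
  assume "substructure L S X"
  then have S: "is_struct L S" and sub: "vertices S \<subseteq> vertices X"
    and e: "emb S X id"
    unfolding substructure_def struct_emb_iff by auto
  have rel: "x \<in> rel_interp X R \<longleftrightarrow> x \<in> rel_interp S R" if "set x \<subseteq> vertices S" for x R
    using e that unfolding emb_on_def by auto
  have fn: "fun_interp X F x = fun_interp S F x" if "set x \<subseteq> vertices S" for x F
    using e that unfolding emb_on_def by (auto simp: option.map_id)
  have "closed_in X (vertices S)"
    unfolding closed_in_def using sub fn struct_funD(4)[OF S] by metis
  moreover have "S = induced X (vertices S)"
  proof (rule struct.equality)
    show "rel_interp S = rel_interp (induced X (vertices S))"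
      using rel struct_relD(3)[OF S] by (auto simp: fun_eq_iff set_eq_iff in_lists_conv_set subset_iff)
    show "fun_interp S = fun_interp (induced X (vertices S))"
    proof (intro ext)
      fix F x
      show "fun_interp S F x = fun_interp (induced X (vertices S)) F x"
        using fn[of x F] struct_funD(3)[OF S, of F x]
        by (cases "fun_interp S F x") (auto simp: restrict_map_def in_lists_conv_set subset_iff)
    qed
  qed auto
  ultimately show "\<exists>V. closed_in X V \<and> S = induced X V" by blast
next
  assume "\<exists>V. closed_in X V \<and> S = induced X V"
  then obtain V where V: "closed_in X V" and S: "S = induced X V" by auto
  have "emb_on X V X id"
    using V unfolding emb_on_def closed_in_def by (auto simp: option.map_id)
  then show "substructure L S X"
    using V X is_struct_induced[OF X V] unfolding substructure_def struct_emb_iff S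
    by (auto simp: closed_in_def)
qed

lemma emb_onI:
  assumes "inj_on f V" "f ` V \<subseteq> vertices Y"
    and "\<And>R x. set x \<subseteq> V \<Longrightarrow> map f x \<in> rel_interp Y R \<longleftrightarrow> x \<in> rel_interp X R"
    and "\<And>F x. set x \<subseteq> V \<Longrightarrow> fun_interp Y F (map f x) = map_option f (fun_interp X F x)"
  shows "emb_on X V Y f"
  using assms unfolding emb_on_def by simp

lemma emb_onD:
  assumes "emb_on X V Y f"
  shows "inj_on f V" "f ` V \<subseteq> vertices Y"
    and "set x \<subseteq> V \<Longrightarrow> map f x \<in> rel_interp Y R \<longleftrightarrow> x \<in> rel_interp X R"
    and "set x \<subseteq> V \<Longrightarrow> fun_interp Y F (map f x) = map_option f (fun_interp X F x)"
  using assms unfolding emb_on_def by simp_all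

lemma hom_onI:
  assumes "f ` V \<subseteq> vertices Y"
    and "\<And>R x. x \<in> rel_interp X R \<Longrightarrow> set x \<subseteq> V \<Longrightarrow> map f x \<in> rel_interp Y R"
    and "\<And>F x y. fun_interp X F x = Some y \<Longrightarrow> set x \<subseteq> V \<Longrightarrow>
      fun_interp Y F (map f x) = Some (f y)"
  shows "hom_on X V Y f"
  using assms unfolding hom_on_def by simp

lemma hom_onD:
  assumes "hom_on X V Y f"
  shows "f ` V \<subseteq> vertices Y"
    and "x \<in> rel_interp X R \<Longrightarrow> set x \<subseteq> V \<Longrightarrow> map f x \<in> rel_interp Y R"
    and "fun_interp X F x = Some y \<Longrightarrow> set x \<subseteq> V \<Longrightarrow>
      fun_interp Y F (map f x) = Some (f y)"
  using assms unfolding hom_on_def by simp_all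

lemma emb_on_refl: "V \<subseteq> vertices X \<Longrightarrow> emb_on X V X id"
  by (rule emb_onI) (auto simp: option.map_id)

lemma emb_on_subset: "emb_on X V Y f \<Longrightarrow> W \<subseteq> V \<Longrightarrow> emb_on X W Y f"
  unfolding emb_on_def by (auto intro: inj_on_subset)

lemma emb_on_cong:
  assumes "emb_on X V Y f" "closed_in X V" "\<And>v. v \<in> V \<Longrightarrow> g v = f v"
  shows "emb_on X V Y g"
proof (rule emb_onI)
  have m: "map g x = map f x" if "set x \<subseteq> V" for x using assms(3) that by auto
  show "inj_on g V" using emb_onD(1)[OF assms(1)] assms(3) inj_on_cong by metis
  show "g ` V \<subseteq> vertices Y" using emb_onD(2)[OF assms(1)] assms(3) by auto
  show "map g x \<in> rel_interp Y R \<longleftrightarrow> x \<in> rel_interp X R" if "set x \<subseteq> V" for R x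
    unfolding m[OF that] by (rule emb_onD(3)[OF assms(1) that])
  show "fun_interp Y F (map g x) = map_option g (fun_interp X F x)" if "set x \<subseteq> V" for F x
  proof -
    have "map_option g (fun_interp X F x) = map_option f (fun_interp X F x)"
      using assms(2,3) that unfolding closed_in_def by (cases "fun_interp X F x") auto
    then show ?thesis unfolding m[OF that] using emb_onD(4)[OF assms(1) that] by simp
  qed
qed

lemma hom_on_subset:
  assumes "hom_on X V Y f" "W \<subseteq> V" shows "hom_on X W Y f"
proof (rule hom_onI)
  show "f ` W \<subseteq> vertices Y" using hom_onD(1)[OF assms(1)] assms(2) by auto
  show "map f x \<in> rel_interp Y R" if "x \<in> rel_interp X R" "set x \<subseteq> W" for R x
    by (rule hom_onD(2)[OF assms(1) that(1) subset_trans[OF that(2) assms(2)]])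
  show "fun_interp Y F (map f x) = Some (f y)" if "fun_interp X F x = Some y" "set x \<subseteq> W" for F x y
    by (rule hom_onD(3)[OF assms(1) that(1) subset_trans[OF that(2) assms(2)]])
qed

lemma hom_on_cong:
  assumes "hom_on X V Y f" "closed_in X V" "\<And>v. v \<in> V \<Longrightarrow> g v = f v"
  shows "hom_on X V Y g"
proof (rule hom_onI)
  have m: "map g x = map f x" if "set x \<subseteq> V" for x using assms(3) that by auto
  show "g ` V \<subseteq> vertices Y" using hom_onD(1)[OF assms(1)] assms(3) by auto
  show "map g x \<in> rel_interp Y R" if "x \<in> rel_interp X R" "set x \<subseteq> V" for R x
    unfolding m[OF that(2)] by (rule hom_onD(2)[OF assms(1) that])
  show "fun_interp Y F (map g x) = Some (g y)" if x: "fun_interp X F x = Some y" "set x \<subseteq> V" for F x y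
  proof -
    have "y \<in> V" using assms(2) x unfolding closed_in_def by blast
    then show ?thesis unfolding m[OF x(2)] using hom_onD(3)[OF assms(1) x] assms(3) by simp
  qed
qed

lemma hom_on_comp:
  assumes f: "hom_on X V Y f" and g: "hom_on Y W Z g" and "f ` V \<subseteq> W"
  shows "hom_on X V Z (g \<circ> f)"
proof (rule hom_onI)
  have s: "set (map f x) \<subseteq> W" if "set x \<subseteq> V" for x using that assms(3) by auto
  show "(g \<circ> f) ` V \<subseteq> vertices Z" using hom_onD(1)[OF g] assms(3) by auto
  show "map (g \<circ> f) x \<in> rel_interp Z R" if x: "x \<in> rel_interp X R" "set x \<subseteq> V" for R x
    using hom_onD(2)[OF g hom_onD(2)[OF f x] s[OF x(2)]] by simp
  show "fun_interp Z F (map (g \<circ> f) x) = Some ((g \<circ> f) y)"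
    if x: "fun_interp X F x = Some y" "set x \<subseteq> V" for F x y
    using hom_onD(3)[OF g hom_onD(3)[OF f x] s[OF x(2)]] by simp
qed

lemma emb_on_comp:
  assumes "emb_on X V Y f" "emb_on Y W Z g" "f ` V \<subseteq> W"
  shows "emb_on X V Z (g \<circ> f)"
proof (rule emb_onI)
  have s: "set (map f x) \<subseteq> W" if "set x \<subseteq> V" for x using that assms(3) by auto
  show "inj_on (g \<circ> f) V"
    using emb_onD(1)[OF assms(1)] emb_onD(1)[OF assms(2)] assms(3)
    by (meson comp_inj_on inj_on_subset)
  show "(g \<circ> f) ` V \<subseteq> vertices Z" using emb_onD(2)[OF assms(2)] assms(3) by auto
  show "map (g \<circ> f) x \<in> rel_interp Z R \<longleftrightarrow> x \<in> rel_interp X R" if "set x \<subseteq> V" for R x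
    using emb_onD(3)[OF assms(1) that] emb_onD(3)[OF assms(2) s[OF that]] by simp
  show "fun_interp Z F (map (g \<circ> f) x) = map_option (g \<circ> f) (fun_interp X F x)"
    if "set x \<subseteq> V" for F x
    using emb_onD(4)[OF assms(1) that] emb_onD(4)[OF assms(2) s[OF that]]
    by (simp add: option.map_comp)
qed

lemma set_subset_imageE:
  assumes "set x \<subseteq> f ` V" obtains u where "set u \<subseteq> V" "x = map f u"
proof -
  have "x \<in> lists (f ` V)" using assms by (auto simp: in_lists_conv_set)
  then obtain u where "u \<in> lists V" "x = map f u" unfolding lists_image by auto
  then show ?thesis using that by (auto simp: in_lists_conv_set subset_iff)
qed

lemma closed_in_image:
  assumes "emb_on X V Y f" "closed_in X V"
  shows "closed_in Y (f ` V)"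
  unfolding closed_in_def
proof (intro conjI allI impI)
  show "f ` V \<subseteq> vertices Y" using assms unfolding emb_on_def by blast
next
  fix F x y assume y: "fun_interp Y F x = Some y" and "set x \<subseteq> f ` V"
  then obtain u where u: "set u \<subseteq> V" "x = map f u" using set_subset_imageE by blast
  then have "map_option f (fun_interp X F u) = Some y"
    using assms(1) y unfolding emb_on_def by metis
  then show "y \<in> f ` V" using assms(2) u unfolding closed_in_def by auto
qed

lemma hom_on_tups: "hom_on X V Y f \<Longrightarrow> set x \<subseteq> V \<Longrightarrow> x \<in> tups X \<Longrightarrow> map f x \<in> tups Y"
  unfolding hom_on_def tups_def by fastforce

lemma irredD:
  assumes "irred X V" "closed_in X V1" "closed_in X V2" "V \<subseteq> V1 \<union> V2"
    "\<And>x. x \<in> tups X \<Longrightarrow> set x \<subseteq> V \<Longrightarrow> set x \<subseteq> V1 \<or> set x \<subseteq> V2"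
  shows "V \<subseteq> V1 \<or> V \<subseteq> V2"
  using assms unfolding irred_def by blast

lemma closed_in_preimage:
  assumes "hom_on X V Y f" "closed_in X V" "closed_in Y W"
  shows "closed_in X {v \<in> V. f v \<in> W}"
  unfolding closed_in_def
proof (intro conjI allI impI)
  show "{v \<in> V. f v \<in> W} \<subseteq> vertices X" using assms unfolding closed_in_def by auto
next
  fix F x y assume y: "fun_interp X F x = Some y" and x: "set x \<subseteq> {v \<in> V. f v \<in> W}"
  then have "set x \<subseteq> V" "set (map f x) \<subseteq> W" by auto
  moreover have "fun_interp Y F (map f x) = Some (f y)"
    using assms(1) y x unfolding hom_on_def by blast
  ultimately show "y \<in> {v \<in> V. f v \<in> W}"
    using assms(2,3) y unfolding closed_in_def by blast
qed

lemma irred_closed: "irred X V \<Longrightarrow> closed_in X V"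
  unfolding irred_def by (rule conjunct1)

lemma closed_in_sub: "closed_in X V \<Longrightarrow> V \<subseteq> vertices X"
  unfolding closed_in_def by (rule conjunct1)

section \<open>Hulls and irreducible sets\<close>

definition hull :: "('a, 'r, 'f) struct \<Rightarrow> 'a set \<Rightarrow> 'a set" where
  "hull X U = \<Inter>{W. closed_in X W \<and> U \<subseteq> W}"

lemma hull_subset: "U \<subseteq> hull X U"
  unfolding hull_def by auto

lemma hull_least: "closed_in X W \<Longrightarrow> U \<subseteq> W \<Longrightarrow> hull X U \<subseteq> W"
  unfolding hull_def by auto

lemma closed_in_hull:
  assumes "is_struct L X" "U \<subseteq> vertices X"
  shows "closed_in X (hull X U)"
  unfolding closed_in_def
proof (intro conjI allI impI)
  show "hull X U \<subseteq> vertices X" using hull_least closed_in_vertices assms by metis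
next
  fix F x y assume "fun_interp X F x = Some y" "set x \<subseteq> hull X U"
  then show "y \<in> hull X U" unfolding hull_def closed_in_def by blast
qed

text \<open>Preimages of closed sets are closed, so a decomposition of the image would decompose \<open>S\<close>.\<close>

lemma irred_image_split:
  assumes S: "irred X S" and h: "hom_on X S Y f"
    and c: "closed_in Y V1" "closed_in Y V2" "f ` S \<subseteq> V1 \<union> V2"
    and t: "\<And>x. x \<in> tups Y \<Longrightarrow> set x \<subseteq> f ` S \<Longrightarrow> set x \<subseteq> V1 \<or> set x \<subseteq> V2"
  shows "f ` S \<subseteq> V1 \<or> f ` S \<subseteq> V2"
proof -
  have cS: "closed_in X S" using S unfolding irred_def by blast
  have "S \<subseteq> {v \<in> S. f v \<in> V1} \<or> S \<subseteq> {v \<in> S. f v \<in> V2}"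
  proof (rule irredD[OF S closed_in_preimage[OF h cS c(1)] closed_in_preimage[OF h cS c(2)]])
    show "S \<subseteq> {v \<in> S. f v \<in> V1} \<union> {v \<in> S. f v \<in> V2}" using c(3) by auto
    fix x assume x: "x \<in> tups X" "set x \<subseteq> S"
    then have "map f x \<in> tups Y" "set (map f x) \<subseteq> f ` S" using hom_on_tups[OF h] by auto
    then have "set (map f x) \<subseteq> V1 \<or> set (map f x) \<subseteq> V2" by (rule t)
    then show "set x \<subseteq> {v \<in> S. f v \<in> V1} \<or> set x \<subseteq> {v \<in> S. f v \<in> V2}" using x by auto
  qed
  then show ?thesis by auto
qed

text \<open>A closed set containing \<open>U\<close> contains the hull of \<open>U\<close>. So it is enough that \<open>U\<close> itself lies on one
side of every decomposition of the hull, which is clear when \<open>U\<close> is a single vertex or the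
set of entries of a tuple.\<close>

lemma irred_hull:
  assumes X: "is_struct L X" and U: "U \<subseteq> vertices X"
    and one_side: "\<And>V1 V2. closed_in X V1 \<Longrightarrow> closed_in X V2 \<Longrightarrow> hull X U \<subseteq> V1 \<union> V2 \<Longrightarrow>
      (\<forall>x\<in>tups X. set x \<subseteq> hull X U \<longrightarrow> set x \<subseteq> V1 \<or> set x \<subseteq> V2) \<Longrightarrow> U \<subseteq> V1 \<or> U \<subseteq> V2"
  shows "irred X (hull X U)"
  unfolding irred_def
proof (intro conjI allI impI)
  show "closed_in X (hull X U)" by (rule closed_in_hull[OF X U])
  fix V1 V2
  assume c: "closed_in X V1" "closed_in X V2" "hull X U \<subseteq> V1 \<union> V2"
    "\<forall>x\<in>tups X. set x \<subseteq> hull X U \<longrightarrow> set x \<subseteq> V1 \<or> set x \<subseteq> V2"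
  from one_side[OF c] show "hull X U \<subseteq> V1 \<or> hull X U \<subseteq> V2"
    using hull_least[OF c(1)] hull_least[OF c(2)] by (elim disjE) simp_all
qed

text \<open>The image of an irreducible set under a homomorphism need not be closed, and need not carry
the induced structure. Its hull is irreducible all the same, since a
decomposition of the hull restricts to one of the image.\<close>

lemma irred_hull_image:
  assumes P: "is_struct L P" and S: "irred Z S" and h: "hom_on Z S P f"
  shows "irred P (hull P (f ` S))"
proof (rule irred_hull[OF P hom_onD(1)[OF h]])
  fix V1 V2
  assume c: "closed_in P V1" "closed_in P V2" "hull P (f ` S) \<subseteq> V1 \<union> V2"
    and t: "\<forall>x\<in>tups P. set x \<subseteq> hull P (f ` S) \<longrightarrow> set x \<subseteq> V1 \<or> set x \<subseteq> V2"
  show "f ` S \<subseteq> V1 \<or> f ` S \<subseteq> V2"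
  proof (rule irred_image_split[OF S h c(1,2) subset_trans[OF hull_subset c(3)]])
    fix x assume x: "x \<in> tups P" "set x \<subseteq> f ` S"
    show "set x \<subseteq> V1 \<or> set x \<subseteq> V2"
      by (rule t[THEN bspec[OF _ x(1)], THEN mp, OF subset_trans[OF x(2) hull_subset]])
  qed
qed

lemma vertex_in_irred:
  assumes X: "is_struct L X" and V: "closed_in X V" and v: "v \<in> V"
  obtains W where "irred X W" "W \<subseteq> V" "v \<in> W"
proof -
  have vh: "v \<in> hull X {v}" using hull_subset[of "{v}" X] by simp
  have "irred X (hull X {v})"
  proof (rule irred_hull[OF X])
    show "{v} \<subseteq> vertices X" using v closed_in_sub[OF V] by blast
    show "{v} \<subseteq> V1 \<or> {v} \<subseteq> V2" if "hull X {v} \<subseteq> V1 \<union> V2" for V1 V2 using vh that by blast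
  qed
  moreover have "hull X {v} \<subseteq> V" by (rule hull_least[OF V]) (simp add: v)
  ultimately show ?thesis using vh by (rule that)
qed

lemma tuple_in_irred:
  assumes X: "is_struct L X" and V: "closed_in X V" and x: "x \<in> tups X" "set x \<subseteq> V"
  obtains W where "irred X W" "W \<subseteq> V" "set x \<subseteq> W"
proof -
  have xh: "set x \<subseteq> hull X (set x)" by (rule hull_subset)
  have "irred X (hull X (set x))"
  proof (rule irred_hull[OF X tups_vertices[OF X x(1)]])
    show "set x \<subseteq> V1 \<or> set x \<subseteq> V2"
      if "\<forall>y\<in>tups X. set y \<subseteq> hull X (set x) \<longrightarrow> set y \<subseteq> V1 \<or> set y \<subseteq> V2" for V1 V2
      using that x(1) xh by blast
  qed
  moreover have "hull X (set x) \<subseteq> V" by (rule hull_least[OF V x(2)])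
  ultimately show ?thesis using xh by (rule that)
qed

text \<open>Each vertex and each tuple lies in an irreducible set, namely in its hull. Hence a map that is well
behaved on irreducible sets is a homomorphism.\<close>

lemma hom_on_from_irred:
  assumes X: "is_struct L X" and V: "closed_in X V"
    and h: "\<And>W. irred X W \<Longrightarrow> W \<subseteq> V \<Longrightarrow> emb_on X W Y h"
  shows "hom_on X V Y h"
proof (rule hom_onI)
  show "h ` V \<subseteq> vertices Y"
  proof
    fix y assume "y \<in> h ` V"
    then obtain v where v: "v \<in> V" "y = h v" by blast
    obtain W where "irred X W" "W \<subseteq> V" "v \<in> W" by (rule vertex_in_irred[OF X V v(1)])
    then show "y \<in> vertices Y" using emb_onD(2)[OF h] v(2) by blast
  qed
  show "map h x \<in> rel_interp Y R" if x: "x \<in> rel_interp X R" "set x \<subseteq> V" for R x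
  proof -
    have "x \<in> tups X" using x(1) unfolding tups_def by blast
    then obtain W where W: "irred X W" "W \<subseteq> V" "set x \<subseteq> W" by (rule tuple_in_irred[OF X V _ x(2)])
    show ?thesis using emb_onD(3)[OF h[OF W(1,2)] W(3)] x(1) by simp
  qed
  show "fun_interp Y F (map h x) = Some (h y)" if x: "fun_interp X F x = Some y" "set x \<subseteq> V" for F x y
  proof -
    have "x \<in> tups X" using x(1) unfolding tups_def by blast
    then obtain W where W: "irred X W" "W \<subseteq> V" "set x \<subseteq> W" by (rule tuple_in_irred[OF X V _ x(2)])
    show ?thesis using emb_onD(4)[OF h[OF W(1,2)] W(3)] x(1) by simp
  qed
qed

section \<open>Transporting embeddings\<close>

lemma irred_image:
  assumes S: "irred X V" and e: "emb_on X V Y f"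
  shows "irred Y (f ` V)"
  unfolding irred_def
proof (intro conjI allI impI)
  show "closed_in Y (f ` V)" by (rule closed_in_image[OF e irred_closed[OF S]])
  show "f ` V \<subseteq> V1 \<or> f ` V \<subseteq> V2"
    if "closed_in Y V1" "closed_in Y V2" "f ` V \<subseteq> V1 \<union> V2"
      "\<forall>x\<in>tups Y. set x \<subseteq> f ` V \<longrightarrow> set x \<subseteq> V1 \<or> set x \<subseteq> V2" for V1 V2
    by (rule irred_image_split[OF S emb_on_hom_on[OF e] that(1-3)]) (use that(4) in simp)
qed

text \<open>The image of an irreducible set under the first map is again irreducible, so the second map embeds it.\<close>

lemma hom_emb_comp:
  assumes f: "hom_emb X Y f" and g: "hom_emb Y Z g"
  shows "hom_emb X Z (g \<circ> f)"
  unfolding hom_emb_def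
proof (intro conjI allI impI)
  have hf: "hom X Y f" and hg: "hom Y Z g"
    using f g unfolding hom_emb_def by auto
  show "hom X Z (g \<circ> f)" by (rule hom_on_comp[OF hf hg hom_onD(1)[OF hf]])
next
  fix V assume V: "irred X V"
  then have e: "emb_on X V Y f" using f unfolding hom_emb_def by blast
  then have "emb_on Y (f ` V) Z g" using g irred_image[OF V e] unfolding hom_emb_def by blast
  then show "emb_on X V Z (g \<circ> f)" by (rule emb_on_comp[OF e _ subset_refl])
qed

lemma emb_on_inv:
  assumes e: "emb_on X V Y f" and V: "closed_in X V"
  shows "emb_on Y (f ` V) X (inv_into V f)"
proof (rule emb_onI)
  have i: "inj_on f V" by (rule emb_onD(1)[OF e])
  show "inj_on (inv_into V f) (f ` V)" by (rule inj_on_inv_into) simp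
  show "inv_into V f ` f ` V \<subseteq> vertices X"
    using i V unfolding closed_in_def by auto
  have inv: "map (inv_into V f) (map f u) = u" if "set u \<subseteq> V" for u
    using that i by (auto intro!: map_idI simp: subset_iff)
  show "map (inv_into V f) x \<in> rel_interp X R \<longleftrightarrow> x \<in> rel_interp Y R" if x: "set x \<subseteq> f ` V" for R x
  proof -
    obtain u where u: "set u \<subseteq> V" "x = map f u" using set_subset_imageE[OF x] by blast
    show ?thesis unfolding u(2) inv[OF u(1)] using emb_onD(3)[OF e u(1)] by blast
  qed
  show "fun_interp X F (map (inv_into V f) x) = map_option (inv_into V f) (fun_interp Y F x)"
    if x: "set x \<subseteq> f ` V" for F x
  proof -
    obtain u where u: "set u \<subseteq> V" "x = map f u" using set_subset_imageE[OF x] by blast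
    have "inv_into V f (f y) = y" if "fun_interp X F u = Some y" for y
      using V u(1) that i unfolding closed_in_def by auto
    then have "map_option (inv_into V f) (map_option f (fun_interp X F u)) = fun_interp X F u"
      by (cases "fun_interp X F u") auto
    then show ?thesis unfolding u(2) inv[OF u(1)] emb_onD(4)[OF e u(1)] by simp
  qed
qed

lemma emb_hom_emb:
  assumes "emb X Y f"
  shows "hom_emb X Y f"
  unfolding hom_emb_def
proof (intro conjI allI impI)
  show "hom X Y f" by (rule emb_on_hom_on[OF assms])
  fix V assume "irred X V"
  then have "V \<subseteq> vertices X" unfolding irred_def closed_in_def by blast
  then show "emb_on X V Y f" by (rule emb_on_subset[OF assms])
qed

lemma emb_on_into_induced:
  assumes "emb_on X V Y f" "f ` V \<subseteq> W"
  shows "emb_on X V (induced Y W) f"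
proof (rule emb_onI)
  have s: "set (map f x) \<subseteq> W" if "set x \<subseteq> V" for x using that assms(2) by auto
  show "inj_on f V" by (rule emb_onD(1)[OF assms(1)])
  show "f ` V \<subseteq> vertices (induced Y W)" using assms(2) by simp
  show "map f x \<in> rel_interp (induced Y W) R \<longleftrightarrow> x \<in> rel_interp X R" if "set x \<subseteq> V" for R x
    using emb_onD(3)[OF assms(1) that, of R] s[OF that] by (auto simp: in_lists_conv_set)
  show "fun_interp (induced Y W) F (map f x) = map_option f (fun_interp X F x)"
    if "set x \<subseteq> V" for F x
    using emb_onD(4)[OF assms(1) that] induced_fun[OF s[OF that]] by metis
qed

lemma irred_pullback:
  assumes e: "emb_on X V Y f" and V: "closed_in X V" and S: "irred Y S" "S \<subseteq> f ` V"
  obtains T where "T \<subseteq> V" "irred X T" "S = f ` T"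
proof -
  let ?T = "inv_into V f ` S"
  have "emb_on Y S X (inv_into V f)" by (rule emb_on_subset[OF emb_on_inv[OF e V] S(2)])
  then have "irred X ?T" by (rule irred_image[OF S(1)])
  moreover have "?T \<subseteq> V" using S(2) inv_into_into[of _ f V] by auto
  moreover have "f ` ?T = S" by (rule image_inv_into_cancel[OF refl S(2)])
  ultimately show ?thesis using that by metis
qed

lemma emb_on_transport:
  assumes e: "emb_on X T Y f" and T: "closed_in X T" and g: "emb_on X T W g"
    and h: "\<And>v. v \<in> T \<Longrightarrow> h (f v) = g v"
  shows "emb_on Y (f ` T) W h"
proof (rule emb_on_cong)
  show "emb_on Y (f ` T) W (g \<circ> inv_into T f)"
    by (rule emb_on_comp[OF emb_on_inv[OF e T] g]) (simp add: emb_onD(1)[OF e])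
  show "closed_in Y (f ` T)" by (rule closed_in_image[OF e T])
  show "h y = (g \<circ> inv_into T f) y" if "y \<in> f ` T" for y
    using that h emb_onD(1)[OF e] by auto
qed

text \<open>A tuple that appears only in the image under \<open>f\<close> would also appear in the image under the composition.\<close>

lemma emb_on_from_comp:
  assumes h: "emb_on X T W h" and f: "hom_on X T Y f" and g: "hom Y W g"
    and eq: "\<And>v. v \<in> T \<Longrightarrow> h v = g (f v)"
  shows "emb_on X T Y f"
proof (rule emb_onI)
  have m: "map h x = map g (map f x)" if "set x \<subseteq> T" for x using that eq by auto
  have s: "set (map f x) \<subseteq> vertices Y" if "set x \<subseteq> T" for x
    using that hom_onD(1)[OF f] by auto
  show "inj_on f T"
  proof (rule inj_onI)
    fix u v assume uv: "u \<in> T" "v \<in> T" "f u = f v"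
    then have "h u = h v" using eq by simp
    then show "u = v" using inj_onD[OF emb_onD(1)[OF h]] uv by blast
  qed
  show "f ` T \<subseteq> vertices Y" by (rule hom_onD(1)[OF f])
  show "map f x \<in> rel_interp Y R \<longleftrightarrow> x \<in> rel_interp X R" if x: "set x \<subseteq> T" for R x
  proof
    assume "map f x \<in> rel_interp Y R"
    then have "map h x \<in> rel_interp W R" unfolding m[OF x] by (rule hom_onD(2)[OF g _ s[OF x]])
    then show "x \<in> rel_interp X R" using emb_onD(3)[OF h x] by blast
  qed (rule hom_onD(2)[OF f _ x])
  show "fun_interp Y F (map f x) = map_option f (fun_interp X F x)" if x: "set x \<subseteq> T" for F x
  proof (cases "fun_interp X F x")
    case None
    have "fun_interp Y F (map f x) = None"
    proof (cases "fun_interp Y F (map f x)")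
      case (Some z)
      have "fun_interp W F (map h x) = Some (g z)"
        unfolding m[OF x] by (rule hom_onD(3)[OF g Some s[OF x]])
      then show ?thesis using emb_onD(4)[OF h x, of F] None by simp
    qed
    then show ?thesis using None by simp
  next
    case (Some y)
    then show ?thesis using hom_onD(3)[OF f Some x] by simp
  qed
qed

lemma emb_on_id_sym:
  assumes e: "emb_on X W Y id" and "W \<subseteq> vertices X"
  shows "emb_on Y W X id"
proof (rule emb_onI)
  show "inj_on id W" by simp
  show "id ` W \<subseteq> vertices X" using assms(2) by simp
  show "map id x \<in> rel_interp X R \<longleftrightarrow> x \<in> rel_interp Y R" if "set x \<subseteq> W" for R x
    using emb_onD(3)[OF e that] by simp
  show "fun_interp X F (map id x) = map_option id (fun_interp Y F x)" if "set x \<subseteq> W" for F x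
    using emb_onD(4)[OF e that] by (simp add: option.map_id)
qed

text \<open>Arities are positive; otherwise the empty tuple would belong to every vertex set and different
components of a disjoint union could interact.\<close>

lemma tups_nonempty:
  assumes "is_language L" "is_struct L X" "x \<in> tups X" shows "x \<noteq> []"
proof -
  consider R where "x \<in> rel_interp X R" | F y where "fun_interp X F x = Some y"
    using assms(3) unfolding tups_def by auto
  then have "0 < length x"
    using assms(1) struct_relD(1,2)[OF assms(2)] struct_funD(1,2)[OF assms(2)]
    unfolding is_language_def by cases metis+
  then show ?thesis by simp
qed

lemma emb_on_empty:
  assumes L: "is_language L" and X: "is_struct L X" and Y: "is_struct L Y"
  shows "emb_on X {} Y f"
proof (rule emb_onI)
  have n: "[] \<notin> tups X" "[] \<notin> tups Y" using tups_nonempty[OF L X] tups_nonempty[OF L Y] by blast+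
  show "map f x \<in> rel_interp Y R \<longleftrightarrow> x \<in> rel_interp X R" if "set x \<subseteq> {}" for R x
    using n that unfolding tups_def by simp
  show "fun_interp Y F (map f x) = map_option f (fun_interp X F x)" if "set x \<subseteq> {}" for F x
    using n that unfolding tups_def by (simp add: domIff)
qed simp_all

section \<open>The Hales--Jewett theorem\<close>

text \<open>Combinatorial lines are lists over \<open>'a option\<close> in which \<open>None\<close> marks the moving coordinates.\<close>

definition subst :: "'a option list \<Rightarrow> 'a \<Rightarrow> 'a list" where
  "subst l a = map (\<lambda>p. case p of None \<Rightarrow> a | Some b \<Rightarrow> b) l"

definition line :: "'a set \<Rightarrow> nat \<Rightarrow> 'a option list \<Rightarrow> bool" where
  "line A n l \<longleftrightarrow> length l = n \<and> None \<in> set l \<and> (\<forall>a. Some a \<in> set l \<longrightarrow> a \<in> A)"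

lemma subst_append: "subst (l @ l') a = subst l a @ subst l' a"
  by (simp add: subst_def)

lemma subst_Some: "subst (map Some w) a = w"
  by (simp add: subst_def map_idI)

lemma subst_words:
  assumes "line A n l" "a \<in> A"
  shows "length (subst l a) = n" "set (subst l a) \<subseteq> A"
  using assms unfolding line_def subst_def by (auto split: option.splits)

definition monochromatic_line :: "'a set \<Rightarrow> nat \<Rightarrow> ('a list \<Rightarrow> 'c) \<Rightarrow> bool" where
  "monochromatic_line A n \<chi> \<longleftrightarrow>
     (\<exists>l. line A n l \<and> (\<forall>a\<in>A. \<forall>b\<in>A. \<chi> (subst l a) = \<chi> (subst l b)))"

definition hales_jewett_dim :: "'a set \<Rightarrow> 'c set \<Rightarrow> nat \<Rightarrow> bool" where
  "hales_jewett_dim A C n \<longleftrightarrow>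
     (\<forall>\<chi>. (\<forall>w. length w = n \<longrightarrow> set w \<subseteq> A \<longrightarrow> \<chi> w \<in> C) \<longrightarrow> monochromatic_line A n \<chi>)"

lemma hj_dimD:
  assumes "hales_jewett_dim A C n" "\<forall>w. length w = n \<longrightarrow> set w \<subseteq> A \<longrightarrow> \<chi> w \<in> C"
  shows "\<exists>l. line A n l \<and> (\<forall>a\<in>A. \<forall>b\<in>A. \<chi> (subst l a) = \<chi> (subst l b))"
  using assms(1)[unfolded hales_jewett_dim_def monochromatic_line_def, THEN spec[of _ \<chi>]] assms(2)
  by (rule mp)

text \<open>The lines belonging to the colours in \<open>D\<close> all pass through the same word \<open>f\<close> when the new letter \<open>z\<close> is
substituted, and each is monochromatic on the old letters, with pairwise different colours.\<close>

definition focused ::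
  "'a set \<Rightarrow> 'a \<Rightarrow> nat \<Rightarrow> ('a list \<Rightarrow> 'c) \<Rightarrow> 'a list \<Rightarrow> 'c set \<Rightarrow> bool" where
  "focused A z n \<chi> f D \<longleftrightarrow> length f = n \<and> set f \<subseteq> insert z A \<and>
     (\<forall>c\<in>D. \<exists>l. line (insert z A) n l \<and> subst l z = f \<and> (\<forall>a\<in>A. \<chi> (subst l a) = c))"

definition focusing_dim :: "'a set \<Rightarrow> 'a \<Rightarrow> 'c set \<Rightarrow> nat \<Rightarrow> nat \<Rightarrow> bool" where
  "focusing_dim A z C k n \<longleftrightarrow>
     (\<forall>\<chi>. (\<forall>w. length w = n \<longrightarrow> set w \<subseteq> insert z A \<longrightarrow> \<chi> w \<in> C) \<longrightarrow>
       monochromatic_line (insert z A) n \<chi> \<or>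
       (\<exists>f D. focused A z n \<chi> f D \<and> D \<subseteq> C \<and> card D = k))"

text \<open>Induction on the number of focused lines. Colour a word \<open>u\<close> over the old alphabet by the function that
sends a word \<open>w\<close> of the previous length to the colour of \<open>w @ u\<close>. A line \<open>l\<close> that is monochromatic on the
old letters for this colouring makes all its old points indistinguishable as suffixes, so the focused
lines of the induced colouring can be prolonged by \<open>l\<close>, and the constant prefix \<open>f\<close> followed by \<open>l\<close> is
one more focused line. If its colour is already in use, then the focused line with that colour is
monochromatic on the new letter too.\<close>

lemma colour_focusing:
  fixes C :: "'c set"
  assumes A: "finite A" "A \<noteq> {}" and C: "finite C"
    and IH: "\<And>E :: nat set. finite E \<Longrightarrow> \<exists>n. hales_jewett_dim A E n"
  shows "\<exists>n. focusing_dim A z C k n"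
proof (induction k)
  case 0
  have "focused A z 0 \<chi> [] {}" for \<chi> :: "'a list \<Rightarrow> 'c"
    unfolding focused_def by simp
  then have "focusing_dim A z C 0 0" unfolding focusing_dim_def by (metis card.empty empty_subsetI)
  then show ?case ..
next
  case (Suc k)
  then obtain n where n: "focusing_dim A z C k n" ..
  let ?W = "{w. set w \<subseteq> insert z A \<and> length w = n}"
  have fW: "finite ?W" using A finite_lists_length_eq[of "insert z A" n] by simp
  let ?T = "PiE ?W (\<lambda>_. C)"
  have fT: "finite ?T" using fW C by (intro finite_PiE) auto
  then obtain code :: "(('a list \<Rightarrow> 'c) \<Rightarrow> nat)" and N where code: "inj_on code ?T"
    using finite_imp_inj_to_nat_seg by metis
  obtain m where m: "hales_jewett_dim A (code ` ?T) m" using IH[of "code ` ?T"] fT by auto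
  obtain a0 where a0: "a0 \<in> A" using A by auto
  have "focusing_dim A z C (Suc k) (n + m)"
    unfolding focusing_dim_def
  proof (intro allI impI)
    fix \<chi> :: "'a list \<Rightarrow> 'c"
    assume \<chi>: "\<forall>w. length w = n + m \<longrightarrow> set w \<subseteq> insert z A \<longrightarrow> \<chi> w \<in> C"
    have \<chi>C: "\<chi> (w @ u) \<in> C"
      if "length w = n" "set w \<subseteq> insert z A" "length u = m" "set u \<subseteq> A" for w u
    proof -
      have "length (w @ u) = n + m" "set (w @ u) \<subseteq> insert z A" using that by auto
      then show ?thesis using \<chi> by blast
    qed
    define g where "g u = restrict (\<lambda>w. \<chi> (w @ u)) ?W" for u
    have gT: "g u \<in> ?T" if "length u = m" "set u \<subseteq> A" for u
    proof -
      have "\<chi> (w @ u) \<in> C" if "w \<in> ?W" for w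
        using \<chi>C[of w u] that \<open>length u = m\<close> \<open>set u \<subseteq> A\<close> by simp
      then show ?thesis unfolding g_def by auto
    qed
    then have "\<forall>u. length u = m \<longrightarrow> set u \<subseteq> A \<longrightarrow> (code \<circ> g) u \<in> code ` ?T" by auto
    from hj_dimD[OF m this] obtain l where l: "line A m l"
      "\<forall>a\<in>A. \<forall>b\<in>A. (code \<circ> g) (subst l a) = (code \<circ> g) (subst l b)" by blast
    have l_col: "\<chi> (w @ subst l a) = \<chi> (w @ subst l a0)" if "a \<in> A" "w \<in> ?W" for a w
    proof -
      have "code (g (subst l a)) = code (g (subst l a0))" using l(2)[rule_format, OF that(1) a0] by simp
      then have "g (subst l a) = g (subst l a0)"
        using inj_onD[OF code _ gT gT] subst_words[OF l(1)] that(1) a0 by blast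
      then have "g (subst l a) w = g (subst l a0) w" by simp
      then show ?thesis using that(2) unfolding g_def by simp
    qed
    let ?\<chi> = "\<lambda>w. \<chi> (w @ subst l a0)"
    have l0: "length (subst l a0) = m" "set (subst l a0) \<subseteq> A"
      using subst_words[OF l(1) a0] by auto
    have ll: "line (insert z A) (n + m) (l' @ l)" if "line (insert z A) n l'" for l'
      using that l(1) unfolding line_def by auto
    have lc: "line (insert z A) (n + m) (l' @ map Some (subst l a0))"
      if "line (insert z A) n l'" for l'
      using that l0 unfolding line_def by auto
    have "\<forall>w. length w = n \<longrightarrow> set w \<subseteq> insert z A \<longrightarrow> ?\<chi> w \<in> C" using \<chi>C l0 by simp
    from n[unfolded focusing_dim_def, THEN spec[of _ ?\<chi>], THEN mp, OF this]
    show "monochromatic_line (insert z A) (n + m) \<chi> \<or>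
      (\<exists>f D. focused A z (n + m) \<chi> f D \<and> D \<subseteq> C \<and> card D = Suc k)"
    proof (elim disjE exE conjE)
      assume "monochromatic_line (insert z A) n ?\<chi>"
      then obtain l' where l': "line (insert z A) n l'"
        "\<forall>a\<in>insert z A. \<forall>b\<in>insert z A. ?\<chi> (subst l' a) = ?\<chi> (subst l' b)"
        unfolding monochromatic_line_def by (elim exE conjE)
      have "\<forall>a\<in>insert z A. \<forall>b\<in>insert z A.
        \<chi> (subst (l' @ map Some (subst l a0)) a) = \<chi> (subst (l' @ map Some (subst l a0)) b)"
        unfolding subst_append subst_Some by (rule l'(2))
      then show ?thesis using lc[OF l'(1)] unfolding monochromatic_line_def by blast
    next
      fix f D assume f: "focused A z n ?\<chi> f D" and D: "D \<subseteq> C" "card D = k"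
      have fw: "f \<in> ?W" using f unfolding focused_def by auto
      define c where "c = ?\<chi> f"
      have cC: "c \<in> C" unfolding c_def using fw l0 \<chi>C by simp
      show ?thesis
      proof (cases "c \<in> D")
        case True
        then obtain l' where l': "line (insert z A) n l'" "subst l' z = f"
          "\<forall>a\<in>A. ?\<chi> (subst l' a) = c" using f unfolding focused_def by blast
        then have eq: "?\<chi> (subst l' a) = c" if "a \<in> insert z A" for a using c_def that by auto
        have "\<forall>a\<in>insert z A. \<forall>b\<in>insert z A.
          \<chi> (subst (l' @ map Some (subst l a0)) a) = \<chi> (subst (l' @ map Some (subst l a0)) b)"
          unfolding subst_append subst_Some using eq by (intro ballI) (rule trans[OF _ sym])
        then show ?thesis using lc[OF l'(1)] unfolding monochromatic_line_def by blast
      next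
        case False
        let ?f = "f @ subst l z"
        have lz: "length (subst l z) = m" "set (subst l z) \<subseteq> insert z A"
          using subst_words[of "insert z A" m l z] l(1) unfolding line_def by auto
        have "focused A z (n + m) \<chi> ?f (insert c D)"
          unfolding focused_def
        proof (intro conjI ballI)
          show "length ?f = n + m" "set ?f \<subseteq> insert z A" using fw lz by auto
          fix d assume d: "d \<in> insert c D"
          show "\<exists>l. line (insert z A) (n + m) l \<and> subst l z = ?f \<and> (\<forall>a\<in>A. \<chi> (subst l a) = d)"
          proof (cases "d = c")
            case True
            have "line (insert z A) (n + m) (map Some f @ l)"
              using fw l(1) unfolding line_def by auto
            moreover have "\<forall>a\<in>A. \<chi> (subst (map Some f @ l) a) = d"
              unfolding subst_append subst_Some using l_col fw True c_def by simp
            ultimately show ?thesis by (metis subst_append subst_Some)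
          next
            case False
            then obtain l' where l': "line (insert z A) n l'" "subst l' z = f"
              "\<forall>a\<in>A. ?\<chi> (subst l' a) = d" using f d unfolding focused_def by blast
            have "\<chi> (subst (l' @ l) a) = d" if a: "a \<in> A" for a
            proof -
              have "subst l' a \<in> ?W" using subst_words[OF l'(1), of a] a by auto
              then show ?thesis using l_col[OF a] l'(3) a by (simp add: subst_append)
            qed
            then show ?thesis using ll[OF l'(1)] l'(2) by (metis subst_append)
          qed
        qed
        moreover have "card (insert c D) = Suc k"
          using False D C finite_subset by (metis card_insert_disjoint)
        ultimately show ?thesis using D(1) cC by (metis insert_subset)
      qed
    qed
  qed
  then show ?case ..
qed

text \<open>Focusing more lines than there are colours is impossible, so a monochromatic line must have occurred.\<close>

theorem hales_jewett:
  assumes "finite A" "finite (C :: nat set)"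
  shows "\<exists>n. hales_jewett_dim A C n"
  using assms
proof (induction A arbitrary: C rule: finite_induct)
  case empty
  have "line {} 1 [None]" unfolding line_def by simp
  then show ?case unfolding hales_jewett_dim_def monochromatic_line_def by blast
next
  case (insert z A)
  show ?case
  proof (cases "A = {}")
    case True
    have "line (insert z A) 1 [None]" unfolding line_def by simp
    then show ?thesis using True unfolding hales_jewett_dim_def monochromatic_line_def by blast
  next
    case False
    have "\<exists>n. focusing_dim A z C (Suc (card C)) n"
      by (rule colour_focusing[OF insert.hyps(1) False insert.prems]) (rule insert.IH)
    then obtain n where n: "focusing_dim A z C (Suc (card C)) n" ..
    have "hales_jewett_dim (insert z A) C n"
      unfolding hales_jewett_dim_def
    proof (intro allI impI)
      fix \<chi> :: "'a list \<Rightarrow> nat"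
      assume a: "\<forall>w. length w = n \<longrightarrow> set w \<subseteq> insert z A \<longrightarrow> \<chi> w \<in> C"
      show "monochromatic_line (insert z A) n \<chi>"
        using n[unfolded focusing_dim_def, THEN spec[of _ \<chi>], THEN mp, OF a]
      proof
        assume "\<exists>f D. focused A z n \<chi> f D \<and> D \<subseteq> C \<and> card D = Suc (card C)"
        then obtain D where "D \<subseteq> C" "card D = Suc (card C)" by blast
        then show ?thesis using card_mono[OF insert.prems, of D] by simp
      qed
    qed
    then show ?thesis ..
  qed
qed

section \<open>Image structures and gluing\<close>

lemma is_struct_by_hom:
  assumes Y: "is_struct L Y" and h: "hom X Y f" and "finite (vertices X)"
    and r: "\<And>R x. x \<in> rel_interp X R \<Longrightarrow> set x \<subseteq> vertices X"
    and fn: "\<And>F x y. fun_interp X F x = Some y \<Longrightarrow> set x \<subseteq> vertices X \<and> y \<in> vertices X"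
  shows "is_struct L X"
proof (rule is_structI)
  show "countable (vertices X)" using assms(3) by (rule countable_finite)
next
  fix R x assume x: "x \<in> rel_interp X R"
  then have "map f x \<in> rel_interp Y R" using hom_onD(2)[OF h x r[OF x]] by blast
  then show "R \<in> rel_syms L \<and> length x = rel_arity L R \<and> set x \<subseteq> vertices X"
    using struct_relD[OF Y] r[OF x] by (metis length_map)
next
  fix F x y assume x: "fun_interp X F x = Some y"
  then have s: "set x \<subseteq> vertices X" using fn by blast
  have "fun_interp Y F (map f x) = Some (f y)" by (rule hom_onD(3)[OF h x s])
  then show "F \<in> fun_syms L \<and> length x = fun_arity L F \<and> set x \<subseteq> vertices X \<and> y \<in> vertices X"
    using struct_funD[OF Y] fn[OF x] by (metis length_map)
qed

definition image_struct :: "('a \<Rightarrow> 'b) \<Rightarrow> ('a, 'r, 'f) struct \<Rightarrow> ('b, 'r, 'f) struct" where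
  "image_struct f X = \<lparr>vertices = f ` vertices X, rel_interp = (\<lambda>R. map f ` rel_interp X R),
     fun_interp = (\<lambda>F x. if set x \<subseteq> f ` vertices X
       then map_option f (fun_interp X F (map (inv_into (vertices X) f) x)) else None)\<rparr>"

lemma vertices_image_struct [simp]: "vertices (image_struct f X) = f ` vertices X"
  by (simp add: image_struct_def)

lemma emb_on_image_struct:
  assumes X: "is_struct L X" and f: "inj_on f (vertices X)"
  shows "emb X (image_struct f X) f"
proof (rule emb_onI)
  show "inj_on f (vertices X)" by fact
  show "f ` vertices X \<subseteq> vertices (image_struct f X)" by simp
  have inv: "map (inv_into (vertices X) f) (map f u) = u" if "set u \<subseteq> vertices X" for u
    using that f by (auto intro!: map_idI simp: subset_iff)
  show "map f x \<in> rel_interp (image_struct f X) R \<longleftrightarrow> x \<in> rel_interp X R"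
    if x: "set x \<subseteq> vertices X" for R x
  proof
    assume "map f x \<in> rel_interp (image_struct f X) R"
    then obtain u where u: "u \<in> rel_interp X R" "map f x = map f u"
      unfolding image_struct_def by auto
    then have "x = u" using inv[OF x] inv[OF struct_relD(3)[OF X u(1)]] by metis
    then show "x \<in> rel_interp X R" using u(1) by simp
  qed (simp add: image_struct_def)
  show "fun_interp (image_struct f X) F (map f x) = map_option f (fun_interp X F x)"
    if x: "set x \<subseteq> vertices X" for F x
  proof -
    have "set (map f x) \<subseteq> f ` vertices X" using x by auto
    then show ?thesis unfolding image_struct_def using inv[OF x] by simp
  qed
qed

lemma is_struct_image_struct:
  assumes X: "is_struct L X" and f: "inj_on f (vertices X)"
  shows "is_struct L (image_struct f X)"
proof (rule is_structI)
  show "countable (vertices (image_struct f X))" using X unfolding is_struct_def by simp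
next
  fix R x assume "x \<in> rel_interp (image_struct f X) R"
  then obtain u where "u \<in> rel_interp X R" "x = map f u" unfolding image_struct_def by auto
  then show "R \<in> rel_syms L \<and> length x = rel_arity L R \<and> set x \<subseteq> vertices (image_struct f X)"
    using struct_relD[OF X, of u R] by auto
next
  fix F x y assume a: "fun_interp (image_struct f X) F x = Some y"
  then have "set x \<subseteq> f ` vertices X" unfolding image_struct_def by (simp split: if_splits)
  then obtain u where u: "set u \<subseteq> vertices X" "x = map f u" by (rule set_subset_imageE)
  then have "map_option f (fun_interp X F u) = Some y"
    using a emb_onD(4)[OF emb_on_image_struct[OF X f] u(1)] by simp
  then obtain v where "fun_interp X F u = Some v" "y = f v" by auto
  then show "F \<in> fun_syms L \<and> length x = fun_arity L F \<and>
    set x \<subseteq> vertices (image_struct f X) \<and> y \<in> vertices (image_struct f X)"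
    using struct_funD[OF X, of F u v] u by auto
qed

lemma finite_struct_on_type:
  fixes U :: "('a, 'r, 'f) struct"
  assumes inf: "infinite (UNIV :: 'v set)" and U: "is_struct L U" "finite (vertices U)"
  obtains P :: "('v, 'r, 'f) struct" and f g where "is_struct L P" "finite (vertices P)"
    "emb U P f" "hom_emb P U g" "\<forall>u\<in>vertices U. g (f u) = u"
proof -
  obtain W :: "'v set" where W: "finite W" "card W = card (vertices U)"
    using infinite_arbitrarily_large[OF inf, of "card (vertices U)"] by blast
  obtain f where "bij_betw f (vertices U) W"
    using finite_same_card_bij[OF U(2) W(1)] W(2) by auto
  then have f: "inj_on f (vertices U)" by (rule bij_betw_imp_inj_on)
  let ?P = "image_struct f U" and ?g = "inv_into (vertices U) f"
  have e: "emb U ?P f" by (rule emb_on_image_struct[OF U(1) f])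
  have "emb ?P U ?g" using emb_on_inv[OF e closed_in_vertices[OF U(1)]] by simp
  then have "hom_emb ?P U ?g" by (rule emb_hom_emb)
  moreover have "finite (vertices ?P)" using U(2) by simp
  moreover have "\<forall>u\<in>vertices U. ?g (f u) = u" using f by simp
  ultimately show ?thesis using is_struct_image_struct[OF U(1) f] e by (intro that)
qed

text \<open>The union of a family of structures. The choice of a structure in which a function value is defined is
immaterial as soon as the members agree on common vertices.\<close>

definition glue :: "'i set \<Rightarrow> ('i \<Rightarrow> ('a, 'r, 'f) struct) \<Rightarrow> ('a, 'r, 'f) struct" where
  "glue I M = \<lparr>vertices = (\<Union>i\<in>I. vertices (M i)),
     rel_interp = (\<lambda>R. \<Union>i\<in>I. rel_interp (M i) R),
     fun_interp = (\<lambda>F x. if \<exists>i\<in>I. fun_interp (M i) F x \<noteq> None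
       then fun_interp (M (SOME i. i \<in> I \<and> fun_interp (M i) F x \<noteq> None)) F x else None)\<rparr>"

lemma vertices_glue [simp]: "vertices (glue I M) = (\<Union>i\<in>I. vertices (M i))"
  by (simp add: glue_def)

lemma glue_relE:
  assumes "x \<in> rel_interp (glue I M) R"
  obtains i where "i \<in> I" "x \<in> rel_interp (M i) R"
  using assms unfolding glue_def by auto

lemma glue_fun_defined:
  assumes "i \<in> I" "fun_interp (M i) F x \<noteq> None"
  shows "\<exists>j\<in>I. fun_interp (M j) F x \<noteq> None \<and> fun_interp (glue I M) F x = fun_interp (M j) F x"
proof -
  let ?j = "SOME i. i \<in> I \<and> fun_interp (M i) F x \<noteq> None"
  have ex: "\<exists>i\<in>I. fun_interp (M i) F x \<noteq> None" using assms by blast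
  then have "\<exists>i. i \<in> I \<and> fun_interp (M i) F x \<noteq> None" by (simp only: Bex_def)
  then have "?j \<in> I \<and> fun_interp (M ?j) F x \<noteq> None" by (rule someI_ex)
  moreover have "fun_interp (glue I M) F x = fun_interp (M ?j) F x"
    unfolding glue_def struct.simps if_P[OF ex] ..
  ultimately show ?thesis by blast
qed

lemma glue_funE:
  assumes "fun_interp (glue I M) F x = Some y"
  obtains i where "i \<in> I" "fun_interp (M i) F x = Some y"
proof -
  have "\<exists>i\<in>I. fun_interp (M i) F x \<noteq> None"
  proof (rule ccontr)
    assume "\<not> ?thesis"
    then have "fun_interp (glue I M) F x = None" unfolding glue_def by simp
    then show False using assms by simp
  qed
  then obtain i where "i \<in> I" "fun_interp (M i) F x \<noteq> None" by blast
  from glue_fun_defined[of i I M F x, OF this]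
  obtain j where "j \<in> I" "fun_interp (M j) F x = Some y" unfolding assms by auto
  then show ?thesis by (rule that)
qed

lemma glue_tups:
  assumes "x \<in> tups (glue I M)" shows "\<exists>i\<in>I. x \<in> tups (M i)"
proof -
  consider R where "x \<in> rel_interp (glue I M) R" | F y where "fun_interp (glue I M) F x = Some y"
    using assms unfolding tups_def dom_def by blast
  then show ?thesis
  proof cases
    case 1
    then obtain i where "i \<in> I" "x \<in> rel_interp (M i) R" by (rule glue_relE)
    then show ?thesis unfolding tups_def by blast
  next
    case 2
    then obtain i where "i \<in> I" "fun_interp (M i) F x = Some y" by (rule glue_funE)
    then show ?thesis unfolding tups_def by blast
  qed
qed

lemma is_struct_glue:
  assumes "countable I" and M: "\<And>i. i \<in> I \<Longrightarrow> is_struct L (M i)"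
  shows "is_struct L (glue I M)"
proof (rule is_structI)
  show "countable (vertices (glue I M))"
    using assms unfolding vertices_glue is_struct_def by (intro countable_UN) simp_all
next
  fix R x assume "x \<in> rel_interp (glue I M) R"
  then obtain i where i: "i \<in> I" "x \<in> rel_interp (M i) R" by (rule glue_relE)
  show "R \<in> rel_syms L \<and> length x = rel_arity L R \<and> set x \<subseteq> vertices (glue I M)"
    using struct_relD[OF M[OF i(1)] i(2)] i(1) by auto
next
  fix F x y assume "fun_interp (glue I M) F x = Some y"
  then obtain i where i: "i \<in> I" "fun_interp (M i) F x = Some y" by (rule glue_funE)
  show "F \<in> fun_syms L \<and> length x = fun_arity L F \<and> set x \<subseteq> vertices (glue I M) \<and>
    y \<in> vertices (glue I M)"
    using struct_funD[OF M[OF i(1)] i(2)] i(1) by auto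
qed

lemma emb_on_glue:
  assumes M: "\<And>i. i \<in> I \<Longrightarrow> is_struct L (M i)"
    and c: "\<And>i j. i \<in> I \<Longrightarrow> j \<in> I \<Longrightarrow>
      emb_on (M i) (vertices (M i) \<inter> vertices (M j)) (M j) id"
    and i: "i \<in> I"
  shows "emb (M i) (glue I M) id"
proof (rule emb_onI)
  show "inj_on id (vertices (M i))" by simp
  show "id ` vertices (M i) \<subseteq> vertices (glue I M)" using i by auto
  show "map id x \<in> rel_interp (glue I M) R \<longleftrightarrow> x \<in> rel_interp (M i) R"
    if x: "set x \<subseteq> vertices (M i)" for R x
  proof
    assume "map id x \<in> rel_interp (glue I M) R"
    then obtain j where j: "j \<in> I" "x \<in> rel_interp (M j) R" by (auto elim: glue_relE)
    then have "set x \<subseteq> vertices (M j) \<inter> vertices (M i)"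
      using x struct_relD(3)[OF M[OF j(1)]] by blast
    then show "x \<in> rel_interp (M i) R" using emb_onD(3)[OF c[OF j(1) i], of x R] j(2) by simp
  qed (use i in \<open>auto simp: glue_def\<close>)
  show "fun_interp (glue I M) F (map id x) = map_option id (fun_interp (M i) F x)"
    if x: "set x \<subseteq> vertices (M i)" for F x
  proof (cases "fun_interp (glue I M) F x")
    case None
    then have "fun_interp (M i) F x = None" using glue_fun_defined[of i I M F x] i by metis
    then show ?thesis using None by simp
  next
    case (Some y)
    then obtain j where j: "j \<in> I" "fun_interp (M j) F x = Some y" by (rule glue_funE)
    then have "set x \<subseteq> vertices (M j) \<inter> vertices (M i)"
      using x struct_funD(3)[OF M[OF j(1)]] by blast
    then have "fun_interp (M i) F x = Some y"
      using emb_onD(4)[OF c[OF j(1) i], of x F] j(2) by simp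
    then show ?thesis using Some by simp
  qed
qed

lemma hom_on_image_struct:
  assumes X: "is_struct L X" and f: "inj_on f (vertices X)" and g: "hom X Y g"
    and h: "\<And>v. v \<in> vertices X \<Longrightarrow> h (f v) = g v"
  shows "hom (image_struct f X) Y h"
proof (rule hom_on_cong)
  have e: "emb X (image_struct f X) f" by (rule emb_on_image_struct[OF X f])
  let ?i = "inv_into (vertices X) f"
  have "emb_on (image_struct f X) (f ` vertices X) X ?i"
    by (rule emb_on_inv[OF e closed_in_vertices[OF X]])
  from hom_on_comp[OF emb_on_hom_on[OF this] g] show "hom (image_struct f X) Y (g \<circ> ?i)"
    using f by simp
  show "closed_in (image_struct f X) (vertices (image_struct f X))"
    by (rule closed_in_vertices[OF is_struct_image_struct[OF X f]])
  show "h y = (g \<circ> ?i) y" if "y \<in> vertices (image_struct f X)" for y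
    using that h f by auto
qed

lemma hom_on_glue:
  assumes M: "\<And>i. i \<in> I \<Longrightarrow> is_struct L (M i)"
    and h: "\<And>i. i \<in> I \<Longrightarrow> hom (M i) Y h"
  shows "hom (glue I M) Y h"
proof (rule hom_onI)
  show "h ` vertices (glue I M) \<subseteq> vertices Y" using hom_onD(1)[OF h] by auto
  show "map h x \<in> rel_interp Y R" if x: "x \<in> rel_interp (glue I M) R" for R x
  proof -
    obtain i where i: "i \<in> I" "x \<in> rel_interp (M i) R" by (rule glue_relE[OF x])
    show ?thesis by (rule hom_onD(2)[OF h[OF i(1)] i(2) struct_relD(3)[OF M[OF i(1)] i(2)]])
  qed
  show "fun_interp Y F (map h x) = Some (h y)" if x: "fun_interp (glue I M) F x = Some y" for F x y
  proof -
    obtain i where i: "i \<in> I" "fun_interp (M i) F x = Some y" by (rule glue_funE[OF x])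
    show ?thesis by (rule hom_onD(3)[OF h[OF i(1)] i(2) struct_funD(3)[OF M[OF i(1)] i(2)]])
  qed
qed

section \<open>One step of the partite construction\<close>

text \<open>The \<open>N\<close>-fold fibre product, with respect to \<open>\<pi>\<close>, of the substructure of \<open>P\<close> on \<open>W\<close>.\<close>

definition fibre_power ::
  "('a, 'r, 'f) struct \<Rightarrow> ('a \<Rightarrow> 'b) \<Rightarrow> 'a set \<Rightarrow> nat \<Rightarrow> ('a list, 'r, 'f) struct" where
  "fibre_power P \<pi> W N = (let Z = {w. length w = N \<and> set w \<subseteq> W \<and> (\<forall>u\<in>set w. \<forall>v\<in>set w. \<pi> u = \<pi> v)} in
     \<lparr>vertices = Z,
      rel_interp = (\<lambda>R. {x. set x \<subseteq> Z \<and> (\<forall>i<N. map (\<lambda>w. w ! i) x \<in> rel_interp P R)}),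
      fun_interp = (\<lambda>F x.
        if set x \<subseteq> Z \<and> (\<forall>i<N. fun_interp P F (map (\<lambda>w. w ! i) x) \<noteq> None)
        then Some (map (\<lambda>i. the (fun_interp P F (map (\<lambda>w. w ! i) x))) [0..<N]) else None)\<rparr>)"

lemma fibre_power_vertices:
  "w \<in> vertices (fibre_power P \<pi> W N) \<longleftrightarrow>
     length w = N \<and> set w \<subseteq> W \<and> (\<forall>u\<in>set w. \<forall>v\<in>set w. \<pi> u = \<pi> v)"
  unfolding fibre_power_def Let_def by simp

lemma fibre_power_rel:
  "x \<in> rel_interp (fibre_power P \<pi> W N) R \<longleftrightarrow>
     set x \<subseteq> vertices (fibre_power P \<pi> W N) \<and> (\<forall>i<N. map (\<lambda>w. w ! i) x \<in> rel_interp P R)"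
  unfolding fibre_power_def Let_def by simp

lemma fibre_power_fun:
  "fun_interp (fibre_power P \<pi> W N) F x = Some y \<longleftrightarrow>
     set x \<subseteq> vertices (fibre_power P \<pi> W N) \<and> length y = N \<and>
     (\<forall>i<N. fun_interp P F (map (\<lambda>w. w ! i) x) = Some (y ! i))"
proof -
  let ?D = "\<forall>i<N. fun_interp P F (map (\<lambda>w. w ! i) x) \<noteq> None"
  let ?y = "map (\<lambda>i. the (fun_interp P F (map (\<lambda>w. w ! i) x))) [0..<N]"
  have "fun_interp (fibre_power P \<pi> W N) F x =
    (if set x \<subseteq> vertices (fibre_power P \<pi> W N) \<and> ?D then Some ?y else None)"
    unfolding fibre_power_def Let_def by simp
  moreover have "(if c then Some u else None) = Some y \<longleftrightarrow> c \<and> u = y" for c :: bool and u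
    by simp
  moreover have "?D \<and> ?y = y \<longleftrightarrow>
    length y = N \<and> (\<forall>i<N. fun_interp P F (map (\<lambda>w. w ! i) x) = Some (y ! i))"
  proof (intro iffI conjI allI impI)
    assume a: "?D \<and> ?y = y"
    then show "length y = N" by auto
    fix i assume i: "i < N"
    then have "y ! i = the (fun_interp P F (map (\<lambda>w. w ! i) x))" using a by auto
    then show "fun_interp P F (map (\<lambda>w. w ! i) x) = Some (y ! i)" using a i by simp
  next
    assume a: "length y = N \<and> (\<forall>i<N. fun_interp P F (map (\<lambda>w. w ! i) x) = Some (y ! i))"
    then show "fun_interp P F (map (\<lambda>w. w ! i) x) \<noteq> None" if "i < N" for i using that by simp
    show "?y = y" using a by (intro nth_equalityI) auto
  qed
  ultimately show ?thesis by (simp only: conj_assoc)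
qed

text \<open>The structure \<open>P\<close> projects to \<open>C\<close>, and \<open>A1\<close> is the copy in \<open>C\<close> that the step deals with. The number \<open>N\<close>
will be the dimension supplied by the Hales--Jewett theorem. The letters are the sets of \<open>P\<close> that \<open>\<pi>\<close> maps
isomorphically onto \<open>A1\<close>, \<open>fibre\<close> is the part of \<open>P\<close> over \<open>A1\<close>, and \<open>sect V\<close> is the inverse of \<open>\<pi>\<close> on the
letter \<open>V\<close>.\<close>

locale partite_step =
  fixes L :: "('r, 'f) language" and C :: "('c, 'r, 'f) struct" and P :: "('a, 'r, 'f) struct"
    and \<pi> :: "'a \<Rightarrow> 'c" and A1 :: "'c set" and N :: nat
  assumes C: "is_struct L C" and P: "is_struct L P" and fin: "finite (vertices P)"
    and \<pi>: "hom_emb P C \<pi>" and A1: "irred C A1" and N: "0 < N"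
begin

definition letters :: "'a set set" where
  "letters = {V. closed_in P V \<and> emb_on P V C \<pi> \<and> \<pi> ` V = A1}"

definition fibre :: "'a set" where
  "fibre = {v \<in> vertices P. \<pi> v \<in> A1}"

definition sect :: "'a set \<Rightarrow> 'c \<Rightarrow> 'a" where
  "sect V = inv_into V \<pi>"

text \<open>The coordinate that a vertex \<open>v\<close> of the fibre receives on a line: \<open>v\<close> itself where the line moves, and
the vertex with the same projection in the copy of \<open>A1\<close> named by a constant letter.\<close>

definition entry :: "'a set option \<Rightarrow> 'a \<Rightarrow> 'a" where
  "entry p v = (case p of None \<Rightarrow> v | Some V \<Rightarrow> sect V (\<pi> v))"

definition Z :: "('a list, 'r, 'f) struct" where
  "Z = fibre_power P \<pi> fibre N"

definition lines :: "'a set option list set" where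
  "lines = {l. line letters N l}"

definition point :: "'a set option list \<Rightarrow> 'a \<Rightarrow> 'a list" where
  "point l v = map (\<lambda>p. entry p v) l"

lemma \<pi>_hom: "hom P C \<pi>"
  using \<pi> unfolding hom_emb_def by blast

lemma A1_closed: "closed_in C A1"
  using A1 unfolding irred_def by blast

lemma fibre_sub: "fibre \<subseteq> vertices P"
  unfolding fibre_def by blast

lemma fibre_closed: "closed_in P fibre"
  unfolding fibre_def by (rule closed_in_preimage[OF \<pi>_hom closed_in_vertices[OF P] A1_closed])

lemma letters_sub: "V \<in> letters \<Longrightarrow> V \<subseteq> fibre"
  unfolding letters_def fibre_def closed_in_def by blast

lemma finite_letters: "finite letters"
  by (rule finite_subset[OF _ finite_Pow_iff[THEN iffD2, OF fin]]) (use letters_sub fibre_sub in blast)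

lemma sect_emb: "V \<in> letters \<Longrightarrow> emb_on C A1 P (sect V)"
  unfolding letters_def sect_def using emb_on_inv by blast

lemma sect_image: "V \<in> letters \<Longrightarrow> sect V ` A1 = V"
  unfolding letters_def sect_def using inv_into_image_cancel emb_onD(1) by (metis (mono_tags, lifting) mem_Collect_eq subset_refl)

lemma \<pi>_sect: "V \<in> letters \<Longrightarrow> y \<in> A1 \<Longrightarrow> \<pi> (sect V y) = y"
  unfolding letters_def sect_def by (auto intro: f_inv_into_f)

lemma letters_irred:
  assumes "V \<in> letters" shows "irred P V"
  using irred_image[OF A1 sect_emb[OF assms]] sect_image[OF assms] by simp

definition valid_entry :: "'a set option \<Rightarrow> bool" where
  "valid_entry p \<longleftrightarrow> (\<forall>V. p = Some V \<longrightarrow> V \<in> letters)"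

lemma \<pi>_entry: "valid_entry p \<Longrightarrow> v \<in> fibre \<Longrightarrow> \<pi> (entry p v) = \<pi> v"
  unfolding valid_entry_def entry_def fibre_def by (auto split: option.splits simp: \<pi>_sect)

lemma entry_fibre:
  assumes "valid_entry p" "v \<in> fibre" shows "entry p v \<in> fibre"
proof (cases p)
  case None
  then show ?thesis using assms by (simp add: entry_def)
next
  case (Some V)
  then have V: "V \<in> letters" using assms(1) unfolding valid_entry_def by blast
  have "\<pi> v \<in> A1" using assms(2) unfolding fibre_def by blast
  then have "sect V (\<pi> v) \<in> V" using sect_image[OF V] by blast
  then show ?thesis using Some letters_sub[OF V] by (auto simp: entry_def)
qed

lemma entry_hom:
  assumes p: "valid_entry p" shows "hom_on P fibre P (entry p)"
proof (cases p)
  case None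
  have c: "entry p = (\<lambda>v. v)" unfolding None entry_def by simp
  show ?thesis unfolding c using fibre_sub by (auto intro!: hom_onI)
next
  case (Some V)
  then have V: "V \<in> letters" using p unfolding valid_entry_def by blast
  have c: "entry p = sect V \<circ> \<pi>" unfolding Some entry_def by auto
  have e: "emb_on C A1 P (sect V)" by (rule sect_emb[OF V])
  show ?thesis unfolding c
    by (rule hom_on_comp[OF hom_on_subset[OF \<pi>_hom fibre_sub] emb_on_hom_on[OF e]])
      (auto simp: fibre_def)
qed

lemma line_valid_entry: "l \<in> lines \<Longrightarrow> i < N \<Longrightarrow> valid_entry (l ! i)"
  unfolding lines_def line_def valid_entry_def by (auto dest: nth_mem)

lemma line_length: "l \<in> lines \<Longrightarrow> length l = N"
  unfolding lines_def line_def by blast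

lemma line_moving:
  assumes "l \<in> lines" obtains i where "i < N" "l ! i = None"
  using assms unfolding lines_def line_def by (auto simp: in_set_conv_nth)

lemma point_nth: "l \<in> lines \<Longrightarrow> i < N \<Longrightarrow> point l v ! i = entry (l ! i) v"
  unfolding point_def using line_length by simp

lemma Z_vertex: "w \<in> vertices Z \<longleftrightarrow>
    length w = N \<and> (\<forall>i<N. w ! i \<in> fibre) \<and> (\<forall>i<N. \<pi> (w ! i) = \<pi> (w ! 0))"
proof -
  have "set w \<subseteq> fibre \<longleftrightarrow> (\<forall>v\<in>set w. v \<in> fibre)" by auto
  moreover have "(\<forall>i<N. \<forall>j<N. \<pi> (w ! i) = \<pi> (w ! j)) \<longleftrightarrow> (\<forall>i<N. \<pi> (w ! i) = \<pi> (w ! 0))"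
    using N by (intro iffI allI impI) (blast, metis)
  ultimately show ?thesis
    unfolding Z_def fibre_power_vertices by (simp only: all_set_conv_all_nth cong: conj_cong)
qed

lemma Z_nth: "w \<in> vertices Z \<Longrightarrow> i < N \<Longrightarrow> w ! i \<in> fibre"
  and Z_length: "w \<in> vertices Z \<Longrightarrow> length w = N"
  and Z_\<pi>_nth: "w \<in> vertices Z \<Longrightarrow> i < N \<Longrightarrow> \<pi> (w ! i) = \<pi> (w ! 0)"
  unfolding Z_vertex by blast+

lemma Z_rel: "x \<in> rel_interp Z R \<longleftrightarrow>
    set x \<subseteq> vertices Z \<and> (\<forall>i<N. map (\<lambda>w. w ! i) x \<in> rel_interp P R)"
  unfolding Z_def by (rule fibre_power_rel)

lemma Z_fun: "fun_interp Z F x = Some y \<longleftrightarrow> set x \<subseteq> vertices Z \<and> length y = N \<and>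
    (\<forall>i<N. fun_interp P F (map (\<lambda>w. w ! i) x) = Some (y ! i))"
  unfolding Z_def by (rule fibre_power_fun)

lemma Z_proj_hom: "i < N \<Longrightarrow> hom Z P (\<lambda>w. w ! i)"
  using fibre_sub by (intro hom_onI) (auto simp: Z_nth Z_rel Z_fun subset_iff)

lemma Z_map_\<pi>:
  assumes "set x \<subseteq> vertices Z" "i < N"
  shows "map \<pi> (map (\<lambda>w. w ! i) x) = map (\<lambda>w. \<pi> (w ! 0)) x"
  unfolding map_map o_def by (rule map_cong[OF refl]) (use assms Z_\<pi>_nth in blast)

lemma Z_\<pi>_hom: "hom Z C (\<lambda>w. \<pi> (w ! 0))"
  using hom_on_comp[OF Z_proj_hom[OF N] \<pi>_hom hom_onD(1)[OF Z_proj_hom[OF N]]] by (simp add: o_def)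

lemma Z_closed_fun:
  assumes "fun_interp Z F x = Some y" shows "set x \<subseteq> vertices Z" "y \<in> vertices Z"
proof -
  show x: "set x \<subseteq> vertices Z" using assms Z_fun by blast
  have f: "length y = N" "\<forall>i<N. fun_interp P F (map (\<lambda>w. w ! i) x) = Some (y ! i)"
    using assms Z_fun by blast+
  have "y ! i \<in> fibre \<and> \<pi> (y ! i) = \<pi> (y ! 0)" if i: "i < N" for i
  proof
    have "set (map (\<lambda>w. w ! i) x) \<subseteq> fibre" using x i by (auto simp: Z_nth subset_iff)
    then show "y ! i \<in> fibre" using fibre_closed f(2) i unfolding closed_in_def by blast
    have g: "fun_interp C F (map \<pi> (map (\<lambda>w. w ! j) x)) = Some (\<pi> (y ! j))" if j: "j < N" for j
    proof (rule hom_onD(3)[OF \<pi>_hom])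
      show "fun_interp P F (map (\<lambda>w. w ! j) x) = Some (y ! j)" using f(2) j by blast
      show "set (map (\<lambda>w. w ! j) x) \<subseteq> vertices P" using x j fibre_sub by (auto simp: Z_nth subset_iff)
    qed
    show "\<pi> (y ! i) = \<pi> (y ! 0)"
      using g[OF i] g[OF N] unfolding Z_map_\<pi>[OF x i] Z_map_\<pi>[OF x N] by simp
  qed
  then show "y \<in> vertices Z" using f(1) Z_vertex by blast
qed

lemma finite_Z: "finite (vertices Z)"
proof (rule finite_subset)
  show "vertices Z \<subseteq> {w. set w \<subseteq> vertices P \<and> length w = N}"
    using fibre_sub unfolding Z_def by (fastforce simp: fibre_power_vertices)
  show "finite {w. set w \<subseteq> vertices P \<and> length w = N}"
    by (rule finite_lists_length_eq[OF fin])
qed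

lemma Z_struct: "is_struct L Z"
  by (rule is_struct_by_hom[OF C Z_\<pi>_hom finite_Z]) (auto simp: Z_rel dest: Z_closed_fun)

text \<open>Each coordinate maps an irreducible set \<open>S\<close> to a set with irreducible hull, and \<open>\<pi>\<close> is an embedding on
this hull. So two words of \<open>S\<close> with equal projection agree in all coordinates, and a tuple that is
present in the projection is present in all coordinates and hence in the power.\<close>

lemma Z_hom_emb: "hom_emb Z C (\<lambda>w. \<pi> (w ! 0))"
  unfolding hom_emb_def
proof (intro conjI allI impI)
  show "hom Z C (\<lambda>w. \<pi> (w ! 0))" by (rule Z_\<pi>_hom)
  fix S assume S: "irred Z S"
  then have SZ: "S \<subseteq> vertices Z" unfolding irred_def closed_in_def by blast
  let ?T = "\<lambda>i. hull P ((\<lambda>w. w ! i) ` S)"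
  have T: "emb_on P (?T i) C \<pi>" if i: "i < N" for i
  proof -
    have "hom_on Z S P (\<lambda>w. w ! i)"
      using Z_proj_hom[OF i] SZ unfolding hom_on_def by (meson image_mono subset_trans)
    from irred_hull_image[OF P S this] show ?thesis using \<pi> unfolding hom_emb_def by blast
  qed
  have mem: "w ! i \<in> ?T i" if "w \<in> S" for w i
    by (rule subsetD[OF hull_subset]) (rule imageI[OF that])
  have ms: "set (map (\<lambda>w. w ! i) x) \<subseteq> ?T i" if "set x \<subseteq> S" for x i
    unfolding set_map by (rule subset_trans[OF image_mono[OF that] hull_subset])
  show "emb_on Z S C (\<lambda>w. \<pi> (w ! 0))"
  proof (rule emb_onI)
    show "inj_on (\<lambda>w. \<pi> (w ! 0)) S"
    proof (rule inj_onI)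
      fix w w' assume w: "w \<in> S" "w' \<in> S" "\<pi> (w ! 0) = \<pi> (w' ! 0)"
      have "w ! i = w' ! i" if i: "i < N" for i
      proof (rule inj_onD[OF emb_onD(1)[OF T[OF i]]])
        show "\<pi> (w ! i) = \<pi> (w' ! i)" using w SZ Z_\<pi>_nth[OF _ i] by (metis subsetD)
      qed (rule mem[OF w(1)], rule mem[OF w(2)])
      moreover have "length w = N" "length w' = N" using Z_length subsetD[OF SZ] w(1,2) by auto
      ultimately show "w = w'" by (intro nth_equalityI) auto
    qed
    show "(\<lambda>w. \<pi> (w ! 0)) ` S \<subseteq> vertices C" using hom_onD(1)[OF Z_\<pi>_hom] SZ by blast
    show "map (\<lambda>w. \<pi> (w ! 0)) x \<in> rel_interp C R \<longleftrightarrow> x \<in> rel_interp Z R"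
      if x: "set x \<subseteq> S" for R x
    proof -
      have xZ: "set x \<subseteq> vertices Z" using x SZ by blast
      have "map (\<lambda>w. \<pi> (w ! 0)) x \<in> rel_interp C R \<longleftrightarrow> map (\<lambda>w. w ! i) x \<in> rel_interp P R"
        if i: "i < N" for i
        using emb_onD(3)[OF T[OF i] ms[OF x], of R] unfolding Z_map_\<pi>[OF xZ i] .
      then show ?thesis unfolding Z_rel using xZ N by blast
    qed
    show "fun_interp C F (map (\<lambda>w. \<pi> (w ! 0)) x) = map_option (\<lambda>w. \<pi> (w ! 0)) (fun_interp Z F x)"
      if x: "set x \<subseteq> S" for F x
    proof -
      have xZ: "set x \<subseteq> vertices Z" using x SZ by blast
      have eq: "fun_interp C F (map (\<lambda>w. \<pi> (w ! 0)) x) =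
        map_option \<pi> (fun_interp P F (map (\<lambda>w. w ! i) x))" if i: "i < N" for i
        using emb_onD(4)[OF T[OF i] ms[OF x], of F] unfolding Z_map_\<pi>[OF xZ i] .
      show ?thesis
      proof (cases "fun_interp C F (map (\<lambda>w. \<pi> (w ! 0)) x)")
        case None
        then have "fun_interp P F (map (\<lambda>w. w ! 0) x) = None" using eq[OF N] by simp
        then have "fun_interp Z F x = None" using Z_fun N by (metis not_Some_eq)
        then show ?thesis using None by simp
      next
        case (Some c)
        then have "\<forall>i<N. \<exists>y. fun_interp P F (map (\<lambda>w. w ! i) x) = Some y"
          using eq by (metis map_option_eq_Some)
        then obtain y where y: "\<forall>i<N. fun_interp P F (map (\<lambda>w. w ! i) x) = Some (y i)" by metis
        have "fun_interp Z F x = Some (map y [0..<N])" using y xZ by (simp add: Z_fun)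
        moreover have "c = \<pi> (y 0)" using y eq[OF N] Some N by simp
        ultimately show ?thesis using Some N by simp
      qed
    qed
  qed
qed

lemma point_Z:
  assumes "l \<in> lines" "v \<in> fibre" shows "point l v \<in> vertices Z"
  unfolding Z_vertex
proof (intro conjI allI impI)
  show "length (point l v) = N" using line_length[OF assms(1)] by (simp add: point_def)
  fix i assume i: "i < N"
  show "point l v ! i \<in> fibre"
    using point_nth[OF assms(1) i] entry_fibre[OF line_valid_entry[OF assms(1) i] assms(2)] by simp
  show "\<pi> (point l v ! i) = \<pi> (point l v ! 0)"
    using point_nth[OF assms(1) i] point_nth[OF assms(1) N]
      \<pi>_entry[OF line_valid_entry[OF assms(1) i] assms(2)] \<pi>_entry[OF line_valid_entry[OF assms(1) N] assms(2)] by simp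
qed

lemma \<pi>_point:
  assumes "l \<in> lines" "v \<in> fibre" shows "\<pi> (point l v ! 0) = \<pi> v"
  using point_nth[OF assms(1) N] \<pi>_entry[OF line_valid_entry[OF assms(1) N] assms(2)] by simp

text \<open>All coordinates are homomorphisms, and at a moving coordinate the vertex can be read off.\<close>

lemma point_emb:
  assumes l: "l \<in> lines" shows "emb_on P fibre Z (point l)"
proof -
  obtain i0 where i0: "i0 < N" "l ! i0 = None" using line_moving[OF l] .
  have p0: "point l v ! i0 = v" for v using point_nth[OF l i0(1)] i0(2) by (simp add: entry_def)
  have m: "map (\<lambda>w. w ! i) (map (point l) x) = map (entry (l ! i)) x" if "i < N" for x i
    using point_nth[OF l that] by simp
  have m0: "map (entry (l ! i0)) x = x" for x
    using i0(2) by (auto simp: entry_def intro!: map_idI)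
  have pZ: "set (map (point l) x) \<subseteq> vertices Z" if "set x \<subseteq> fibre" for x
    using that point_Z[OF l] by auto
  show ?thesis
  proof (rule emb_onI)
    show "inj_on (point l) fibre" using p0 by (metis inj_onI)
    show "point l ` fibre \<subseteq> vertices Z" using point_Z[OF l] by auto
    show "map (point l) x \<in> rel_interp Z R \<longleftrightarrow> x \<in> rel_interp P R" if x: "set x \<subseteq> fibre" for R x
    proof
      assume "map (point l) x \<in> rel_interp Z R"
      then have "map (\<lambda>w. w ! i0) (map (point l) x) \<in> rel_interp P R" using Z_rel i0(1) by blast
      then show "x \<in> rel_interp P R" unfolding m[OF i0(1)] m0 .
    next
      assume "x \<in> rel_interp P R"
      then have "map (entry (l ! i)) x \<in> rel_interp P R" if "i < N" for i
        using hom_onD(2)[OF entry_hom[OF line_valid_entry[OF l that]] _ x] by blast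
      then show "map (point l) x \<in> rel_interp Z R"
        unfolding Z_rel using pZ[OF x] m by metis
    qed
    show "fun_interp Z F (map (point l) x) = map_option (point l) (fun_interp P F x)"
      if x: "set x \<subseteq> fibre" for F x
    proof (cases "fun_interp P F x")
      case None
      then have "fun_interp P F (map (\<lambda>w. w ! i0) (map (point l) x)) = None"
        unfolding m[OF i0(1)] m0 .
      then have "fun_interp Z F (map (point l) x) = None" using Z_fun i0(1) by (metis not_Some_eq)
      then show ?thesis using None by simp
    next
      case (Some y)
      have "fun_interp P F (map (\<lambda>w. w ! i) (map (point l) x)) = Some (point l y ! i)"
        if i: "i < N" for i
        unfolding m[OF i] point_nth[OF l i]
        by (rule hom_onD(3)[OF entry_hom[OF line_valid_entry[OF l i]] Some x])
      moreover have "length (point l y) = N" using line_length[OF l] by (simp add: point_def)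
      ultimately have "fun_interp Z F (map (point l) x) = Some (point l y)"
        unfolding Z_fun using pZ[OF x] by blast
      then show ?thesis using Some by simp
    qed
  qed
qed

text \<open>The copy of \<open>P\<close> that belongs to the line \<open>l\<close>. Over \<open>A1\<close> it runs through the power \<open>Z\<close>; the other vertices
are new and carry the name of the line.\<close>

definition place :: "'a set option list \<Rightarrow> 'a \<Rightarrow> 'a list + 'a set option list \<times> 'a" where
  "place l v = (if \<pi> v \<in> A1 then Inl (point l v) else Inr (l, v))"

definition piece ::
  "'a set option list option \<Rightarrow> ('a list + 'a set option list \<times> 'a, 'r, 'f) struct" where
  "piece p = (case p of None \<Rightarrow> image_struct Inl Z | Some l \<Rightarrow> image_struct (place l) P)"

definition extension :: "('a list + 'a set option list \<times> 'a, 'r, 'f) struct" where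
  "extension = glue (insert None (Some ` lines)) piece"

definition \<pi>ext :: "'a list + 'a set option list \<times> 'a \<Rightarrow> 'c" where
  "\<pi>ext = case_sum (\<lambda>w. \<pi> (w ! 0)) (\<lambda>(l, v). \<pi> v)"

text \<open>Reading off coordinate \<open>i\<close>. On lines that move at \<open>i\<close> this is the inverse of \<open>place\<close>; on the private
vertices of the other lines the value has no meaning.\<close>

definition retr :: "nat \<Rightarrow> 'a list + 'a set option list \<times> 'a \<Rightarrow> 'a" where
  "retr i = case_sum (\<lambda>w. w ! i) (\<lambda>(l, v). v)"

lemma place_fibre: "v \<in> fibre \<Longrightarrow> place l v = Inl (point l v)"
  unfolding place_def fibre_def by simp

lemma place_outside: "v \<in> vertices P \<Longrightarrow> v \<notin> fibre \<Longrightarrow> place l v = Inr (l, v)"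
  unfolding place_def fibre_def by simp

lemma place_inj:
  assumes l: "l \<in> lines" shows "inj_on (place l) (vertices P)"
proof (rule inj_onI)
  fix u v assume uv: "u \<in> vertices P" "v \<in> vertices P" "place l u = place l v"
  show "u = v"
  proof (cases "u \<in> fibre \<and> v \<in> fibre")
    case True
    then have "point l u = point l v" using uv(3) place_fibre by simp
    then show ?thesis using inj_onD[OF emb_onD(1)[OF point_emb[OF l]]] True by blast
  next
    case False
    then show ?thesis using uv place_fibre place_outside by (cases "u \<in> fibre"; cases "v \<in> fibre") auto
  qed
qed

lemma piece_simps [simp]: "piece None = image_struct Inl Z" "piece (Some l) = image_struct (place l) P"
  unfolding piece_def by simp_all

lemma piece_struct: "p \<in> insert None (Some ` lines) \<Longrightarrow> is_struct L (piece p)"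
  using is_struct_image_struct[OF Z_struct, of Inl] is_struct_image_struct[OF P place_inj] by auto

lemma piece_Z: "emb Z (piece None) Inl"
  using emb_on_image_struct[OF Z_struct, of Inl] by simp

lemma piece_line: "l \<in> lines \<Longrightarrow> emb P (piece (Some l)) (place l)"
  using emb_on_image_struct[OF P place_inj] by simp

lemma line_Z_common:
  assumes "l \<in> lines"
  shows "place l ` vertices P \<inter> Inl ` vertices Z = place l ` fibre"
proof (intro equalityI subsetI)
  fix x assume "x \<in> place l ` vertices P \<inter> Inl ` vertices Z"
  then obtain v w where v: "v \<in> vertices P" "x = place l v" "x = Inl w" by blast
  then have "v \<in> fibre" using place_outside by (cases "v \<in> fibre") auto
  then show "x \<in> place l ` fibre" using v(2) by blast
next
  fix x assume "x \<in> place l ` fibre"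
  then obtain v where v: "v \<in> fibre" "x = place l v" by blast
  then have "x \<in> place l ` vertices P" using fibre_sub by blast
  moreover have "x \<in> Inl ` vertices Z"
    unfolding v(2) place_fibre[OF v(1)] using point_Z[OF assms v(1)] by (rule imageI)
  ultimately show "x \<in> place l ` vertices P \<inter> Inl ` vertices Z" by (rule IntI)
qed

lemma compat_line_Z:
  assumes l: "l \<in> lines"
  shows "emb_on (piece (Some l)) (place l ` fibre) (piece None) id"
proof (rule emb_on_transport)
  show "emb_on P fibre (piece (Some l)) (place l)" by (rule emb_on_subset[OF piece_line[OF l] fibre_sub])
  show "closed_in P fibre" by (rule fibre_closed)
  show "emb_on P fibre (piece None) (Inl \<circ> point l)"
    by (rule emb_on_comp[OF point_emb[OF l] piece_Z emb_onD(2)[OF point_emb[OF l]]])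
  show "id (place l v) = (Inl \<circ> point l) v" if "v \<in> fibre" for v using place_fibre[OF that] by simp
qed

lemma compat_Z_line:
  assumes l: "l \<in> lines"
  shows "emb_on (piece None) (place l ` fibre) (piece (Some l)) id"
  by (rule emb_on_id_sym[OF compat_line_Z[OF l]]) (use fibre_sub in auto)

lemma two_lines_common:
  assumes "l \<noteq> l'"
  shows "place l ` vertices P \<inter> place l' ` vertices P \<subseteq> place l ` fibre \<inter> place l' ` fibre"
proof
  fix x assume "x \<in> place l ` vertices P \<inter> place l' ` vertices P"
  then obtain u v where uv: "u \<in> vertices P" "v \<in> vertices P" "x = place l u" "x = place l' v" by blast
  then have "u \<in> fibre \<and> v \<in> fibre"
    using assms place_fibre place_outside by (cases "u \<in> fibre"; cases "v \<in> fibre") auto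
  then show "x \<in> place l ` fibre \<inter> place l' ` fibre" using uv by blast
qed

text \<open>Two different lines meet only inside \<open>Z\<close>, and there both agree with \<open>Z\<close> since they are embedded by
\<open>point_emb\<close>.\<close>

lemma piece_compat:
  assumes "p \<in> insert None (Some ` lines)" "q \<in> insert None (Some ` lines)"
  shows "emb_on (piece p) (vertices (piece p) \<inter> vertices (piece q)) (piece q) id"
proof (cases "p = q")
  case True
  show ?thesis unfolding True Int_absorb by (rule emb_on_refl[OF subset_refl])
next
  case False
  show ?thesis
  proof (cases p)
    case None
    then obtain l where l: "q = Some l" "l \<in> lines" using False assms(2) by auto
    show ?thesis unfolding None l(1)
      using compat_Z_line[OF l(2)] line_Z_common[OF l(2)] by (simp add: Int_commute)
  next
    case p: (Some l)
    then have l: "l \<in> lines" using assms(1) by auto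
    show ?thesis
    proof (cases q)
      case None
      show ?thesis unfolding None p
        using compat_line_Z[OF l] line_Z_common[OF l] by simp
    next
      case q: (Some l')
      then have l': "l' \<in> lines" "l \<noteq> l'" using assms(2) p False by auto
      let ?W = "place l ` vertices P \<inter> place l' ` vertices P"
      have W: "?W \<subseteq> place l ` fibre" "?W \<subseteq> place l' ` fibre" using two_lines_common[OF l'(2)] by auto
      have "emb_on (piece (Some l)) ?W (piece (Some l')) (id \<circ> id)"
        by (rule emb_on_comp[OF emb_on_subset[OF compat_line_Z[OF l] W(1)]
              emb_on_subset[OF compat_Z_line[OF l'(1)] W(2)]]) simp
      then show ?thesis unfolding p q by simp
    qed
  qed
qed

lemma extension_Z: "emb Z extension Inl"
proof -
  have "emb (piece None) extension id"
    unfolding extension_def by (rule emb_on_glue[OF piece_struct piece_compat]) auto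
  from emb_on_comp[OF piece_Z this] show ?thesis by simp
qed

lemma extension_line: assumes l: "l \<in> lines" shows "emb P extension (place l)"
proof -
  have "emb (piece (Some l)) extension id"
    unfolding extension_def by (rule emb_on_glue[OF piece_struct piece_compat]) (use l in auto)
  from emb_on_comp[OF piece_line[OF l] this] show ?thesis by simp
qed

lemma \<pi>ext_place:
  assumes "l \<in> lines" "v \<in> vertices P" shows "\<pi>ext (place l v) = \<pi> v"
proof (cases "v \<in> fibre")
  case True
  then show ?thesis using \<pi>_point[OF assms(1)] by (simp add: \<pi>ext_def place_fibre)
next
  case False
  then show ?thesis using assms(2) by (simp add: \<pi>ext_def place_outside)
qed

lemma \<pi>ext_hom: "hom extension C \<pi>ext"
  unfolding extension_def
proof (rule hom_on_glue[OF piece_struct])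
  fix p assume p: "p \<in> insert None (Some ` lines)"
  show "hom (piece p) C \<pi>ext"
  proof (cases p)
    case None
    show ?thesis unfolding None piece_simps
      by (rule hom_on_image_struct[OF Z_struct _ Z_\<pi>_hom]) (simp_all add: \<pi>ext_def)
  next
    case (Some l)
    then have l: "l \<in> lines" using p by auto
    show ?thesis unfolding Some piece_simps
      by (rule hom_on_image_struct[OF P place_inj[OF l] \<pi>_hom \<pi>ext_place[OF l]])
  qed
qed

lemma finite_lines: "finite lines"
proof (rule finite_subset)
  show "lines \<subseteq> {l. set l \<subseteq> insert None (Some ` letters) \<and> length l = N}"
  proof
    fix l assume l: "l \<in> lines"
    have "p \<in> insert None (Some ` letters)" if "p \<in> set l" for p
      using l that unfolding lines_def line_def by (cases p) auto
    then show "l \<in> {l. set l \<subseteq> insert None (Some ` letters) \<and> length l = N}"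
      using line_length[OF l] by blast
  qed
  show "finite {l. set l \<subseteq> insert None (Some ` letters) \<and> length l = N}"
    by (rule finite_lists_length_eq) (simp add: finite_letters)
qed

lemma finite_extension: "finite (vertices extension)"
  unfolding extension_def using finite_Z fin finite_lines by auto

lemma extension_struct: "is_struct L extension"
  unfolding extension_def
  by (rule is_struct_glue[OF _ piece_struct]) (simp_all add: countable_finite finite_lines)

lemma vertices_extension:
  "vertices extension = Inl ` vertices Z \<union> (\<Union>l\<in>lines. place l ` vertices P)"
  unfolding extension_def by simp

lemma place_fibre_sub: "l \<in> lines \<Longrightarrow> place l ` fibre \<subseteq> Inl ` vertices Z"
  using line_Z_common by blast

lemma closed_line: "l \<in> lines \<Longrightarrow> closed_in extension (place l ` vertices P)"
  by (rule closed_in_image[OF extension_line closed_in_vertices[OF P]])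

lemma closed_place_fibre: "l \<in> lines \<Longrightarrow> closed_in extension (place l ` fibre)"
  by (rule closed_in_image[OF emb_on_subset[OF extension_line fibre_sub] fibre_closed])

lemma extension_fun_piece:
  assumes "fun_interp extension F x = Some y"
  obtains "set x \<subseteq> Inl ` vertices Z" "y \<in> Inl ` vertices Z"
  | l where "l \<in> lines" "set x \<subseteq> place l ` vertices P" "y \<in> place l ` vertices P"
proof -
  obtain p where p: "p \<in> insert None (Some ` lines)" "fun_interp (piece p) F x = Some y"
    using assms unfolding extension_def by (rule glue_funE)
  have v: "set x \<subseteq> vertices (piece p)" "y \<in> vertices (piece p)"
    using struct_funD(3,4)[OF piece_struct[OF p(1)] p(2)] by blast+
  show ?thesis
  proof (cases p)
    case None
    show ?thesis by (rule that(1)) (use v None in simp_all)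
  next
    case (Some l)
    show ?thesis by (rule that(2)[of l]) (use v p Some in auto)
  qed
qed

lemma extension_tups_piece:
  assumes "x \<in> tups extension"
  shows "set x \<subseteq> Inl ` vertices Z \<or> (\<exists>l\<in>lines. set x \<subseteq> place l ` vertices P)"
proof -
  obtain p where p: "p \<in> insert None (Some ` lines)" "x \<in> tups (piece p)"
    using glue_tups assms unfolding extension_def by blast
  have "set x \<subseteq> vertices (piece p)" by (rule tups_vertices[OF piece_struct[OF p(1)] p(2)])
  then show ?thesis using p(1) by (cases p) auto
qed

text \<open>What remains when the vertices that belong to the line \<open>l\<close> alone are removed.\<close>

definition off_line :: "'a set option list \<Rightarrow> ('a list + 'a set option list \<times> 'a) set" where
  "off_line l = Inl ` vertices Z \<union> (\<Union>l'\<in>lines - {l}. place l' ` vertices P)"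

lemma line_off_line:
  assumes "l \<in> lines" shows "place l ` vertices P \<inter> off_line l \<subseteq> place l ` fibre"
proof
  fix x assume x: "x \<in> place l ` vertices P \<inter> off_line l"
  then consider "x \<in> Inl ` vertices Z" | l' where "l' \<noteq> l" "x \<in> place l' ` vertices P"
    unfolding off_line_def by blast
  then show "x \<in> place l ` fibre"
  proof cases
    case 1
    then show ?thesis using x line_Z_common[OF assms] by blast
  next
    case 2
    then show ?thesis using x two_lines_common[OF 2(1)] by blast
  qed
qed

lemma closed_off_line:
  assumes l: "l \<in> lines" shows "closed_in extension (off_line l)"
  unfolding closed_in_def
proof (intro conjI allI impI)
  show "off_line l \<subseteq> vertices extension" unfolding off_line_def vertices_extension by blast
  fix F x y assume f: "fun_interp extension F x = Some y" and x: "set x \<subseteq> off_line l"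
  show "y \<in> off_line l"
    using f
  proof (rule extension_fun_piece)
    assume "y \<in> Inl ` vertices Z"
    then show ?thesis unfolding off_line_def by (rule UnI1)
  next
    fix l' assume l': "l' \<in> lines" "set x \<subseteq> place l' ` vertices P" "y \<in> place l' ` vertices P"
    show ?thesis
    proof (cases "l' = l")
      case True
      then have "set x \<subseteq> place l ` fibre" using l'(2) x line_off_line[OF l] by blast
      then have "y \<in> place l ` fibre" using closed_place_fibre[OF l] f unfolding closed_in_def by blast
      then show ?thesis using place_fibre_sub[OF l] unfolding off_line_def by blast
    next
      case False
      then show ?thesis using l'(1,3) unfolding off_line_def by blast
    qed
  qed
qed

text \<open>The copy of \<open>P\<close> on the line \<open>l\<close> and \<open>off_line l\<close> are closed and no tuple is split between them. An irreducible set
not inside \<open>Z\<close> has a vertex that belongs to some line alone, and is therefore contained in the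
copy on that line.\<close>

lemma irred_extension_cases:
  assumes S: "irred extension S"
  obtains (power) T where "irred Z T" "S = Inl ` T"
  | (line) l T where "l \<in> lines" "irred P T" "S = place l ` T"
proof (cases "S \<subseteq> Inl ` vertices Z")
  case True
  obtain T where "irred Z T" "S = Inl ` T"
    by (rule irred_pullback[OF extension_Z closed_in_vertices[OF Z_struct] S True])
  then show ?thesis by (rule power)
next
  case False
  have SV: "S \<subseteq> vertices extension" by (rule closed_in_sub[OF irred_closed[OF S]])
  obtain x where x: "x \<in> S" "x \<notin> Inl ` vertices Z" using False by blast
  then obtain l where l: "l \<in> lines" "x \<in> place l ` vertices P"
    using SV unfolding vertices_extension by blast
  have "S \<subseteq> place l ` vertices P \<or> S \<subseteq> off_line l"
  proof (rule irredD[OF S closed_line[OF l(1)] closed_off_line[OF l(1)]])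
    show "S \<subseteq> place l ` vertices P \<union> off_line l"
      using SV unfolding vertices_extension off_line_def by blast
    show "set x \<subseteq> place l ` vertices P \<or> set x \<subseteq> off_line l" if "x \<in> tups extension" for x
      using extension_tups_piece[OF that] unfolding off_line_def by blast
  qed
  moreover have "x \<notin> off_line l" using x(2) l(2) line_off_line[OF l(1)] place_fibre_sub[OF l(1)] by blast
  ultimately have SP: "S \<subseteq> place l ` vertices P" using x(1) by blast
  obtain T where "irred P T" "S = place l ` T"
    by (rule irred_pullback[OF extension_line[OF l(1)] closed_in_vertices[OF P] S SP])
  then show ?thesis by (rule line[OF l(1)])
qed

lemma irred_P_sub: "irred P T \<Longrightarrow> T \<subseteq> vertices P"
  by (rule closed_in_sub[OF irred_closed])

lemma irred_Z_sub: "irred Z T \<Longrightarrow> T \<subseteq> vertices Z"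
  by (rule closed_in_sub[OF irred_closed])

lemma transport_Z:
  assumes T: "irred Z T" and g: "emb_on Z T W g" and h: "\<And>w. w \<in> T \<Longrightarrow> h (Inl w) = g w"
  shows "emb_on extension (Inl ` T) W h"
  by (rule emb_on_transport[OF emb_on_subset[OF extension_Z irred_Z_sub[OF T]] irred_closed[OF T] g h])

lemma transport_line:
  assumes l: "l \<in> lines" and T: "irred P T" and g: "emb_on P T W g"
    and h: "\<And>v. v \<in> T \<Longrightarrow> h (place l v) = g v"
  shows "emb_on extension (place l ` T) W h"
  by (rule emb_on_transport[OF emb_on_subset[OF extension_line[OF l] irred_P_sub[OF T]]
        irred_closed[OF T] g h])

lemma extension_hom_emb: "hom_emb extension C \<pi>ext"
  unfolding hom_emb_def
proof (intro conjI allI impI)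
  show "hom extension C \<pi>ext" by (rule \<pi>ext_hom)
  fix S assume "irred extension S"
  then show "emb_on extension S C \<pi>ext"
  proof (cases rule: irred_extension_cases)
    case (power T)
    have "emb_on Z T C (\<lambda>w. \<pi> (w ! 0))"
      using Z_hom_emb power(1) unfolding hom_emb_def by blast
    then show ?thesis unfolding power(2)
      by (rule transport_Z[OF power(1)]) (simp add: \<pi>ext_def)
  next
    case (line l T)
    have "emb_on P T C \<pi>" using \<pi> line(2) unfolding hom_emb_def by blast
    then show ?thesis unfolding line(3)
      by (rule transport_line[OF line(1,2)]) (use \<pi>ext_place[OF line(1)] irred_P_sub[OF line(2)] in blast)
  qed
qed

text \<open>The projection of \<open>Z\<close> to \<open>C\<close> embeds irreducible sets and factors through coordinate \<open>i\<close>.\<close>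

lemma retr_Z:
  assumes T: "irred Z T" and i: "i < N"
  shows "emb_on extension (Inl ` T) P (retr i)"
proof (rule transport_Z[OF T])
  show "emb_on Z T P (\<lambda>w. w ! i)"
  proof (rule emb_on_from_comp)
    show "emb_on Z T C (\<lambda>w. \<pi> (w ! 0))" using Z_hom_emb T unfolding hom_emb_def by blast
    show "hom_on Z T P (\<lambda>w. w ! i)" by (rule hom_on_subset[OF Z_proj_hom[OF i] irred_Z_sub[OF T]])
    show "hom P C \<pi>" by (rule \<pi>_hom)
    show "\<pi> (w ! 0) = \<pi> (w ! i)" if "w \<in> T" for w
      by (rule sym, rule Z_\<pi>_nth[OF subsetD[OF irred_Z_sub[OF T] that] i])
  qed
qed (simp add: retr_def)

lemma retr_place_fibre:
  assumes "l \<in> lines" "i < N" "v \<in> fibre"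
  shows "retr i (place l v) = entry (l ! i) v"
  unfolding place_fibre[OF assms(3)] retr_def using point_nth[OF assms(1,2)] by simp

lemma retr_place_moving:
  assumes "l \<in> lines" "i < N" "l ! i = None" "v \<in> vertices P"
  shows "retr i (place l v) = v"
proof (cases "v \<in> fibre")
  case True
  then show ?thesis using retr_place_fibre[OF assms(1,2) True] assms(3) by (simp add: entry_def)
next
  case False
  then show ?thesis using place_outside[OF assms(4) False] by (simp add: retr_def)
qed

lemma retr_line:
  assumes l: "l \<in> lines" and i: "i < N" "l ! i = None" and T: "irred P T"
  shows "emb_on extension (place l ` T) P (retr i)"
  by (rule transport_line[OF l T emb_on_refl[OF irred_P_sub[OF T]]])
    (use retr_place_moving[OF l i] irred_P_sub[OF T] in auto)

text \<open>The copy of \<open>A\<close> that a line \<open>l\<close> makes of the letter \<open>V\<close> depends only on the word obtained by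
substituting \<open>V\<close> in \<open>l\<close>. This is what turns colourings of copies into colourings of words.\<close>

lemma place_copy:
  assumes l: "l \<in> lines" and V: "V \<in> letters"
  shows "place l ` V = (\<lambda>y. Inl (map (\<lambda>U. sect U y) (subst l V))) ` A1"
proof -
  have "place l (sect V y) = Inl (map (\<lambda>U. sect U y) (subst l V))" if y: "y \<in> A1" for y
  proof -
    have s: "sect V y \<in> fibre" using sect_image[OF V] letters_sub[OF V] y by blast
    have "entry p (sect V y) = sect (case p of None \<Rightarrow> V | Some U \<Rightarrow> U) y" for p
      unfolding entry_def using \<pi>_sect[OF V y] by (simp split: option.split)
    then show ?thesis unfolding place_fibre[OF s] point_def subst_def by simp
  qed
  then have "place l ` sect V ` A1 = (\<lambda>y. Inl (map (\<lambda>U. sect U y) (subst l V))) ` A1"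
    unfolding image_image by (rule image_cong[OF refl])
  then show ?thesis unfolding sect_image[OF V] .
qed

lemma step_arrow:
  assumes N': "hales_jewett_dim letters C' N" and \<chi>: "\<And>V. \<chi> V \<in> C'"
  shows "\<exists>e c. emb P extension e \<and> (\<forall>v\<in>vertices P. \<pi>ext (e v) = \<pi> v) \<and>
    (\<forall>V\<in>letters. \<chi> (e ` V) = c)"
proof -
  let ?\<chi> = "\<lambda>w. \<chi> ((\<lambda>y. Inl (map (\<lambda>U. sect U y) w)) ` A1)"
  have "\<forall>w. length w = N \<longrightarrow> set w \<subseteq> letters \<longrightarrow> ?\<chi> w \<in> C'" using \<chi> by blast
  from hj_dimD[OF N' this] obtain l where l: "line letters N l"
    "\<forall>V\<in>letters. \<forall>W\<in>letters. ?\<chi> (subst l V) = ?\<chi> (subst l W)" by (elim exE conjE)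
  have ll: "l \<in> lines" unfolding lines_def using l(1) by simp
  have "\<chi> (place l ` V) = \<chi> (place l ` W)" if "V \<in> letters" "W \<in> letters" for V W
    unfolding place_copy[OF ll that(1)] place_copy[OF ll that(2)]
    by (rule l(2)[rule_format, OF that])
  then have "\<exists>c. \<forall>V\<in>letters. \<chi> (place l ` V) = c" by (cases "letters = {}") blast+
  then show ?thesis using extension_line[OF ll] \<pi>ext_place[OF ll] by blast
qed

end

section \<open>Completing finitely many irreducible sets\<close>

text \<open>The map \<open>h\<close> is common to all sets of the family, but it is required to be an embedding only on
each of them; nothing is demanded of other irreducible sets inside their union.\<close>

definition completable ::
  "('v, 'r, 'f) struct set \<Rightarrow> nat \<Rightarrow> ('a, 'r, 'f) struct \<Rightarrow> bool" where
  "completable \<K> t X \<longleftrightarrow> (\<forall>\<S>. finite \<S> \<longrightarrow> card \<S> \<le> t \<longrightarrow> (\<forall>S\<in>\<S>. irred X S) \<longrightarrow>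
     (\<exists>K\<in>\<K>. \<exists>h. \<forall>S\<in>\<S>. emb_on X S K h))"

lemma completableD:
  assumes "completable \<K> t X" "finite \<S>" "card \<S> \<le> t" "\<And>S. S \<in> \<S> \<Longrightarrow> irred X S"
  obtains K h where "K \<in> \<K>" "\<And>S. S \<in> \<S> \<Longrightarrow> emb_on X S K h"
proof -
  have "\<exists>K\<in>\<K>. \<exists>h. \<forall>S\<in>\<S>. emb_on X S K h"
    using assms(1)[unfolded completable_def, THEN spec[of _ \<S>]] assms(2-4) by simp
  then show ?thesis using that by blast
qed

lemma completable_witness:
  assumes "K \<in> \<K>" "\<And>S. S \<in> \<S> \<Longrightarrow> emb_on X S K h"
  shows "\<exists>K\<in>\<K>. \<exists>h. \<forall>S\<in>\<S>. emb_on X S K h"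
  using assms by blast

lemma completable_one:
  assumes "completable \<K> 1 X" "irred X S"
  obtains K h where "K \<in> \<K>" "emb_on X S K h"
proof -
  obtain K h where "K \<in> \<K>" "\<And>T. T \<in> {S} \<Longrightarrow> emb_on X T K h"
    by (rule completableD[OF assms(1), of "{S}"]) (use assms(2) in auto)
  then show ?thesis using that by simp
qed

lemma completable_mono: "completable \<K> t X \<Longrightarrow> s \<le> t \<Longrightarrow> completable \<K> s X"
  unfolding completable_def by (meson order_trans)

lemma completable_pullback:
  assumes f: "hom_emb X Y f" and Y: "completable \<K> t Y"
  shows "completable \<K> t X"
  unfolding completable_def
proof (intro allI impI)
  fix \<S> assume S: "finite \<S>" "card \<S> \<le> t" "\<forall>S\<in>\<S>. irred X S"
  have e: "emb_on X S Y f" if "S \<in> \<S>" for S using f S(3) that unfolding hom_emb_def by blast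
  have "card ((`) f ` \<S>) \<le> t" using card_image_le[OF S(1), of "(`) f"] S(2) by simp
  moreover have "irred Y T" if "T \<in> (`) f ` \<S>" for T
    using that irred_image e S(3) by blast
  ultimately obtain K h where K: "K \<in> \<K>" "\<And>T. T \<in> (`) f ` \<S> \<Longrightarrow> emb_on Y T K h"
    using completableD[OF Y finite_imageI[OF S(1)]] by metis
  have "emb_on X S K (h \<circ> f)" if "S \<in> \<S>" for S
    by (rule emb_on_comp[OF e[OF that] K(2)[OF imageI[OF that]] subset_refl])
  then show "\<exists>K\<in>\<K>. \<exists>h. \<forall>S\<in>\<S>. emb_on X S K h" by (rule completable_witness[OF K(1)])
qed

locale amalg_class =
  fixes L :: "('r, 'f) language" and \<K> :: "('v, 'r, 'f) struct set"
  assumes cls: "struct_class L \<K>" and her: "hereditary L \<K>"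
    and sap: "strong_amalgamation_property L \<K>"
begin

lemma K_struct: "K \<in> \<K> \<Longrightarrow> is_struct L K"
  using cls unfolding struct_class_def by simp

lemma K_induced:
  assumes "K \<in> \<K>" "closed_in K V" shows "induced K V \<in> \<K>"
proof -
  have "substructure L (induced K V) K"
    using substructure_iff[OF K_struct[OF assms(1)]] assms(2) by blast
  then show ?thesis using her assms(1) unfolding hereditary_def by simp
qed

lemma K_iso:
  assumes "K \<in> \<K>" "is_struct L X" "emb K X f" "f ` vertices K = vertices X"
  shows "X \<in> \<K>"
proof -
  have "struct_isomorphic L K X"
    unfolding struct_isomorphic_def struct_emb_iff using assms K_struct by blast
  then show ?thesis using cls assms(1) unfolding struct_class_def by simp
qed

lemma K_pullback:
  assumes X: "is_struct L X" and V: "closed_in X V" and K: "K \<in> \<K>" and h: "emb_on X V K h"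
  shows "induced X V \<in> \<K>"
proof (rule K_iso)
  show "induced K (h ` V) \<in> \<K>" by (rule K_induced[OF K closed_in_image[OF h V]])
  show "is_struct L (induced X V)" by (rule is_struct_induced[OF X V])
  have im: "inv_into V h ` h ` V = V" using emb_onD(1)[OF h] by simp
  have "emb_on K (h ` V) (induced X V) (inv_into V h)"
    by (rule emb_on_into_induced[OF emb_on_inv[OF h V]]) (simp only: im subset_refl)
  then show "emb (induced K (h ` V)) (induced X V) (inv_into V h)"
    by simp
  show "inv_into V h ` vertices (induced K (h ` V)) = vertices (induced X V)" by (simp only: induced_simps im)
qed

lemma amalg:
  assumes "A \<in> \<K>" "K1 \<in> \<K>" "K2 \<in> \<K>"
    and "emb A K1 f1" "emb A K2 f2"
  obtains D g1 g2 where "D \<in> \<K>" "emb K1 D g1" "emb K2 D g2"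
    "\<And>x. x \<in> vertices A \<Longrightarrow> g1 (f1 x) = g2 (f2 x)"
proof -
  have "struct_emb L A K1 f1" "struct_emb L A K2 f2"
    using assms K_struct unfolding struct_emb_iff by blast+
  then obtain D g1 g2 where "D \<in> \<K>" "strong_amalgamation L A K1 K2 f1 f2 D g1 g2"
    using sap assms(1-3) unfolding strong_amalgamation_property_def by metis
  then show ?thesis
    using that[of D g1 g2] unfolding strong_amalgamation_def struct_emb_iff by simp
qed

text \<open>Attach the structures \<open>K j\<close> one at a time; the copies of \<open>A\<close> in \<open>K0\<close> remain available because
\<open>K0\<close> stays embedded.\<close>

lemma multi_amalg:
  assumes A: "A \<in> \<K>" and J: "finite J" and K0: "K0 \<in> \<K>"
    and K: "\<And>j. j \<in> J \<Longrightarrow> K j \<in> \<K>"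
    and a: "\<And>j. j \<in> J \<Longrightarrow> emb A K0 (a j)"
    and f: "\<And>j. j \<in> J \<Longrightarrow> emb A (K j) (f j)"
  shows "\<exists>D\<in>\<K>. \<exists>g0 g. emb K0 D g0 \<and>
    (\<forall>j\<in>J. emb (K j) D (g j) \<and> (\<forall>x\<in>vertices A. g0 (a j x) = g j (f j x)))"
  using J K a f
proof (induction J)
  case empty
  have "emb K0 K0 id" by (rule emb_on_refl[OF subset_refl])
  then show ?case using K0 by blast
next
  case (insert i J)
  have "\<exists>D\<in>\<K>. \<exists>g0 g. emb K0 D g0 \<and>
    (\<forall>j\<in>J. emb (K j) D (g j) \<and> (\<forall>x\<in>vertices A. g0 (a j x) = g j (f j x)))"
    by (rule insert.IH) (use insert.prems in auto)
  then obtain D g0 g where D: "D \<in> \<K>" "emb K0 D g0"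
    and g: "\<And>j. j \<in> J \<Longrightarrow> emb (K j) D (g j)"
      "\<And>j x. j \<in> J \<Longrightarrow> x \<in> vertices A \<Longrightarrow> g0 (a j x) = g j (f j x)" by blast
  have i: "K i \<in> \<K>" "emb A K0 (a i)" "emb A (K i) (f i)"
    using insert.prems by auto
  have "emb A D (g0 \<circ> a i)"
    by (rule emb_on_comp[OF i(2) D(2) emb_onD(2)[OF i(2)]])
  then obtain E b1 b2 where E: "E \<in> \<K>" "emb D E b1"
    "emb (K i) E b2"
    "\<And>x. x \<in> vertices A \<Longrightarrow> b1 ((g0 \<circ> a i) x) = b2 (f i x)"
    using amalg[OF A D(1) i(1) _ i(3)] by metis
  let ?g = "\<lambda>j. if j = i then b2 else b1 \<circ> g j"
  have "emb (K j) E (?g j) \<and> (\<forall>x\<in>vertices A. (b1 \<circ> g0) (a j x) = ?g j (f j x))"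
    if j: "j \<in> insert i J" for j
  proof (cases "j = i")
    case True
    then show ?thesis using E(3,4) by simp
  next
    case False
    then have jJ: "j \<in> J" using j by blast
    show ?thesis using False emb_on_comp[OF g(1)[OF jJ] E(2) emb_onD(2)[OF g(1)[OF jJ]]] g(2)[OF jJ]
      by simp
  qed
  note step = this
  show ?case
  proof (rule bexI[OF _ E(1)], intro exI conjI)
    show "emb K0 E (b1 \<circ> g0)"
      by (rule emb_on_comp[OF D(2) E(2) emb_onD(2)[OF D(2)]])
    show "\<forall>j\<in>insert i J. emb (K j) E (?g j) \<and>
      (\<forall>x\<in>vertices A. (b1 \<circ> g0) (a j x) = ?g j (f j x))"
      using step by (rule ballI)
  qed
qed

text \<open>Both sets induce members of the class, and so does their intersection; amalgamate over it.\<close>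

lemma completable_two:
  fixes X :: "('v, 'r, 'f) struct"
  assumes X: "is_struct L X" and one: "completable \<K> 1 X"
  shows "completable \<K> 2 X"
  unfolding completable_def
proof (intro allI impI)
  fix \<S> assume S: "finite \<S>" "card \<S> \<le> 2" "\<forall>S\<in>\<S>. irred X S"
  have K: "induced X S \<in> \<K>" if S: "irred X S" for S
  proof -
    obtain K h where "K \<in> \<K>" "emb_on X S K h" by (rule completable_one[OF one S])
    then show ?thesis by (rule K_pullback[OF X irred_closed[OF S]])
  qed
  show "\<exists>K\<in>\<K>. \<exists>h. \<forall>S\<in>\<S>. emb_on X S K h"
  proof (cases "card \<S> = 2")
    case False
    then have "card \<S> \<le> 1" using S(2) by linarith
    then obtain K h where "K \<in> \<K>" "\<And>S. S \<in> \<S> \<Longrightarrow> emb_on X S K h"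
      by (rule completableD[OF one S(1)]) (use S(3) in auto)
    then show ?thesis by (rule completable_witness)
  next
    case True
    then obtain S T where ST: "\<S> = {S, T}" by (auto simp: card_2_iff)
    have i: "irred X S" "irred X T" using S(3) ST by auto
    have c: "closed_in X (S \<inter> T)" by (rule closed_in_Int[OF irred_closed[OF i(1)] irred_closed[OF i(2)]])
    have sub: "emb_on X S (induced X S) id" "emb_on X T (induced X T) id"
      by (rule emb_on_into_induced[OF emb_on_refl[OF closed_in_sub[OF irred_closed]]];
          use i in simp)+
    have A: "induced X (S \<inter> T) \<in> \<K>"
      by (rule K_pullback[OF X c K[OF i(1)] emb_on_subset[OF sub(1) Int_lower1]])
    have "emb (induced X (S \<inter> T)) (induced X S) id"
      "emb (induced X (S \<inter> T)) (induced X T) id"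
      using emb_on_subset[OF sub(1) Int_lower1] emb_on_subset[OF sub(2) Int_lower2] by simp_all
    then obtain D g1 g2 where D: "D \<in> \<K>"
      "emb (induced X S) D g1"
      "emb (induced X T) D g2"
      "\<And>x. x \<in> S \<inter> T \<Longrightarrow> g1 x = g2 x"
      using amalg[OF A K[OF i(1)] K[OF i(2)], of id id] by auto
    let ?h = "\<lambda>x. if x \<in> S then g1 x else g2 x"
    have "emb_on X S D ?h"
      by (rule emb_on_cong[of _ _ _ g1]) (use D(2) irred_closed[OF i(1)] in auto)
    moreover have "emb_on X T D ?h"
      by (rule emb_on_cong[of _ _ _ g2]) (use D(3,4) irred_closed[OF i(2)] in auto)
    ultimately have "emb_on X U D ?h" if "U \<in> \<S>" for U using that ST by auto
    then show ?thesis by (rule completable_witness[OF D(1)])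
  qed
qed

end

locale partite_class_step = partite_step L C P \<pi> A1 N + amalg_class L \<K>
  for L :: "('r, 'f) language" and C :: "('v, 'r, 'f) struct" and P :: "('a, 'r, 'f) struct"
    and \<pi> A1 N and \<K> :: "('v, 'r, 'f) struct set" +
  assumes A1K: "induced C A1 \<in> \<K>"
begin

text \<open>The case \<open>t = 2\<close> is excluded: two sets on two different lines would require completing a set of \<open>C\<close> together with
\<open>A1\<close>, which is a task of the same size \<open>2\<close>. For \<open>t \<le> 1\<close> only one line can be involved, and no constant
line appears.\<close>

lemma step_completable:
  assumes QP: "completable \<K> t P"
    and QC: "t \<le> 1 \<or> t \<ge> 3 \<and> completable \<K> (t - 1) C"
  shows "completable \<K> t extension"
  unfolding completable_def
proof (intro allI impI)
  fix \<S> assume S: "finite \<S>" "card \<S> \<le> t" "\<forall>S\<in>\<S>. irred extension S"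
  define SL where "SL l = {S \<in> \<S>. \<not> S \<subseteq> Inl ` vertices Z \<and> S \<subseteq> place l ` vertices P}" for l
  define J where "J = {l \<in> lines. SL l \<noteq> {}}"
  have finJ: "finite J" unfolding J_def using finite_lines by simp
  have finSL: "finite (SL l)" for l unfolding SL_def using S(1) by simp
  have disj: "SL l \<inter> SL l' = {}" if "l \<in> lines" "l \<noteq> l'" for l l'
    using two_lines_common[OF that(2)] place_fibre_sub[OF that(1)] unfolding SL_def by blast
  have Zform: "\<exists>T. irred Z T \<and> S = Inl ` T" if "irred extension S" "S \<subseteq> Inl ` vertices Z" for S
    using irred_pullback[OF extension_Z closed_in_vertices[OF Z_struct] that] by metis
  have Lform: "\<exists>T. irred P T \<and> S = place l ` T" if "l \<in> lines" "S \<in> SL l" for l S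
  proof -
    have "irred extension S" "S \<subseteq> place l ` vertices P" using S(3) that(2) unfolding SL_def by auto
    then show ?thesis
      using irred_pullback[OF extension_line[OF that(1)] closed_in_vertices[OF P]] by metis
  qed
  have cover: "S \<subseteq> Inl ` vertices Z \<or> (\<exists>l\<in>J. S \<in> SL l)" if "S \<in> \<S>" for S
  proof -
    have "irred extension S" using S(3) that by blast
    then show ?thesis
    proof (cases rule: irred_extension_cases)
      case (power T)
      then show ?thesis using irred_Z_sub by blast
    next
      case (line l T)
      then have "S \<subseteq> place l ` vertices P" using irred_P_sub by blast
      then show ?thesis using line(1) that unfolding J_def SL_def by blast
    qed
  qed
  have \<pi>S: "emb_on extension S C \<pi>ext" if "S \<in> \<S>" for S
    using extension_hom_emb S(3) that unfolding hom_emb_def by blast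
  show "\<exists>K\<in>\<K>. \<exists>h. \<forall>S\<in>\<S>. emb_on extension S K h"
  proof (cases "J = {}")
    case True
    have "emb_on extension S (induced C A1) \<pi>ext" if s: "S \<in> \<S>" for S
    proof (rule emb_on_into_induced[OF \<pi>S[OF s]])
      have "S \<subseteq> Inl ` vertices Z" using cover[OF s] True by blast
      moreover have "\<pi>ext (Inl w) \<in> A1" if "w \<in> vertices Z" for w
        using Z_nth[OF that N] unfolding \<pi>ext_def fibre_def by simp
      ultimately show "\<pi>ext ` S \<subseteq> A1" by blast
    qed
    then show ?thesis by (rule completable_witness[OF A1K])
  next
    case False
    have finc: "finite ((\<lambda>l. card (SL l)) ` J)" by (rule finite_imageI[OF finJ])
    have "Max ((\<lambda>l. card (SL l)) ` J) \<in> (\<lambda>l. card (SL l)) ` J"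
      by (rule Max_in[OF finc]) (simp add: False)
    then obtain l0 where l0J: "l0 \<in> J" and Max: "Max ((\<lambda>l. card (SL l)) ` J) = card (SL l0)"
      by (rule imageE)
    have l0: "card (SL l) \<le> card (SL l0)" if "l \<in> J" for l
      unfolding Max[symmetric] by (rule Max_ge[OF finc imageI[OF that]])
    \<comment> \<open>A coordinate that moves on the line with the largest number of sets.\<close>
    have "l0 \<in> lines" using l0J unfolding J_def by simp
    then obtain i where i: "i < N" "l0 ! i = None" by (rule line_moving)
    \<comment> \<open>The occupied lines that are constant at \<open>i\<close>, with \<open>cp l\<close> the copy of \<open>A1\<close> that is their letter there.\<close>
    define Jc where "Jc = {l \<in> J. l ! i \<noteq> None}"
    have finJc: "finite Jc" unfolding Jc_def using finJ by simp
    have JcL: "l \<in> lines" "l \<in> J" if "l \<in> Jc" for l using that unfolding Jc_def J_def by auto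
    define cp where "cp l = the (l ! i)" for l :: "'a set option list"
    have cp: "l ! i = Some (cp l)" "cp l \<in> letters" if "l \<in> Jc" for l
    proof -
      show s: "l ! i = Some (cp l)" using that unfolding Jc_def cp_def by auto
      show "cp l \<in> letters" using line_valid_entry[OF JcL(1)[OF that] i(1)] s unfolding valid_entry_def by blast
    qed
    define const where "const S \<longleftrightarrow> (\<exists>l\<in>Jc. S \<in> SL l)" for S
    \<comment> \<open>The task for \<open>P\<close>: sets on constant lines are replaced by the letter of the line.\<close>
    define \<psi> where "\<psi> S = (if const S then cp (SOME l. l \<in> Jc \<and> S \<in> SL l) else retr i ` S)" for S
    have \<psi>_const: "\<psi> S = cp l" if l: "l \<in> Jc" and Sl: "S \<in> SL l" for l S
    proof -
      have "(SOME l. l \<in> Jc \<and> S \<in> SL l) = l"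
      proof (rule some_equality)
        show "l \<in> Jc \<and> S \<in> SL l" using l Sl by (rule conjI)
        fix l' assume l': "l' \<in> Jc \<and> S \<in> SL l'"
        show "l' = l"
        proof (rule ccontr)
          assume "l' \<noteq> l"
          then have "SL l \<inter> SL l' = {}" using disj[OF JcL(1)[OF l], of l'] by simp
          then show False using l' Sl by blast
        qed
      qed
      moreover have "const S" unfolding const_def by (rule bexI[of _ l]) fact+
      ultimately show ?thesis unfolding \<psi>_def by simp
    qed
    have moving: "emb_on extension S P (retr i)" if s: "S \<in> \<S>" "\<not> const S" for S
      using cover[OF s(1)]
    proof
      assume "S \<subseteq> Inl ` vertices Z"
      then obtain T where "irred Z T" "S = Inl ` T" using Zform S(3) s(1) by blast
      then show ?thesis using retr_Z[OF _ i(1)] by blast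
    next
      assume "\<exists>l\<in>J. S \<in> SL l"
      then obtain l where l: "l \<in> J" "S \<in> SL l" by blast
      have ll: "l \<in> lines" using l(1) unfolding J_def by simp
      have "l ! i = None" using l s(2) unfolding const_def Jc_def by blast
      moreover obtain T where "irred P T" "S = place l ` T" using Lform[OF ll l(2)] by blast
      ultimately show ?thesis using retr_line[OF ll i(1)] by blast
    qed
    have \<psi>_irred: "irred P T" if T: "T \<in> \<psi> ` \<S>" for T
    proof -
      obtain S where s: "S \<in> \<S>" "T = \<psi> S" using T by blast
      show ?thesis
      proof (cases "const S")
        case True
        then obtain l where l: "l \<in> Jc" "S \<in> SL l" unfolding const_def by blast
        show ?thesis unfolding s(2) \<psi>_const[OF l] by (rule letters_irred[OF cp(2)[OF l(1)]])
      next
        case False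
        have "irred extension S" using S(3) s(1) by blast
        from irred_image[OF this moving[OF s(1) False]] show ?thesis
          unfolding s(2) \<psi>_def using False by simp
      qed
    qed
    have c\<psi>: "card (\<psi> ` \<S>) \<le> t" using card_image_le[OF S(1), of \<psi>] S(2) by linarith
    obtain K0 h0 where K0: "K0 \<in> \<K>" "\<And>T. T \<in> \<psi> ` \<S> \<Longrightarrow> emb_on P T K0 h0"
      by (rule completableD[OF QP finite_imageI[OF S(1)] c\<psi> \<psi>_irred]) (assumption, rule that)
    \<comment> \<open>The task for \<open>C\<close>: the sets on one constant line together with \<open>A1\<close>.\<close>
    have side: "\<exists>K\<in>\<K>. \<exists>h. emb_on C A1 K h \<and> (\<forall>S\<in>SL l. emb_on C (\<pi>ext ` S) K h)"
      if l: "l \<in> Jc" for l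
    proof -
      let ?T = "insert A1 ((`) \<pi>ext ` SL l)"
      have ne: "l \<noteq> l0" using l i(2) unfolding Jc_def by auto
      have "card (SL l) + card (SL l0) = card (SL l \<union> SL l0)"
        by (rule card_Un_disjoint[symmetric, OF finSL finSL disj[OF JcL(1)[OF l] ne]])
      also have "\<dots> \<le> card \<S>" by (rule card_mono[OF S(1)]) (auto simp: SL_def)
      finally have two: "card (SL l) + card (SL l0) \<le> t" using S(2) by linarith
      have pos: "0 < card (SL l)"
        using JcL(2)[OF l] finSL unfolding J_def by (simp add: card_gt_0_iff)
      have le: "card (SL l) \<le> card (SL l0)" by (rule l0[OF JcL(2)[OF l]])
      \<comment> \<open>There is a set on \<open>l\<close> and at least one on \<open>l0\<close>, which rules out \<open>t \<le> 1\<close>.\<close>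
      have t3: "t \<ge> 3" "completable \<K> (t - 1) C" using QC two pos le by linarith+
      have "card ?T \<le> Suc (card (SL l))"
        using card_image_le[OF finSL, of "(`) \<pi>ext" l]
          card_insert_if[OF finite_imageI[OF finSL], of A1 "(`) \<pi>ext" l] by (simp split: if_splits)
      then have c: "card ?T \<le> t - 1" using two pos le t3(1) by linarith
      have ir: "irred C T" if "T \<in> ?T" for T
        using that
      proof
        assume "T = A1" then show ?thesis using A1 by simp
      next
        assume "T \<in> (`) \<pi>ext ` SL l"
        then obtain S' where s: "S' \<in> \<S>" "T = \<pi>ext ` S'" unfolding SL_def by blast
        then show ?thesis using irred_image \<pi>S S(3) by blast
      qed
      have fT: "finite ?T" by (rule finite.insertI[OF finite_imageI[OF finSL]])
      obtain K h where K: "K \<in> \<K>" "\<And>T. T \<in> ?T \<Longrightarrow> emb_on C T K h"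
        by (rule completableD[OF t3(2) fT c ir]) (assumption, rule that)
      show ?thesis
        by (rule bexI[OF _ K(1)], rule exI[of _ h]) (intro conjI ballI K(2) insertI1 insertI2 imageI)
    qed
    have "\<forall>l\<in>Jc. \<exists>K. K \<in> \<K> \<and> (\<exists>h. emb_on C A1 K h \<and> (\<forall>S\<in>SL l. emb_on C (\<pi>ext ` S) K h))"
      by (intro ballI) (rule side[unfolded Bex_def])
    from bchoice[OF this] obtain K where K1: "\<forall>l\<in>Jc. K l \<in> \<K> \<and>
      (\<exists>h. emb_on C A1 (K l) h \<and> (\<forall>S\<in>SL l. emb_on C (\<pi>ext ` S) (K l) h))" by (rule exE)
    then have "\<forall>l\<in>Jc. \<exists>h. emb_on C A1 (K l) h \<and> (\<forall>S\<in>SL l. emb_on C (\<pi>ext ` S) (K l) h)"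
      by simp
    from bchoice[OF this] obtain h where h: "\<forall>l\<in>Jc. emb_on C A1 (K l) (h l) \<and>
      (\<forall>S\<in>SL l. emb_on C (\<pi>ext ` S) (K l) (h l))" by (rule exE)
    have K: "\<And>l. l \<in> Jc \<Longrightarrow> K l \<in> \<K>" "\<And>l. l \<in> Jc \<Longrightarrow> emb_on C A1 (K l) (h l)"
      "\<And>l S. l \<in> Jc \<Longrightarrow> S \<in> SL l \<Longrightarrow> emb_on C (\<pi>ext ` S) (K l) (h l)"
      using K1 h by simp_all
    \<comment> \<open>Attach the completions of the constant lines to \<open>K0\<close> along their letters.\<close>
    let ?A = "induced C A1"
    have a0: "emb ?A K0 (h0 \<circ> sect (cp l))" if l: "l \<in> Jc" for l
    proof -
      obtain S' where s: "S' \<in> SL l" using JcL(2)[OF l] unfolding J_def by blast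
      then have "S' \<in> \<S>" unfolding SL_def by blast
      then have "emb_on P (\<psi> S') K0 h0" by (intro K0(2) imageI)
      then have "emb_on P (cp l) K0 h0" unfolding \<psi>_const[OF l s] .
      then have "emb_on C A1 K0 (h0 \<circ> sect (cp l))"
        by (rule emb_on_comp[OF sect_emb[OF cp(2)[OF l]]]) (simp add: sect_image[OF cp(2)[OF l]])
      then show ?thesis by simp
    qed
    have f: "emb ?A (K l) (h l)" if "l \<in> Jc" for l using K(2)[OF that] by simp
    have "\<exists>D\<in>\<K>. \<exists>g0 g. emb K0 D g0 \<and>
      (\<forall>l\<in>Jc. emb (K l) D (g l) \<and>
        (\<forall>x\<in>vertices ?A. g0 ((h0 \<circ> sect (cp l)) x) = g l (h l x)))"
      by (rule multi_amalg[OF A1K finJc K0(1)]) (erule K(1) a0 f)+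
    then obtain D g0 g where D': "D \<in> \<K>" "emb K0 D g0"
      "\<forall>l\<in>Jc. emb (K l) D (g l) \<and>
        (\<forall>x\<in>vertices ?A. g0 ((h0 \<circ> sect (cp l)) x) = g l (h l x))"
      by (elim bexE exE conjE)
    have D: "D \<in> \<K>" "emb K0 D g0"
      "\<And>l. l \<in> Jc \<Longrightarrow> emb (K l) D (g l)"
      "\<And>l y. l \<in> Jc \<Longrightarrow> y \<in> A1 \<Longrightarrow> g0 (h0 (sect (cp l) y)) = g l (h l y)"
      using D' by simp_all
    \<comment> \<open>On \<open>Z\<close> and on lines other than the constant ones \<open>H\<close> reads off coordinate \<open>i\<close>; the private
    vertices of a constant line are sent to the completion of that line.\<close>
    define H where "H = case_sum (\<lambda>w. g0 (h0 (w ! i)))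
      (\<lambda>(l, v). if l \<in> Jc then g l (h l (\<pi> v)) else g0 (h0 v))"
    have H_moving: "H x = g0 (h0 (retr i x))" if "\<And>l v. x = Inr (l, v) \<Longrightarrow> l \<notin> Jc" for x
      using that unfolding H_def retr_def by (cases x) auto
    \<comment> \<open>Over \<open>A1\<close> both descriptions agree, because the amalgamation was made over \<open>A1\<close>.\<close>
    have H_const: "H (place l v) = g l (h l (\<pi> v))" if l: "l \<in> Jc" and v: "v \<in> vertices P" for l v
    proof (cases "v \<in> fibre")
      case True
      have "retr i (place l v) = sect (cp l) (\<pi> v)"
        using retr_place_fibre[OF JcL(1)[OF l] i(1) True] cp(1)[OF l] by (simp add: entry_def)
      moreover have "H (place l v) = g0 (h0 (retr i (place l v)))"
        by (rule H_moving) (simp add: place_fibre[OF True])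
      ultimately show ?thesis using D(4)[OF l, of "\<pi> v"] True unfolding fibre_def by simp
    next
      case False
      then show ?thesis using place_outside[OF v False] l unfolding H_def by simp
    qed
    have "emb_on extension S D H" if s: "S \<in> \<S>" for S
    proof (cases "const S")
      case True
      then obtain l where l: "l \<in> Jc" "S \<in> SL l" unfolding const_def by blast
      obtain T where T: "irred P T" "S = place l ` T" using Lform[OF JcL(1)[OF l(1)] l(2)] by blast
      have e1: "emb_on extension S (K l) (h l \<circ> \<pi>ext)"
        by (rule emb_on_comp[OF \<pi>S[OF s] K(3)[OF l] subset_refl])
      have e2: "emb_on extension S D (g l \<circ> (h l \<circ> \<pi>ext))"
        by (rule emb_on_comp[OF e1 D(3)[OF l(1)] emb_onD(2)[OF e1]])
      show ?thesis
      proof (rule emb_on_cong[OF e2])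
        show "closed_in extension S" using irred_closed S(3) s by blast
        fix x assume "x \<in> S"
        then obtain v where v: "v \<in> vertices P" "x = place l v" using T irred_P_sub by blast
        show "H x = (g l \<circ> (h l \<circ> \<pi>ext)) x"
          unfolding v(2) H_const[OF l(1) v(1)] using \<pi>ext_place[OF JcL(1)[OF l(1)] v(1)] by simp
      qed
    next
      case False
      have "emb_on P (\<psi> S) K0 h0" by (rule K0(2)[OF imageI[OF s]])
      then have "emb_on P (retr i ` S) K0 h0" using False unfolding \<psi>_def by simp
      then have e1: "emb_on extension S K0 (h0 \<circ> retr i)"
        by (rule emb_on_comp[OF moving[OF s False] _ subset_refl])
      have e2: "emb_on extension S D (g0 \<circ> (h0 \<circ> retr i))"
        by (rule emb_on_comp[OF e1 D(2) emb_onD(2)[OF e1]])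
      show ?thesis
      proof (rule emb_on_cong[OF e2])
        show "closed_in extension S" using irred_closed S(3) s by blast
        fix x assume x: "x \<in> S"
        have "l \<notin> Jc" if xl: "x = Inr (l, v)" for l v
        proof
          assume lc: "l \<in> Jc"
          have "\<not> S \<subseteq> Inl ` vertices Z" using x xl by blast
          then obtain l' where l': "l' \<in> J" "S \<in> SL l'" using cover[OF s] by blast
          then have "x \<in> place l' ` vertices P" using x unfolding SL_def by blast
          then have "l' = l" using xl unfolding place_def by (auto split: if_splits)
          then show False using False lc l'(2) unfolding const_def by blast
        qed
        then show "H x = (g0 \<circ> (h0 \<circ> retr i)) x" using H_moving by simp
      qed
    qed
    then show ?thesis by (rule completable_witness[OF D(1)])
  qed
qed

end

section \<open>Iterating the step\<close>

text \<open>The numbers \<open>t\<close> for which \<open>step_completable\<close> applies to a construction over \<open>C\<close>.\<close>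

definition step_preserves ::
  "('v, 'r, 'f) struct set \<Rightarrow> nat \<Rightarrow> ('v, 'r, 'f) struct \<Rightarrow> bool" where
  "step_preserves \<K> t C \<longleftrightarrow> t \<le> 1 \<or> t \<ge> 3 \<and> completable \<K> (t - 1) C"

definition copies_over ::
  "('a, 'r, 'f) struct \<Rightarrow> ('a \<Rightarrow> 'c) \<Rightarrow> ('c, 'r, 'f) struct \<Rightarrow> 'c set \<Rightarrow> 'a set set" where
  "copies_over P \<pi> C A1 = {V. closed_in P V \<and> emb_on P V C \<pi> \<and> \<pi> ` V = A1}"

text \<open>What one or several steps achieve: for each colouring there is a copy of \<open>P0\<close> in \<open>P\<close> on which the colour
of the copies over any given member of \<open>\<A>\<close> is constant.\<close>

definition partite_extension where
  "partite_extension L \<K> r C \<A> P0 \<pi>0 P \<pi> \<longleftrightarrow>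
     is_struct L P \<and> finite (vertices P) \<and> hom_emb P C \<pi> \<and>
     (\<forall>t. step_preserves \<K> t C \<longrightarrow> completable \<K> t P0 \<longrightarrow> completable \<K> t P) \<and>
     (\<forall>\<chi>. (\<forall>V. \<chi> V < (r::nat)) \<longrightarrow> (\<exists>e. emb P0 P e \<and> (\<forall>v\<in>vertices P0. \<pi> (e v) = \<pi>0 v) \<and>
       (\<forall>A1\<in>\<A>. \<exists>c. \<forall>V\<in>copies_over P0 \<pi>0 C A1. \<chi> (e ` V) = c)))"

lemma partite_extensionD:
  assumes "partite_extension L \<K> r C \<A> P0 \<pi>0 P \<pi>"
  shows "is_struct L P" "finite (vertices P)" "hom_emb P C \<pi>"
    and "step_preserves \<K> t C \<Longrightarrow> completable \<K> t P0 \<Longrightarrow> completable \<K> t P"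
    and "\<forall>V. \<chi> V < r \<Longrightarrow> \<exists>e. emb P0 P e \<and> (\<forall>v\<in>vertices P0. \<pi> (e v) = \<pi>0 v) \<and>
      (\<forall>A1\<in>\<A>. \<exists>c. \<forall>V\<in>copies_over P0 \<pi>0 C A1. \<chi> (e ` V) = c)"
  using assms unfolding partite_extension_def by simp_all

text \<open>The glued structure lives on words and tagged vertices. Being finite, it can be moved back to the infinite vertex
type, so that steps can be iterated.\<close>

lemma (in amalg_class) partite_step_exists:
  fixes C P :: "('v, 'r, 'f) struct"
  assumes inf: "infinite (UNIV :: 'v set)"
    and C: "is_struct L C" and P: "is_struct L P" "finite (vertices P)"
    and \<pi>: "hom_emb P C \<pi>" and A1: "irred C A1" "induced C A1 \<in> \<K>" and r: "0 < r"
  shows "\<exists>P' :: ('v, 'r, 'f) struct. \<exists>\<pi>'. partite_extension L \<K> r C {A1} P \<pi> P' \<pi>'"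
proof -
  let ?CP = "copies_over P \<pi> C A1"
  have "?CP \<subseteq> Pow (vertices P)" unfolding copies_over_def closed_in_def by blast
  then have "finite ?CP" using P(2) by (meson finite_Pow_iff finite_subset)
  then obtain N where hjN: "hales_jewett_dim ?CP {..<r} N" using hales_jewett[OF _ finite_lessThan] by blast
  have "\<forall>w. length w = N \<longrightarrow> set w \<subseteq> ?CP \<longrightarrow> (\<lambda>_. 0) w \<in> {..<r}" using r by simp
  \<comment> \<open>A line exists and has a moving coordinate, so the dimension is positive.\<close>
  from hj_dimD[OF hjN this] have N0: "0 < N" unfolding line_def by (cases N) auto
  interpret partite_class_step L C P \<pi> A1 N \<K>
    by unfold_locales (use C P \<pi> A1 N0 in auto)
  have letters: "letters = ?CP" unfolding letters_def copies_over_def by (rule refl)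
  obtain P' :: "('v, 'r, 'f) struct" and f g where P': "is_struct L P'" "finite (vertices P')"
    "emb extension P' f" "hom_emb P' extension g"
    "\<forall>u\<in>vertices extension. g (f u) = u"
    by (rule finite_struct_on_type[OF inf extension_struct finite_extension])
  show ?thesis
    unfolding partite_extension_def
  proof (rule exI[of _ P'], rule exI[of _ "\<pi>ext \<circ> g"], intro conjI allI impI)
    show "is_struct L P'" "finite (vertices P')" by fact+
    show "hom_emb P' C (\<pi>ext \<circ> g)" by (rule hom_emb_comp[OF P'(4) extension_hom_emb])
    show "completable \<K> t P'" if "step_preserves \<K> t C" "completable \<K> t P" for t
      by (rule completable_pullback[OF P'(4)
            step_completable[OF that(2) that(1)[unfolded step_preserves_def]]])
    fix \<chi> :: "'v set \<Rightarrow> nat" assume \<chi>: "\<forall>V. \<chi> V < r"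
    have "\<chi> (f ` V) \<in> {..<r}" for V using \<chi> by simp
    from step_arrow[where \<chi> = "\<lambda>V. \<chi> (f ` V)", OF hjN[folded letters] this] obtain e c where
      e: "emb P extension e" "\<forall>v\<in>vertices P. \<pi>ext (e v) = \<pi> v"
        "\<forall>V\<in>letters. \<chi> (f ` e ` V) = c" by (elim exE conjE)
    have "(\<pi>ext \<circ> g) ((f \<circ> e) v) = \<pi> v" if "v \<in> vertices P" for v
      using e(2) emb_onD(2)[OF e(1)] that P'(5) by (simp add: image_subset_iff)
    moreover have "emb P P' (f \<circ> e)"
      by (rule emb_on_comp[OF e(1) P'(3) emb_onD(2)[OF e(1)]])
    moreover have "\<forall>V\<in>?CP. \<chi> ((f \<circ> e) ` V) = c" using e(3) unfolding letters by (simp add: image_comp)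
    ultimately show "\<exists>e. emb P P' e \<and> (\<forall>v\<in>vertices P. (\<pi>ext \<circ> g) (e v) = \<pi> v) \<and>
      (\<forall>A1\<in>{A1}. \<exists>c. \<forall>V\<in>copies_over P \<pi> C A1. \<chi> (e ` V) = c)"
      by (intro exI[of _ "f \<circ> e"] conjI ballI) (auto intro: exI[of _ c])
  qed
qed

lemma copies_over_image:
  assumes V: "V \<in> copies_over P0 \<pi>0 C A1" and e: "emb P0 P e"
    and \<pi>: "\<And>v. v \<in> vertices P0 \<Longrightarrow> \<pi> (e v) = \<pi>0 v"
  shows "e ` V \<in> copies_over P \<pi> C A1"
proof -
  have V': "closed_in P0 V" "emb_on P0 V C \<pi>0" "\<pi>0 ` V = A1"
    using V unfolding copies_over_def by auto
  have sub: "V \<subseteq> vertices P0" by (rule closed_in_sub[OF V'(1)])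
  have eV: "emb_on P0 V P e" by (rule emb_on_subset[OF e sub])
  have "emb_on P (e ` V) C \<pi>"
    by (rule emb_on_transport[OF eV V'(1,2)]) (use \<pi> sub in blast)
  moreover have "\<pi> ` e ` V = A1" unfolding V'(3)[symmetric] image_image
    by (rule image_cong[OF refl]) (use \<pi> sub in blast)
  ultimately show ?thesis unfolding copies_over_def using closed_in_image[OF eV V'(1)] by simp
qed

text \<open>The copies in \<open>\<A>\<close> are treated one by one. A colouring of the final structure is first made constant over
the last treated copy by passing to a copy of the previous structure, and then over the others
by induction.\<close>

lemma (in amalg_class) partite_construction:
  fixes C P0 :: "('v, 'r, 'f) struct"
  assumes inf: "infinite (UNIV :: 'v set)"
    and C: "is_struct L C" and P0: "is_struct L P0" "finite (vertices P0)"
    and \<pi>0: "hom_emb P0 C \<pi>0" and r: "0 < r"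
    and fin: "finite \<A>" and \<A>: "\<forall>A1\<in>\<A>. irred C A1 \<and> induced C A1 \<in> \<K>"
  shows "\<exists>P :: ('v, 'r, 'f) struct. \<exists>\<pi>. partite_extension L \<K> r C \<A> P0 \<pi>0 P \<pi>"
  using fin \<A>
proof (induction \<A>)
  case empty
  have "emb P0 P0 id" by (rule emb_on_refl[OF subset_refl])
  then show ?case using P0 \<pi>0
    by - (rule exI[of _ P0], rule exI[of _ \<pi>0], auto simp: partite_extension_def intro!: exI[of _ id])
next
  case (insert A1 \<A>)
  have "\<exists>P :: ('v, 'r, 'f) struct. \<exists>\<pi>. partite_extension L \<K> r C \<A> P0 \<pi>0 P \<pi>"
    by (rule insert.IH) (use insert.prems in simp)
  then obtain P :: "('v, 'r, 'f) struct" and \<pi> where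
    P: "partite_extension L \<K> r C \<A> P0 \<pi>0 P \<pi>" by (elim exE)
  have A1: "irred C A1" "induced C A1 \<in> \<K>" using insert.prems by simp_all
  from partite_step_exists[OF inf C partite_extensionD(1-3)[OF P] A1 r]
  obtain P' :: "('v, 'r, 'f) struct" and \<pi>' where
    P': "partite_extension L \<K> r C {A1} P \<pi> P' \<pi>'" by (elim exE)
  show ?case
    unfolding partite_extension_def
  proof (rule exI[of _ P'], rule exI[of _ \<pi>'], intro conjI allI impI)
    show "is_struct L P'" "finite (vertices P')" "hom_emb P' C \<pi>'"
      by (rule partite_extensionD[OF P'])+
    show "completable \<K> t P'" if "step_preserves \<K> t C" "completable \<K> t P0" for t
      by (rule partite_extensionD(4)[OF P' that(1) partite_extensionD(4)[OF P that]])
    fix \<chi> :: "'v set \<Rightarrow> nat" assume \<chi>: "\<forall>V. \<chi> V < r"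
    from partite_extensionD(5)[OF P' \<chi>] obtain e1 where
      e1: "emb P P' e1" "\<forall>v\<in>vertices P. \<pi>' (e1 v) = \<pi> v"
        "\<exists>c. \<forall>V\<in>copies_over P \<pi> C A1. \<chi> (e1 ` V) = c" by (elim exE conjE) simp
    then obtain c where c: "\<forall>V\<in>copies_over P \<pi> C A1. \<chi> (e1 ` V) = c" by (elim exE)
    have "\<forall>V. \<chi> (e1 ` V) < r" using \<chi> by simp
    from partite_extensionD(5)[where \<chi> = "\<lambda>V. \<chi> (e1 ` V)", OF P this] obtain e0 where
      e0: "emb P0 P e0" "\<forall>v\<in>vertices P0. \<pi> (e0 v) = \<pi>0 v"
        "\<forall>A1\<in>\<A>. \<exists>c. \<forall>V\<in>copies_over P0 \<pi>0 C A1. \<chi> (e1 ` e0 ` V) = c" by (elim exE conjE)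
    have "emb P0 P' (e1 \<circ> e0)"
      by (rule emb_on_comp[OF e0(1) e1(1) emb_onD(2)[OF e0(1)]])
    moreover have "\<forall>v\<in>vertices P0. \<pi>' ((e1 \<circ> e0) v) = \<pi>0 v"
      using e0(2) e1(2) emb_onD(2)[OF e0(1)] by (simp add: image_subset_iff)
    moreover have "\<exists>c. \<forall>V\<in>copies_over P0 \<pi>0 C A2. \<chi> ((e1 \<circ> e0) ` V) = c" if "A2 \<in> insert A1 \<A>" for A2
      using that
    proof
      assume A2: "A2 = A1"
      have "\<chi> ((e1 \<circ> e0) ` V) = c" if V: "V \<in> copies_over P0 \<pi>0 C A1" for V
        using c[THEN bspec, OF copies_over_image[OF V e0(1)]] e0(2) by (simp add: image_comp)
      then show ?thesis unfolding A2 by blast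
    next
      assume "A2 \<in> \<A>"
      then show ?thesis unfolding image_comp[symmetric] by (rule e0(3)[THEN bspec])
    qed
    ultimately show "\<exists>e. emb P0 P' e \<and> (\<forall>v\<in>vertices P0. \<pi>' (e v) = \<pi>0 v) \<and>
      (\<forall>A1\<in>insert A1 \<A>. \<exists>c. \<forall>V\<in>copies_over P0 \<pi>0 C A1. \<chi> (e ` V) = c)"
      by (intro exI[of _ "e1 \<circ> e0"] conjI ballI) simp_all
  qed
qed

section \<open>The arrow in terms of embeddings\<close>

definition copies_of :: "('a, 'r, 'f) struct \<Rightarrow> ('b, 'r, 'f) struct \<Rightarrow> 'b set set" where
  "copies_of A X = {a ` vertices A |a. emb A X a}"

lemma finite_copies_of: "finite (vertices X) \<Longrightarrow> finite (copies_of A X)"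
  by (rule finite_subset[of _ "Pow (vertices X)"]) (auto simp: copies_of_def dest: emb_onD(2))

text \<open>The Ramsey arrow for \<open>r\<close> colours with embeddings of \<open>B\<close> in place of copies of \<open>B\<close>, and with copies of \<open>A\<close> represented by
their vertex sets; colouring all vertex sets instead of only these is harmless.\<close>

definition arrows ::
  "nat \<Rightarrow> ('v, 'r, 'f) struct \<Rightarrow> ('v, 'r, 'f) struct \<Rightarrow> ('v, 'r, 'f) struct \<Rightarrow> bool" where
  "arrows r A B X \<longleftrightarrow> (\<forall>\<chi>. (\<forall>V. \<chi> V < r) \<longrightarrow>
     (\<exists>b c. emb B X b \<and> (\<forall>V\<in>copies_of A B. \<chi> (b ` V) = c)))"

lemma arrowsD:
  assumes "arrows r A B X" "\<forall>V. \<chi> V < r"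
  shows "\<exists>b c. emb B X b \<and> (\<forall>V\<in>copies_of A B. \<chi> (b ` V) = c)"
  by (rule assms(1)[unfolded arrows_def, THEN spec[of _ \<chi>], THEN mp, OF assms(2)])

lemma arrows_image:
  assumes X: "arrows r A B X"
    and f: "\<And>b. emb B X b \<Longrightarrow> emb_on X (b ` vertices B) Y f"
  shows "arrows r A B Y"
  unfolding arrows_def
proof (intro allI impI)
  fix \<chi> :: "'a set \<Rightarrow> nat" assume "\<forall>V. \<chi> V < r"
  then have "\<forall>V. \<chi> (f ` V) < r" by simp
  from arrowsD[where \<chi> = "\<lambda>V. \<chi> (f ` V)", OF X this] obtain b c where
    b: "emb B X b" "\<forall>V\<in>copies_of A B. \<chi> (f ` b ` V) = c"
    by (elim exE conjE)
  have "emb B Y (f \<circ> b)" by (rule emb_on_comp[OF b(1) f[OF b(1)] subset_refl])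
  moreover have "\<forall>V\<in>copies_of A B. \<chi> ((f \<circ> b) ` V) = c" using b(2) by (simp add: image_comp)
  ultimately show "\<exists>b c. emb B Y b \<and> (\<forall>V\<in>copies_of A B. \<chi> (b ` V) = c)"
    by (intro exI conjI)
qed

section \<open>Disjoint copies of a structure\<close>

definition disjoint_copies :: "'i set \<Rightarrow> ('a, 'r, 'f) struct \<Rightarrow> ('i \<times> 'a, 'r, 'f) struct" where
  "disjoint_copies I B = glue I (\<lambda>i. image_struct (Pair i) B)"

context
  fixes L :: "('r, 'f) language" and B :: "('a, 'r, 'f) struct" and I :: "'i set"
  assumes L: "is_language L" and B: "is_struct L B"
begin

lemma copy_struct: "is_struct L (image_struct (Pair i) B)"
  by (rule is_struct_image_struct[OF B]) (simp add: inj_on_def)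

lemma copy_compat:
  "emb_on (image_struct (Pair i) B)
     (vertices (image_struct (Pair i) B) \<inter> vertices (image_struct (Pair j) B))
     (image_struct (Pair j) B) id"
proof (cases "i = j")
  case True
  show ?thesis unfolding True Int_absorb by (rule emb_on_refl[OF subset_refl])
next
  case False
  then have e: "vertices (image_struct (Pair i) B) \<inter> vertices (image_struct (Pair j) B) = {}" by auto
  show ?thesis unfolding e by (rule emb_on_empty[OF L copy_struct copy_struct])
qed

lemma copy_emb: assumes "i \<in> I" shows "emb B (disjoint_copies I B) (Pair i)"
proof -
  have g: "emb (image_struct (Pair i) B)
    (disjoint_copies I B) id"
    unfolding disjoint_copies_def by (rule emb_on_glue[OF copy_struct copy_compat assms])
  have e: "emb B (image_struct (Pair i) B) (Pair i)"
    by (rule emb_on_image_struct[OF B]) (simp add: inj_on_def)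
  from emb_on_comp[OF e g emb_onD(2)[OF e]] show ?thesis by simp
qed

lemma vertices_disjoint_copies: "vertices (disjoint_copies I B) = I \<times> vertices B"
  unfolding disjoint_copies_def by auto

lemma disjoint_copies_hom_on:
  assumes "\<And>i. i \<in> I \<Longrightarrow> hom B Y (\<lambda>x. f (i, x))"
  shows "hom (disjoint_copies I B) Y f"
  unfolding disjoint_copies_def
proof (rule hom_on_glue[OF copy_struct])
  fix i assume i: "i \<in> I"
  show "hom (image_struct (Pair i) B) Y f"
    by (rule hom_on_image_struct[OF B _ assms[OF i]]) (simp_all add: inj_on_def)
qed

lemma disjoint_copies_struct: "countable I \<Longrightarrow> is_struct L (disjoint_copies I B)"
  unfolding disjoint_copies_def by (rule is_struct_glue[OF _ copy_struct])

lemma disjoint_copies_irred: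
  assumes I: "countable I" and S: "irred (disjoint_copies I B) S"
  obtains "S = {}" | i T where "i \<in> I" "irred B T" "S = Pair i ` T"
proof (cases "S = {}")
  case False
  let ?U = "disjoint_copies I B"
  note U = disjoint_copies_struct[OF I]
  have SV: "S \<subseteq> I \<times> vertices B"
    using closed_in_sub[OF irred_closed[OF S]] unfolding vertices_disjoint_copies .
  obtain i b where ib: "(i, b) \<in> S" using False by auto
  then have i: "i \<in> I" using SV by blast
  let ?V = "Pair i ` vertices B"
  have cV: "closed_in ?U ?V" by (rule closed_in_image[OF copy_emb[OF i] closed_in_vertices[OF B]])
  have piece: "\<exists>k\<in>I. set x \<subseteq> Pair k ` vertices B" if x: "x \<in> tups ?U" for x
  proof -
    obtain k where k: "k \<in> I" "x \<in> tups (image_struct (Pair k) B)"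
      using glue_tups[OF x[unfolded disjoint_copies_def]] by blast
    have "set x \<subseteq> vertices (image_struct (Pair k) B)" by (rule tups_vertices[OF copy_struct k(2)])
    then show ?thesis using k(1) by auto
  qed
  have cR: "closed_in ?U ((I - {i}) \<times> vertices B)"
    unfolding closed_in_def
  proof (intro conjI allI impI)
    show "(I - {i}) \<times> vertices B \<subseteq> vertices ?U" unfolding vertices_disjoint_copies by blast
    fix F x y assume f: "fun_interp ?U F x = Some y" and x: "set x \<subseteq> (I - {i}) \<times> vertices B"
    have t: "x \<in> tups ?U" unfolding tups_def using f by blast
    have ne: "x \<noteq> []" by (rule tups_nonempty[OF L U t])
    obtain k where k: "k \<in> I" "set x \<subseteq> Pair k ` vertices B" using piece[OF t] by blast
    have "y \<in> Pair k ` vertices B"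
      using closed_in_image[OF copy_emb[OF k(1)] closed_in_vertices[OF B]] f k(2)
      unfolding closed_in_def by blast
    moreover have "k \<noteq> i" using ne x k(2) by (cases x) auto
    ultimately show "y \<in> (I - {i}) \<times> vertices B" using k(1) by blast
  qed
  have "S \<subseteq> ?V \<or> S \<subseteq> (I - {i}) \<times> vertices B"
  proof (rule irredD[OF S cV cR])
    show "S \<subseteq> ?V \<union> (I - {i}) \<times> vertices B" using SV by blast
    fix x assume "x \<in> tups ?U"
    then obtain k where "k \<in> I" "set x \<subseteq> Pair k ` vertices B" using piece by blast
    then show "set x \<subseteq> ?V \<or> set x \<subseteq> (I - {i}) \<times> vertices B" by (cases "k = i") auto
  qed
  then have "S \<subseteq> ?V" using ib by blast
  from irred_pullback[OF copy_emb[OF i] closed_in_vertices[OF B] S this]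
  obtain T where "irred B T" "S = Pair i ` T" .
  then show ?thesis by (rule that(2)[OF i])
qed (rule that(1))

lemma disjoint_copies_hom_emb:
  assumes I: "countable I" and Y: "is_struct L Y"
    and f: "\<And>i. i \<in> I \<Longrightarrow> emb B Y (\<lambda>x. f (i, x))"
  shows "hom_emb (disjoint_copies I B) Y f"
  unfolding hom_emb_def
proof (intro conjI allI impI)
  show "hom (disjoint_copies I B) Y f"
    by (rule disjoint_copies_hom_on[OF emb_on_hom_on[OF f]])
  fix S assume "irred (disjoint_copies I B) S"
  then show "emb_on (disjoint_copies I B) S Y f"
  proof (cases rule: disjoint_copies_irred[OF I, consumes 1, case_names empty copy])
    case empty
    show ?thesis unfolding empty by (rule emb_on_empty[OF L disjoint_copies_struct[OF I] Y])
  next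
    case (copy i T)
    have T: "T \<subseteq> vertices B" by (rule closed_in_sub[OF irred_closed[OF copy(2)]])
    show ?thesis unfolding copy(3)
      by (rule emb_on_transport[OF emb_on_subset[OF copy_emb[OF copy(1)] T] irred_closed[OF copy(2)]
            emb_on_subset[OF f[OF copy(1)] T] refl])
  qed
qed

end

section \<open>Rounds of the partite construction\<close>

text \<open>One copy of \<open>B\<close> for each copy of \<open>B\<close> in \<open>C\<close>. Folding all copies onto \<open>B\<close> is a homomorphism-embedding, so
any number of irreducible sets can be completed at once, in \<open>B\<close> itself.\<close>

lemma (in amalg_class) initial_system:
  fixes C :: "('v, 'r, 'f) struct"
  assumes inf: "infinite (UNIV :: 'v set)" and L: "is_language L"
    and C: "is_struct L C" "finite (vertices C)" and B: "B \<in> \<K>" "finite (vertices B)"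
  shows "\<exists>P :: ('v, 'r, 'f) struct. \<exists>\<pi>. is_struct L P \<and> finite (vertices P) \<and> hom_emb P C \<pi> \<and>
    (\<forall>t. completable \<K> t P) \<and>
    (\<forall>b. emb B C b \<longrightarrow>
      (\<exists>j. emb B P j \<and> (\<forall>x\<in>vertices B. \<pi> (j x) = b x)))"
proof -
  let ?I = "copies_of B C"
  note Bs = K_struct[OF B(1)]
  have fI: "finite ?I" by (rule finite_copies_of[OF C(2)])
  have "\<forall>V\<in>?I. \<exists>b. emb B C b \<and> b ` vertices B = V"
    unfolding copies_of_def by blast
  from bchoice[OF this] obtain s where
    s: "\<forall>V\<in>?I. emb B C (s V) \<and> s V ` vertices B = V" by (rule exE)
  let ?U = "disjoint_copies ?I B"
  have U: "is_struct L ?U" by (rule disjoint_copies_struct[OF L Bs countable_finite[OF fI]])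
  have finU: "finite (vertices ?U)" unfolding vertices_disjoint_copies[OF L Bs] using fI B(2) by simp
  let ?\<pi> = "\<lambda>(V, x). s V x"
  have hC: "hom_emb ?U C ?\<pi>"
    by (rule disjoint_copies_hom_emb[OF L Bs countable_finite[OF fI] C(1)]) (use s in simp)
  have hB: "hom_emb ?U B snd"
    by (rule disjoint_copies_hom_emb[OF L Bs countable_finite[OF fI] Bs])
      (simp add: emb_on_refl[OF subset_refl, unfolded id_def])
  have "completable \<K> t B" for t
    unfolding completable_def
  proof (intro allI impI)
    fix \<S> assume "\<forall>S\<in>\<S>. irred B S"
    then have "emb_on B S B id" if "S \<in> \<S>" for S
      using that by (intro emb_on_refl closed_in_sub[OF irred_closed]) simp
    then show "\<exists>K\<in>\<K>. \<exists>h. \<forall>S\<in>\<S>. emb_on B S K h" by (rule completable_witness[OF B(1)])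
  qed
  then have cU: "completable \<K> t ?U" for t by (rule completable_pullback[OF hB])
  obtain P :: "('v, 'r, 'f) struct" and f g where P: "is_struct L P" "finite (vertices P)"
    "emb ?U P f" "hom_emb P ?U g" "\<forall>u\<in>vertices ?U. g (f u) = u"
    by (rule finite_struct_on_type[OF inf U finU])
  show ?thesis
  proof (rule exI[of _ P], rule exI[of _ "?\<pi> \<circ> g"], intro conjI allI impI)
    show "is_struct L P" "finite (vertices P)" by fact+
    show "hom_emb P C (?\<pi> \<circ> g)" by (rule hom_emb_comp[OF P(4) hC])
    show "completable \<K> t P" for t by (rule completable_pullback[OF P(4) cU])
    fix b assume b: "emb B C b"
    let ?V = "b ` vertices B"
    have V: "?V \<in> ?I" unfolding copies_of_def using b by blast
    have sV: "emb B C (s ?V)" "s ?V ` vertices B = ?V" using s V by blast+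
    \<comment> \<open>The embedding \<open>b\<close> may differ from the chosen embedding \<open>s ?V\<close> with the same image by an automorphism of \<open>B\<close>.\<close>
    have "emb_on C ?V B (inv_into (vertices B) (s ?V))"
      using emb_on_inv[OF sV(1) closed_in_vertices[OF Bs]] unfolding sV(2) .
    from emb_on_comp[OF b this subset_refl]
    have e1: "emb B B (inv_into (vertices B) (s ?V) \<circ> b)" .
    let ?j = "Pair ?V \<circ> (inv_into (vertices B) (s ?V) \<circ> b)"
    have e2: "emb B ?U ?j"
      by (rule emb_on_comp[OF e1 copy_emb[OF L Bs V] emb_onD(2)[OF e1]])
    have "emb B P (f \<circ> ?j)" by (rule emb_on_comp[OF e2 P(3) emb_onD(2)[OF e2]])
    moreover have "(?\<pi> \<circ> g) ((f \<circ> ?j) x) = b x" if x: "x \<in> vertices B" for x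
    proof -
      have "?j x \<in> vertices ?U" using emb_onD(2)[OF e2] x by blast
      with P(5) have "g (f (?j x)) = ?j x" by (rule bspec)
      moreover have "s ?V (inv_into (vertices B) (s ?V) (b x)) = b x"
        by (rule f_inv_into_f) (simp add: sV(2) x)
      ultimately show ?thesis by simp
    qed
    ultimately show "\<exists>j. emb B P j \<and> (\<forall>x\<in>vertices B. (?\<pi> \<circ> g) (j x) = b x)"
      by (intro exI[of _ "f \<circ> ?j"] conjI ballI)
  qed
qed

text \<open>Colour a copy \<open>A1\<close> of \<open>A\<close> in \<open>C\<close> by the common colour of the copies of \<open>A\<close> over it. A copy of \<open>B\<close> in \<open>C\<close> that is
monochromatic for this colouring lifts to a monochromatic copy in the new structure.\<close>

lemma (in amalg_class) one_round:
  fixes C :: "('v, 'r, 'f) struct"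
  assumes inf: "infinite (UNIV :: 'v set)" and L: "is_language L" and r: "0 < r"
    and C: "is_struct L C" "finite (vertices C)"
    and A: "A \<in> \<K>" "irred A (vertices A)" and B: "B \<in> \<K>" "finite (vertices B)"
    and arr: "arrows r A B C"
  shows "\<exists>D :: ('v, 'r, 'f) struct. \<exists>f. is_struct L D \<and> finite (vertices D) \<and> hom_emb D C f \<and>
    arrows r A B D \<and> (\<forall>t. step_preserves \<K> t C \<longrightarrow> completable \<K> t D)"
proof -
  let ?\<A> = "copies_of A C"
  note As = K_struct[OF A(1)]
  from initial_system[OF inf L C B] obtain P0 :: "('v, 'r, 'f) struct" and \<pi>0 where
    P0: "is_struct L P0" "finite (vertices P0)" "hom_emb P0 C \<pi>0" "\<forall>t. completable \<K> t P0"
    and lift: "\<forall>b. emb B C b \<longrightarrow>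
      (\<exists>j. emb B P0 j \<and> (\<forall>x\<in>vertices B. \<pi>0 (j x) = b x))" by (elim exE conjE)
  have \<A>: "irred C A1 \<and> induced C A1 \<in> \<K>" if A1: "A1 \<in> ?\<A>" for A1
  proof -
    obtain a where a: "A1 = a ` vertices A" "emb A C a"
      using A1 unfolding copies_of_def by blast
    have i: "irred C A1" unfolding a(1) by (rule irred_image[OF A(2) a(2)])
    have "induced C A1 \<in> \<K>"
    proof (rule K_iso[OF A(1)])
      show "is_struct L (induced C A1)" by (rule is_struct_induced[OF C(1) irred_closed[OF i]])
      show "emb A (induced C A1) a"
        unfolding a(1) by (rule emb_on_into_induced[OF a(2) subset_refl])
    qed (simp add: a(1))
    then show ?thesis using i by blast
  qed
  then have \<A>: "\<forall>A1\<in>?\<A>. irred C A1 \<and> induced C A1 \<in> \<K>" by (rule ballI)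
  from partite_construction[OF inf C(1) P0(1-3) r finite_copies_of[OF C(2)] \<A>]
  obtain P :: "('v, 'r, 'f) struct" and \<pi> where
    P: "partite_extension L \<K> r C ?\<A> P0 \<pi>0 P \<pi>" by (elim exE)
  have "arrows r A B P"
    unfolding arrows_def
  proof (intro allI impI)
    fix \<chi> :: "'v set \<Rightarrow> nat" assume \<chi>: "\<forall>V. \<chi> V < r"
    from partite_extensionD(5)[OF P \<chi>] obtain e where
      e: "emb P0 P e" "\<forall>v\<in>vertices P0. \<pi> (e v) = \<pi>0 v"
        "\<forall>A1\<in>?\<A>. \<exists>c. \<forall>V\<in>copies_over P0 \<pi>0 C A1. \<chi> (e ` V) = c" by (elim exE conjE)
    \<comment> \<open>If no copy of \<open>A\<close> lies over \<open>A1\<close>, this is the colour of some irrelevant set.\<close>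
    define \<chi>0 where "\<chi>0 A1 = \<chi> (e ` (SOME V. V \<in> copies_over P0 \<pi>0 C A1))" for A1
    have \<chi>0: "\<chi> (e ` V) = \<chi>0 A1" if A1: "A1 \<in> ?\<A>" and V: "V \<in> copies_over P0 \<pi>0 C A1" for A1 V
    proof -
      obtain c where "\<forall>V\<in>copies_over P0 \<pi>0 C A1. \<chi> (e ` V) = c" using e(3) A1 by blast
      moreover have "(SOME V. V \<in> copies_over P0 \<pi>0 C A1) \<in> copies_over P0 \<pi>0 C A1"
        by (rule someI[of "\<lambda>V. V \<in> copies_over P0 \<pi>0 C A1", OF V])
      ultimately show ?thesis using V unfolding \<chi>0_def by simp
    qed
    have "\<forall>A1. \<chi>0 A1 < r" unfolding \<chi>0_def using \<chi> by simp
    from arrowsD[OF arr this] obtain b c where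
      b: "emb B C b" "\<forall>V\<in>copies_of A B. \<chi>0 (b ` V) = c" by (elim exE conjE)
    from lift[THEN spec[of _ b], THEN mp, OF b(1)] obtain j where
      j: "emb B P0 j" "\<forall>x\<in>vertices B. \<pi>0 (j x) = b x" by (elim exE conjE)
    have "\<chi> ((e \<circ> j) ` V) = c" if V: "V \<in> copies_of A B" for V
    proof -
      obtain a where a: "V = a ` vertices A" "emb A B a"
        using V unfolding copies_of_def by blast
      have cV: "closed_in B V" unfolding a(1) by (rule closed_in_image[OF a(2) closed_in_vertices[OF As]])
      have sV: "V \<subseteq> vertices B" by (rule closed_in_sub[OF cV])
      have jV: "emb_on B V P0 j" by (rule emb_on_subset[OF j(1) sV])
      have ba: "emb A C (b \<circ> a)"
        by (rule emb_on_comp[OF a(2) b(1) emb_onD(2)[OF a(2)]])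
      have bV: "b ` V \<in> ?\<A>" unfolding copies_of_def a(1) image_comp using ba by blast
      have "emb_on P0 (j ` V) C \<pi>0"
        by (rule emb_on_transport[OF jV cV emb_on_subset[OF b(1) sV]]) (use j(2) sV in blast)
      moreover have "\<pi>0 ` j ` V = b ` V"
        unfolding image_image by (rule image_cong[OF refl]) (use j(2) sV in blast)
      ultimately have "j ` V \<in> copies_over P0 \<pi>0 C (b ` V)"
        unfolding copies_over_def using closed_in_image[OF jV cV] by simp
      from \<chi>0[OF bV this] have "\<chi> (e ` j ` V) = \<chi>0 (b ` V)" .
      then show ?thesis using b(2) V by (simp add: image_comp)
    qed
    moreover have "emb B P (e \<circ> j)"
      by (rule emb_on_comp[OF j(1) e(1) emb_onD(2)[OF j(1)]])
    ultimately show "\<exists>b c. emb B P b \<and> (\<forall>V\<in>copies_of A B. \<chi> (b ` V) = c)"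
      by (intro exI[of _ "e \<circ> j"] exI[of _ c] conjI ballI)
  qed
  then show ?thesis using partite_extensionD(1-4)[OF P] P0(4)
    by (intro exI[of _ P] exI[of _ \<pi>] conjI allI impI) simp_all
qed

text \<open>The first round already yields \<open>t = 1\<close>, since irreducible sets of the new structure come from \<open>B\<close> or
from \<open>A\<close>, and amalgamation yields \<open>t = 2\<close>. Each further round adds one.\<close>

lemma (in amalg_class) iterated_rounds:
  fixes C0 :: "('v, 'r, 'f) struct"
  assumes inf: "infinite (UNIV :: 'v set)" and L: "is_language L" and r: "0 < r"
    and C0: "is_struct L C0" "finite (vertices C0)"
    and A: "A \<in> \<K>" "irred A (vertices A)" and B: "B \<in> \<K>" "finite (vertices B)"
    and arr: "arrows r A B C0"
  shows "\<exists>C :: ('v, 'r, 'f) struct. \<exists>f. is_struct L C \<and> finite (vertices C) \<and> hom_emb C C0 f \<and>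
    arrows r A B C \<and> completable \<K> (m + 2) C"
proof (induction m)
  case 0
  from one_round[OF inf L r C0 A B arr] obtain D :: "('v, 'r, 'f) struct" and f where
    D: "is_struct L D" "finite (vertices D)" "hom_emb D C0 f" "arrows r A B D"
      "\<forall>t. step_preserves \<K> t C0 \<longrightarrow> completable \<K> t D" by (elim exE conjE)
  have "completable \<K> 1 D" using D(5) unfolding step_preserves_def by simp
  then have "completable \<K> (0 + 2) D" unfolding add_0 by (rule completable_two[OF D(1)])
  then show ?case using D(1-4) by (intro exI[of _ D] exI[of _ f] conjI)
next
  case (Suc m)
  then obtain C :: "('v, 'r, 'f) struct" and g where
    C: "is_struct L C" "finite (vertices C)" "hom_emb C C0 g" "arrows r A B C"
      "completable \<K> (m + 2) C" by (elim exE conjE)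
  from one_round[OF inf L r C(1,2) A B C(4)] obtain D :: "('v, 'r, 'f) struct" and f where
    D: "is_struct L D" "finite (vertices D)" "hom_emb D C f" "arrows r A B D"
      "\<forall>t. step_preserves \<K> t C \<longrightarrow> completable \<K> t D" by (elim exE conjE)
  have "completable \<K> (Suc m + 2) D" using D(5) C(5) unfolding step_preserves_def by simp
  moreover have "hom_emb D C0 (g \<circ> f)" by (rule hom_emb_comp[OF D(3) C(3)])
  ultimately show ?case using D(1,2,4) by (intro exI[of _ D] exI[of _ "g \<circ> f"] conjI)
qed

section \<open>Passing between structures and vertex sets\<close>

text \<open>A decomposition of the vertex set into two closed parts that splits no tuple is a free amalgamation over
the intersection of the parts.\<close>

lemma irreducible_struct_irred:
  assumes X: "irreducible_struct L X"
  shows "irred X (vertices X)"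
  unfolding irred_def
proof (intro conjI allI impI)
  have s: "is_struct L X" using X unfolding irreducible_struct_def by (rule conjunct1)
  show "closed_in X (vertices X)" by (rule closed_in_vertices[OF s])
  fix V1 V2
  assume c: "closed_in X V1" "closed_in X V2" "vertices X \<subseteq> V1 \<union> V2"
    and t: "\<forall>x\<in>tups X. set x \<subseteq> vertices X \<longrightarrow> set x \<subseteq> V1 \<or> set x \<subseteq> V2"
  show "vertices X \<subseteq> V1 \<or> vertices X \<subseteq> V2"
  proof (rule ccontr)
    assume n: "\<not> (vertices X \<subseteq> V1 \<or> vertices X \<subseteq> V2)"
    have sub: "V1 \<subseteq> vertices X" "V2 \<subseteq> vertices X" using c(1,2) by (auto dest: closed_in_sub)
    have cI: "closed_in X (V1 \<inter> V2)" by (rule closed_in_Int[OF c(1,2)])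
    have proper: "proper_substructure L (induced X V) X"
      if V: "closed_in X V" "\<not> vertices X \<subseteq> V" for V
    proof -
      have "substructure L (induced X V) X" using substructure_iff[OF s] V(1) by blast
      moreover have "induced X V \<noteq> X"
      proof
        assume "induced X V = X"
        then have "vertices (induced X V) = vertices X" by simp
        then show False using V(2) by simp
      qed
      ultimately show ?thesis unfolding proper_substructure_def by (rule conjI)
    qed
    have emb: "struct_emb L (induced X V) (induced X W) id"
      if "closed_in X V" "closed_in X W" "V \<subseteq> W" for V W
    proof -
      have "emb_on X V (induced X W) id"
        by (rule emb_on_into_induced[OF emb_on_refl[OF closed_in_sub[OF that(1)]]]) (simp add: that(3))
      then show ?thesis
        unfolding struct_emb_iff
        using is_struct_induced[OF s that(1)] is_struct_induced[OF s that(2)] by simp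
    qed
    have embX: "struct_emb L (induced X V) X id" if "closed_in X V" for V
      unfolding struct_emb_iff
      using s is_struct_induced[OF s that] emb_on_refl[OF closed_in_sub[OF that]] by simp
    have "strong_amalgamation L (induced X (V1 \<inter> V2)) (induced X V1) (induced X V2) id id X id id"
      unfolding strong_amalgamation_def
      using emb[OF cI c(1)] emb[OF cI c(2)] embX[OF c(1)] embX[OF c(2)] by simp
    moreover have "\<not> (set x \<inter> (V1 - V1 \<inter> V2) \<noteq> {} \<and> set x \<inter> (V2 - V1 \<inter> V2) \<noteq> {})"
      if x: "(\<exists>R\<in>rel_syms L. x \<in> rel_interp X R) \<or> (\<exists>F\<in>fun_syms L. x \<in> dom (fun_interp X F))" for x
    proof -
      have "x \<in> tups X" using x unfolding tups_def by blast
      then have "set x \<subseteq> V1 \<or> set x \<subseteq> V2" using t tups_vertices[OF s] by blast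
      then show ?thesis by blast
    qed
    moreover have "vertices X = V1 \<union> V2" using c(3) sub by blast
    ultimately have "free_amalgamation L (induced X (V1 \<inter> V2)) (induced X V1) (induced X V2) id id X id id"
      unfolding free_amalgamation_def by simp
    then show False
      using X proper[OF c(1)] proper[OF c(2)] n unfolding irreducible_struct_def by blast
  qed
qed

lemma irreducible_substructure:
  assumes "substructure L S X" "irreducible_struct L S"
  shows "irred X (vertices S)" "emb S X id" "is_struct L S"
proof -
  show e: "emb S X id" "is_struct L S"
    using assms(1) unfolding substructure_def struct_emb_iff by blast+
  show "irred X (vertices S)" using irred_image[OF irreducible_struct_irred[OF assms(2)] e(1)] by simp
qed

lemma hom_emb_hom_embedding:
  assumes "is_struct L X" "is_struct L Y" "hom_emb X Y f"
  shows "hom_embedding L X Y f"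
  unfolding hom_embedding_def struct_hom_iff
proof (intro conjI allI impI)
  show "is_struct L X" "is_struct L Y" by fact+
  show "hom X Y f" using assms(3) unfolding hom_emb_def by (rule conjunct1)
  fix S assume S: "substructure L S X \<and> irreducible_struct L S"
  note i = irreducible_substructure[OF conjunct1[OF S] conjunct2[OF S]]
  have "emb_on X (vertices S) Y f" using assms(3) i(1) unfolding hom_emb_def by blast
  from emb_on_comp[OF i(2) this] have "emb S Y f" by simp
  then show "struct_emb L S Y f" unfolding struct_emb_iff using i(3) assms(2) by simp
qed

text \<open>Complete all irreducible sets inside \<open>S\<close> at once; there are at most \<open>2 ^ n\<close> of them.\<close>

lemma small_substructure_completion:
  assumes C: "is_struct L C" and fin: "finite (vertices S)" "card (vertices S) \<le> n"
    and S: "substructure L S C" and comp: "completable \<K> (2 ^ n) C"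
    and \<K>: "\<And>K. K \<in> \<K> \<Longrightarrow> irreducible_struct L K"
  shows "has_completion_in L \<K> S"
proof -
  obtain V where V: "closed_in C V" "S = induced C V" using S substructure_iff[OF C] by blast
  let ?\<S> = "{W. irred C W \<and> W \<subseteq> V}"
  have fV: "finite V" "card V \<le> n" using fin V(2) by simp_all
  have sub: "?\<S> \<subseteq> Pow V" by blast
  have f\<S>: "finite ?\<S>" using sub fV(1) by (simp add: finite_subset)
  have "card ?\<S> \<le> card (Pow V)" by (rule card_mono[OF _ sub]) (simp add: fV(1))
  also have "\<dots> \<le> 2 ^ n" using fV by (simp add: card_Pow)
  finally have c: "card ?\<S> \<le> 2 ^ n" .
  have "\<exists>K\<in>\<K>. \<exists>h. \<forall>W\<in>?\<S>. emb_on C W K h"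
    using comp[unfolded completable_def, THEN spec[of _ ?\<S>]] f\<S> c by simp
  then obtain K h where K: "K \<in> \<K>" and h: "\<forall>W\<in>?\<S>. emb_on C W K h" by blast
  have h': "emb_on C W K h" if "irred C W" "W \<subseteq> V" for W using h that by blast
  have sS: "is_struct L S" unfolding V(2) by (rule is_struct_induced[OF C V(1)])
  have iK: "irreducible_struct L K" by (rule \<K>[OF K])
  have sK: "is_struct L K" using iK unfolding irreducible_struct_def by (rule conjunct1)
  have SC: "emb S C id" unfolding V(2) by (simp add: emb_on_refl[OF closed_in_sub[OF V(1)]])
  have "hom_emb S K h"
    unfolding hom_emb_def
  proof (intro conjI allI impI)
    show "hom S K h"
    proof -
      have g: "hom_on C V K h" by (rule hom_on_from_irred[OF C V(1) h'])
      show ?thesis unfolding V(2) induced_simps(1)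
      proof (rule hom_onI)
        show "h ` V \<subseteq> vertices K" by (rule hom_onD(1)[OF g])
        show "map h x \<in> rel_interp K R" if "x \<in> rel_interp (induced C V) R" "set x \<subseteq> V" for R x
          using hom_onD(2)[OF g _ that(2)] that(1) by simp
        show "fun_interp K F (map h x) = Some (h y)"
          if "fun_interp (induced C V) F x = Some y" "set x \<subseteq> V" for F x y
          using hom_onD(3)[OF g _ that(2)] that(1) unfolding induced_fun_Some by blast
      qed
    qed
    fix W assume W: "irred S W"
    have WV: "W \<subseteq> V" using closed_in_sub[OF irred_closed[OF W]] unfolding V(2) by simp
    have "emb_on S W C id" by (rule emb_on_subset[OF SC]) (simp add: V(2) WV)
    from irred_image[OF W this] have "irred C W" by simp
    then have "emb_on C W K h" using WV by (rule h')
    then show "emb_on S W K h" unfolding V(2) using WV by simp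
  qed
  then have "hom_embedding L S K h" by (rule hom_emb_hom_embedding[OF sS sK])
  then show ?thesis unfolding has_completion_in_def is_completion_def using K iK by blast
qed

lemma isomorphicE:
  assumes "struct_isomorphic L X Y"
  obtains g where "emb Y X g" "g ` vertices Y = vertices X"
proof -
  obtain f where f: "emb X Y f" "f ` vertices X = vertices Y" "is_struct L X"
    using assms unfolding struct_isomorphic_def struct_emb_iff by blast
  have "emb Y X (inv_into (vertices X) f)"
    using emb_on_inv[OF f(1) closed_in_vertices[OF f(3)]] unfolding f(2) .
  moreover have "inv_into (vertices X) f ` vertices Y = vertices X"
    unfolding f(2)[symmetric] by (rule inv_into_image_cancel[OF emb_onD(1)[OF f(1)] subset_refl])
  ultimately show ?thesis by (rule that)
qed

lemma induced_copy:
  assumes A: "is_struct L A" and X: "is_struct L X" and a: "emb A X a"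
  shows "induced X (a ` vertices A) \<in> copies L X A"
proof -
  let ?V = "a ` vertices A"
  have c: "closed_in X ?V" by (rule closed_in_image[OF a closed_in_vertices[OF A]])
  have i: "inv_into (vertices A) a ` ?V = vertices A"
    by (rule inv_into_image_cancel[OF emb_onD(1)[OF a] subset_refl])
  have "emb_on X ?V A (inv_into (vertices A) a)" by (rule emb_on_inv[OF a closed_in_vertices[OF A]])
  then have "struct_isomorphic L (induced X ?V) A"
    unfolding struct_isomorphic_def struct_emb_iff
    using is_struct_induced[OF X c] A i by (intro exI[of _ "inv_into (vertices A) a"]) simp
  moreover have "substructure L (induced X ?V) X" using substructure_iff[OF X] c by blast
  ultimately show ?thesis unfolding copies_def by simp
qed

lemma ramsey_arrow_arrows:
  fixes A B C :: "('v, 'r, 'f) struct"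
  assumes C: "is_struct L C" and A: "is_struct L A" and B: "is_struct L B"
    and r: "ramsey_arrow L C B A k"
  shows "arrows k A B C"
  unfolding arrows_def
proof (intro allI impI)
  fix \<chi> :: "'v set \<Rightarrow> nat" assume \<chi>: "\<forall>V. \<chi> V < k"
  let ?P = "\<lambda>i. {S \<in> copies L C A. \<chi> (vertices S) = i}"
  have "(\<Union>i<k. ?P i) = copies L C A" using \<chi> by auto
  moreover have "\<forall>i<k. \<forall>j<k. i \<noteq> j \<longrightarrow> ?P i \<inter> ?P j = {}" by auto
  ultimately have "\<exists>B'\<in>copies L C B. \<exists>i<k. copies L B' A \<subseteq> ?P i"
    using r[unfolded ramsey_arrow_def, THEN spec[of _ ?P]] by simp
  then obtain B' i where B': "B' \<in> copies L C B" "copies L B' A \<subseteq> ?P i" by blast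
  have sub: "emb B' C id" "is_struct L B'"
    using B'(1) unfolding copies_def substructure_def struct_emb_iff by simp_all
  have "struct_isomorphic L B' B" using B'(1) unfolding copies_def by simp
  then obtain b where b: "emb B B' b" "b ` vertices B = vertices B'"
    by (rule isomorphicE)
  have "\<chi> (b ` V) = i" if V: "V \<in> copies_of A B" for V
  proof -
    obtain a where a: "V = a ` vertices A" "emb A B a"
      using V unfolding copies_of_def by blast
    have ba: "emb A B' (b \<circ> a)" by (rule emb_on_comp[OF a(2) b(1) emb_onD(2)[OF a(2)]])
    have "induced B' ((b \<circ> a) ` vertices A) \<in> ?P i"
      using induced_copy[OF A sub(2) ba] B'(2) by blast
    then show ?thesis by (simp add: a(1) image_comp)
  qed
  moreover have "emb B C b"
    using emb_on_comp[OF b(1) sub(1) emb_onD(2)[OF b(1)]] by simp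
  ultimately show "\<exists>b c. emb B C b \<and> (\<forall>V\<in>copies_of A B. \<chi> (b ` V) = c)"
    by (intro exI[of _ b] exI[of _ i] conjI ballI)
qed

lemma arrows_ramsey_arrow:
  fixes A B C :: "('v, 'r, 'f) struct"
  assumes C: "is_struct L C" and A: "is_struct L A" and B: "is_struct L B"
    and k: "1 \<le> k" and r: "arrows k A B C"
  shows "ramsey_arrow L C B A k"
  unfolding ramsey_arrow_def
proof (intro allI impI)
  fix P :: "nat \<Rightarrow> ('v, 'r, 'f) struct set"
  assume P: "(\<Union>i<k. P i) = copies L C A \<and> (\<forall>i<k. \<forall>j<k. i \<noteq> j \<longrightarrow> P i \<inter> P j = {})"
  \<comment> \<open>Sets that are not copies receive the colour \<open>0\<close>, which exists because \<open>k \<ge> 1\<close>.\<close>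
  define \<chi> where "\<chi> V = (if induced C V \<in> copies L C A then SOME i. i < k \<and> induced C V \<in> P i else 0)" for V
  have \<chi>P: "\<chi> V < k \<and> induced C V \<in> P (\<chi> V)" if "induced C V \<in> copies L C A" for V
  proof -
    have "\<exists>i. i < k \<and> induced C V \<in> P i" using that P by blast
    from someI_ex[OF this] show ?thesis unfolding \<chi>_def using that by simp
  qed
  have "\<chi> V < k" for V
    using \<chi>P[of V] k by (cases "induced C V \<in> copies L C A") (simp_all add: \<chi>_def)
  then have "\<forall>V. \<chi> V < k" by (rule allI)
  from arrowsD[OF r this] obtain b c where
    b: "emb B C b" "\<forall>V\<in>copies_of A B. \<chi> (b ` V) = c" by (elim exE conjE)
  let ?W = "b ` vertices B"
  let ?B = "induced C ?W"
  have cW: "closed_in C ?W" by (rule closed_in_image[OF b(1) closed_in_vertices[OF B]])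
  have sB: "is_struct L ?B" by (rule is_struct_induced[OF C cW])
  have inP: "c < k \<and> S \<in> P c" if S: "S \<in> copies L ?B A" for S
  proof -
    have "substructure L S ?B" using S unfolding copies_def by simp
    then obtain V where V: "closed_in ?B V" "S = induced ?B V" using substructure_iff[OF sB] by blast
    have VW: "V \<subseteq> ?W" using closed_in_sub[OF V(1)] by simp
    have SC: "S = induced C V"
      unfolding V(2) induced_def using VW by (auto simp: fun_eq_iff restrict_map_def)
    have "struct_isomorphic L S A" using S unfolding copies_def by simp
    then obtain a where a: "emb A S a" "a ` vertices A = vertices S"
      by (rule isomorphicE)
    have aV: "a ` vertices A = V" using a(2) unfolding SC by simp
    have "emb S C id" unfolding SC
      using emb_on_refl[of V C] VW closed_in_sub[OF cW] by (simp add: subset_trans)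
    from emb_on_comp[OF a(1) this emb_onD(2)[OF a(1)]]
    have aC: "emb A C a" by simp
    have SCc: "induced C V \<in> copies L C A" using induced_copy[OF A C aC] unfolding aV .
    have "emb_on C V B (inv_into (vertices B) b)"
      by (rule emb_on_subset[OF emb_on_inv[OF b(1) closed_in_vertices[OF B]] VW])
    from emb_on_comp[OF aC this] aV
    have "emb A B (inv_into (vertices B) b \<circ> a)" by simp
    then have "(inv_into (vertices B) b \<circ> a) ` vertices A \<in> copies_of A B"
      unfolding copies_of_def by blast
    then have "\<chi> (b ` inv_into (vertices B) b ` V) = c"
      using b(2) unfolding image_comp[symmetric] aV by blast
    then have "\<chi> V = c" unfolding image_inv_into_cancel[OF refl VW] .
    then show ?thesis using \<chi>P[OF SCc] SC by simp
  qed
  have "?B \<in> copies L C B" by (rule induced_copy[OF B C b(1)])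
  moreover have "\<exists>i<k. copies L ?B A \<subseteq> P i"
  proof (cases "copies L ?B A = {}")
    case True
    then show ?thesis using k by (intro exI[of _ 0]) simp
  next
    case False
    then show ?thesis using inP by (intro exI[of _ c]) blast
  qed
  ultimately show "\<exists>B'\<in>copies L C B. \<exists>i<k. copies L B' A \<subseteq> P i" by (rule bexI[rotated])
qed

section \<open>The Ramsey property\<close>

theorem theorem2p11:
  fixes L :: "('r, 'f) language"
    and \<R> \<K> :: "('v, 'r, 'f) struct set"
  assumes "infinite (UNIV :: 'v set)"
    and "is_language L"
    and "finite_irreducible_class L \<R>"
    and "ramsey_class L \<R>"
    and "struct_class L \<K>"
    and "hereditary L \<K>"
    and "locally_finite_subclass L \<R> \<K>"
    and "strong_amalgamation_property L \<K>"
  shows "ramsey_class L \<K> \<and> (\<forall>A\<in>\<K>. \<forall>B\<in>\<K>. \<exists>C\<in>\<K>. ramsey_arrow L C B A 2)"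
proof -
  interpret amalg_class L \<K> by unfold_locales fact+
  have sub: "\<K> \<subseteq> \<R>" using assms(7) by (simp add: locally_finite_subclass_def)
  have R: "is_struct L X \<and> finite (vertices X) \<and> irreducible_struct L X" if "X \<in> \<R>" for X
    using assms(3) that by (simp add: finite_irreducible_class_def struct_class_def)
  have main: "\<exists>C\<in>\<K>. ramsey_arrow L C B A k" if AB: "A \<in> \<K>" "B \<in> \<K>" and k: "1 \<le> k" for A B k
  proof -
    have AR: "A \<in> \<R>" "B \<in> \<R>" using AB sub by blast+
    have A: "is_struct L A" "irred A (vertices A)" using R[OF AR(1)] irreducible_struct_irred by blast+
    have B: "is_struct L B" "finite (vertices B)" "irred B (vertices B)"
      using R[OF AR(2)] irreducible_struct_irred by blast+
    obtain C0 where C0: "C0 \<in> \<R>" "ramsey_arrow L C0 B A k"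
      using assms(4) AR k unfolding ramsey_class_def by blast
    note C0s = R[OF C0(1)]
    from assms(7)[unfolded locally_finite_subclass_def, THEN conjunct2, THEN conjunct2,
        THEN conjunct2, THEN bspec, OF C0(1)]
    obtain n :: nat where n: "\<forall>C :: ('v, 'r, 'f) struct.
        is_struct L C \<and> is_completion L C C0 \<and>
        (\<forall>S. substructure L S C \<and> irreducible_struct L S \<longrightarrow> S \<in> \<K>) \<and>
        (\<forall>S. substructure L S C \<and> finite (vertices S) \<and> card (vertices S) \<le> n \<longrightarrow>
              has_completion_in L \<K> S)
        \<longrightarrow> has_completion_in L \<K> C" by (rule exE)
    have "arrows k A B C0" by (rule ramsey_arrow_arrows[OF _ A(1) B(1) C0(2)]) (use C0s in blast)
    \<comment> \<open>Enough rounds to reach \<open>t = 2 ^ n\<close>, which takes care of the substructures with \<open>n\<close> vertices.\<close>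
    from iterated_rounds[OF assms(1,2) _ _ _ AB(1) A(2) AB(2) B(2) this, of "2 ^ n"] k C0s
    have "\<exists>C :: ('v, 'r, 'f) struct. \<exists>f. is_struct L C \<and> finite (vertices C) \<and> hom_emb C C0 f \<and>
      arrows k A B C \<and> completable \<K> (2 ^ n + 2) C" by simp
    then obtain C :: "('v, 'r, 'f) struct" and f where
      C: "is_struct L C" "finite (vertices C)" "hom_emb C C0 f" "arrows k A B C"
        "completable \<K> (2 ^ n + 2) C" by (elim exE conjE)
    have "is_completion L C C0"
      unfolding is_completion_def using C0s hom_emb_hom_embedding[OF C(1) _ C(3)] by blast
    moreover have "S \<in> \<K>" if S: "substructure L S C" "irreducible_struct L S" for S
    proof -
      obtain V where V: "closed_in C V" "S = induced C V" using S(1) substructure_iff[OF C(1)] by blast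
      have i: "irred C V" using irreducible_substructure(1)[OF S] unfolding V(2) by simp
      have "completable \<K> 1 C" by (rule completable_mono[OF C(5)]) simp
      then obtain K h where "K \<in> \<K>" "emb_on C V K h" using i by (rule completable_one)
      then show ?thesis unfolding V(2) by (rule K_pullback[OF C(1) V(1)])
    qed
    moreover have "has_completion_in L \<K> S"
      if S: "substructure L S C" "finite (vertices S)" "card (vertices S) \<le> n" for S
    proof (rule small_substructure_completion[OF C(1) S(2,3,1)])
      show "completable \<K> (2 ^ n) C" by (rule completable_mono[OF C(5)]) simp
      show "irreducible_struct L K" if "K \<in> \<K>" for K using R sub that by blast
    qed
    ultimately have "has_completion_in L \<K> C"
      using n[THEN spec[of _ C]] C(1) by simp
    then obtain K g where K: "K \<in> \<K>" and g: "hom_embedding L C K g"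
      unfolding has_completion_in_def is_completion_def by blast
    have "arrows k A B K"
    proof (rule arrows_image[OF C(4)])
      fix b assume b: "emb B C b"
      let ?V = "b ` vertices B"
      have c: "closed_in C ?V" by (rule closed_in_image[OF b closed_in_vertices[OF B(1)]])
      have "induced C ?V \<in> \<K>"
        by (rule K_iso[OF AB(2) is_struct_induced[OF C(1) c] emb_on_into_induced[OF b subset_refl]]) simp
      then have "irreducible_struct L (induced C ?V)" using R sub by blast
      moreover have "substructure L (induced C ?V) C" using substructure_iff[OF C(1)] c by blast
      ultimately have "struct_emb L (induced C ?V) K g" using g unfolding hom_embedding_def by simp
      then show "emb_on C ?V K g" unfolding struct_emb_iff by simp
    qed
    from arrows_ramsey_arrow[OF K_struct[OF K] A(1) B(1) k this]
    show ?thesis using K by blast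
  qed
  show ?thesis
  proof
    show "ramsey_class L \<K>" unfolding ramsey_class_def using main by blast
    show "\<forall>A\<in>\<K>. \<forall>B\<in>\<K>. \<exists>C\<in>\<K>. ramsey_arrow L C B A 2" using main by simp
  qed
qed

end
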